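(* Let $M\subset\mathbb C^{n+2}$ be a $C^3$-smooth generic submanifold of real codimension $d=2$ with $0\in M$, of finite type $m=(2)$ at $0$ and with nondegenerate Levi map at $0$, written in standard coordinates $(z,w)\in\mathbb C^n\times\mathbb C^2$. Then any $h=(z+f,w+g)\in Aut(M,0)$ is uniquely determined by the following partial derivatives of its components at $0$: - the first complex tangential derivatives $\dfrac{\partial f_j}{\partial z_k}(0)$, $j,k=1,\dots,n$; - the first and second order normal derivatives $\dfrac{\partial f_j}{\partial w_l}(0)$, $\dfrac{\partial g_u}{\partial w_l}(0)$, $\dfrac{\partial^2 g_u}{\partial w_s\,\partial w_l}(0)$, $j=1,\dots,n$, $u,l,s=1,2$. That is, if $h,\tilde h\in Aut(M,0)$ have the same values for all these derivatives, then $h=\tilde h$ as germs at $0$.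
   Context: $Aut(M,0)$ is the set of germs at $0$ of biholomorphisms of $\mathbb C^{n+2}$ that fix $0$ and map $M$ into itself; every such $h$ is written $h(z,w)=(z+f(z,w),\,w+g(z,w))$ with $f=(f_1,\dots,f_n)$ and $g=(g_1,g_2)$. Standard coordinates for a generic submanifold of finite type $m=(2)$ at $0$ (in the sense of Kohn and Bloom–Graham, all Hörmander numbers equal to $2$): with $w=u+iv$, $M$ is given near $0$ by $$v_j={}^t\bar z A_j z+R_j(z,\bar z,u),\qquad j=1,2,$$ where $A_1,A_2$ are Hermitian $n\times n$ matrices, and the $R_j$ are $C^3$-smooth real functions whose derivatives at $0$ of weighted order at most $2$ vanish, where $z,\bar z$ have weight $1$ and $u$ has weight $2$. Finite type $m=(2)$ at $0$ is equivalent to $A_1,A_2$ being linearly independent (over $\mathbb R$). The pair $(A_1,A_2)$ represents the Levi map of $M$ at $0$; it is nondegenerate if $\ker A_1\cap\ker A_2=\{0\}$. *)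

theory Defs
  imports "HOL-Analysis.Analysis"
begin

type_synonym 'n ambient = "(complex ^ 'n) \<times> (complex ^ 2)"

definition cscale :: "complex \<Rightarrow> ('n::finite) ambient \<Rightarrow> 'n ambient" where
  "cscale c p = (c *s fst p, c *s snd p)"


section \<open>Maps of class \<open>C\<^sup>k\<close>, Lie brackets, holomorphic maps\<close>

text \<open>The set \<^term>\<open>S\<close> is meant to be open.\<close>

fun Ck_on :: "nat \<Rightarrow> ('a::euclidean_space \<Rightarrow> 'b::euclidean_space) \<Rightarrow> 'a set \<Rightarrow> bool" where
  "Ck_on 0 F S \<longleftrightarrow> continuous_on S F"
| "Ck_on (Suc k) F S \<longleftrightarrow>
     F differentiable_on S \<and> (\<forall>v. Ck_on k (\<lambda>x. frechet_derivative F (at x) v) S)"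

definition lie_bracket ::
    "('a::euclidean_space \<Rightarrow> 'a) \<Rightarrow> ('a \<Rightarrow> 'a) \<Rightarrow> 'a \<Rightarrow> 'a" where
  "lie_bracket X Y p =
     frechet_derivative Y (at p) (X p) - frechet_derivative X (at p) (Y p)"

definition holo_on :: "(('n::finite) ambient \<Rightarrow> 'n ambient) \<Rightarrow> 'n ambient set \<Rightarrow> bool" where
  "holo_on h U \<longleftrightarrow>
     (\<forall>p\<in>U. \<exists>L. (h has_derivative L) (at p) \<and> (\<forall>c v. L (cscale c v) = cscale c (L v)))"

definition cpartial_z :: "'n \<Rightarrow> (('n::finite) ambient \<Rightarrow> complex) \<Rightarrow> 'n ambient \<Rightarrow> complex" where
  "cpartial_z k F p = deriv (\<lambda>t. F (p + (axis k t, 0))) 0"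

definition cpartial_w :: "2 \<Rightarrow> (('n::finite) ambient \<Rightarrow> complex) \<Rightarrow> 'n ambient \<Rightarrow> complex" where
  "cpartial_w l F p = deriv (\<lambda>t. F (p + (0, axis l t))) 0"


section \<open>Generic submanifolds of codimension two and finite type\<close>

text \<open>The \<open>(1,0)\<close>-part of the differential of a real function:
  \<open>\<partial>\<rho>(v) = (d\<rho>(v) - i d\<rho>(iv)) / 2\<close>.\<close>

definition del_form ::
    "(('n::finite) ambient \<Rightarrow> real) \<Rightarrow> 'n ambient \<Rightarrow> 'n ambient \<Rightarrow> complex" where
  "del_form \<rho> p v =
     (complex_of_real (frechet_derivative \<rho> (at p) v)
       - \<i> * complex_of_real (frechet_derivative \<rho> (at p) (cscale \<i> v))) / 2"

text \<open>Locally \<^term>\<open>M\<close> is the zero set of two real functions of class \<open>C\<^sup>3\<close> with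
  \<open>\<partial>\<rho>\<^sub>1 \<and> \<partial>\<rho>\<^sub>2 \<noteq> 0\<close> on \<^term>\<open>M\<close>.\<close>

definition generic_C3_submanifold_codim2 :: "('n::finite) ambient set \<Rightarrow> bool" where
  "generic_C3_submanifold_codim2 M \<longleftrightarrow>
     (\<forall>p\<in>M. \<exists>U (\<rho> :: 2 \<Rightarrow> 'n ambient \<Rightarrow> real).
        open U \<and> p \<in> U \<and> (\<forall>j. Ck_on 3 (\<rho> j) U) \<and>
        M \<inter> U = {q \<in> U. \<forall>j. \<rho> j q = 0} \<and>
        (\<forall>q \<in> M \<inter> U. \<forall>c :: 2 \<Rightarrow> complex.
           (\<forall>v. (\<Sum>j\<in>UNIV. c j * del_form (\<rho> j) q v) = 0) \<longrightarrow> (\<forall>j. c j = 0)))"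

definition tangent_space :: "('a::euclidean_space) set \<Rightarrow> 'a \<Rightarrow> 'a set" where
  "tangent_space M p =
     {v. \<exists>\<gamma> :: real \<Rightarrow> 'a. \<gamma> 0 = p \<and> (\<forall>t. \<gamma> t \<in> M) \<and> (\<gamma> has_vector_derivative v) (at 0)}"

definition complex_tangent_space :: "('n::finite) ambient set \<Rightarrow> 'n ambient \<Rightarrow> 'n ambient set" where
  "complex_tangent_space M p =
     {v. v \<in> tangent_space M p \<and> cscale \<i> v \<in> tangent_space M p}"

text \<open>Local sections of the complex tangent bundle of \<^term>\<open>M\<close> near \<^term>\<open>p\<close>, extended to a
  neighbourhood of \<^term>\<open>p\<close> in the ambient space. For \<^term>\<open>M\<close> of class \<open>C\<^sup>3\<close> this bundle is
  of class \<open>C\<^sup>2\<close>. The bracket of two such fields is tangent to \<^term>\<open>M\<close> and on \<^term>\<open>M\<close> it does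
  not depend on the extensions.\<close>

definition complex_tangent_field ::
    "('n::finite) ambient set \<Rightarrow> 'n ambient \<Rightarrow> ('n ambient \<Rightarrow> 'n ambient) \<Rightarrow> bool" where
  "complex_tangent_field M p X \<longleftrightarrow>
     (\<exists>U. open U \<and> p \<in> U \<and> Ck_on 2 X U \<and> (\<forall>q \<in> M \<inter> U. X q \<in> complex_tangent_space M q))"

text \<open>All Hoermander numbers at \<^term>\<open>p\<close> equal \<open>2\<close> (Kohn, Bloom--Graham): the values at
  \<^term>\<open>p\<close> of complex tangent fields and of their simple brackets span the tangent space. As
  \<^term>\<open>M\<close> is generic of codimension two, \<open>2\<close> is then a Hoermander number of multiplicity two.\<close>

definition finite_type_2 :: "('n::finite) ambient set \<Rightarrow> 'n ambient \<Rightarrow> bool" where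
  "finite_type_2 M p \<longleftrightarrow>
     span (complex_tangent_space M p \<union>
           {lie_bracket X Y p | X Y. complex_tangent_field M p X \<and> complex_tangent_field M p Y})
       = tangent_space M p"


section \<open>Standard coordinates and the Levi map\<close>

definition hermitian_matrix :: "complex ^ 'n ^ 'n \<Rightarrow> bool" where
  "hermitian_matrix A \<longleftrightarrow> (\<forall>i k. A $ i $ k = cnj (A $ k $ i))"

definition hermitian_form :: "complex ^ 'n ^ 'n \<Rightarrow> complex ^ ('n::finite) \<Rightarrow> complex" where
  "hermitian_form A z = (\<Sum>i\<in>UNIV. cnj (z $ i) * (A *v z) $ i)"

text \<open>Weights: \<open>1\<close> for real directions in \<^term>\<open>z\<close>, \<open>2\<close> for directions in \<^term>\<open>u\<close>. Hence the
  derivatives of weighted order at most \<open>2\<close> are the value, all first order derivatives, and the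
  second order derivatives in two \<^term>\<open>z\<close>-directions. Real derivatives in \<^term>\<open>z\<close>-directions
  span the same space as those with respect to \<^term>\<open>z\<close> and its conjugate.\<close>

definition vanishes_to_weighted_order_2 ::
    "((complex ^ ('n::finite)) \<times> (real ^ 2) \<Rightarrow> real) \<Rightarrow> bool" where
  "vanishes_to_weighted_order_2 R \<longleftrightarrow>
     R 0 = 0 \<and>
     (\<forall>\<zeta>. frechet_derivative R (at 0) (\<zeta>, 0) = 0) \<and>
     (\<forall>\<eta>. frechet_derivative R (at 0) (0, \<eta>) = 0) \<and>
     (\<forall>\<zeta> \<zeta>'. frechet_derivative (\<lambda>p. frechet_derivative R (at p) (\<zeta>, 0)) (at 0) (\<zeta>', 0) = 0)"

definition standard_coordinates ::
    "('n::finite) ambient set \<Rightarrow> (2 \<Rightarrow> complex ^ 'n ^ 'n) \<Rightarrow>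
      (2 \<Rightarrow> (complex ^ 'n) \<times> (real ^ 2) \<Rightarrow> real) \<Rightarrow> bool" where
  "standard_coordinates M A R \<longleftrightarrow>
     (\<forall>j. hermitian_matrix (A j)) \<and>
     (\<exists>U V. open U \<and> 0 \<in> U \<and> open V \<and> 0 \<in> V \<and>
        (\<forall>j. Ck_on 3 (R j) V \<and> vanishes_to_weighted_order_2 (R j)) \<and>
        (\<forall>(z, w) \<in> U. (z, \<chi> l. Re (w $ l)) \<in> V) \<and>
        M \<inter> U = {(z, w). (z, w) \<in> U \<and>
          (\<forall>j. complex_of_real (Im (w $ j)) =
                 hermitian_form (A j) z + complex_of_real (R j (z, \<chi> l. Re (w $ l))))})"

definition levi_nondegenerate :: "(2 \<Rightarrow> complex ^ 'n ^ ('n::finite)) \<Rightarrow> bool" where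
  "levi_nondegenerate A \<longleftrightarrow> {z. A 1 *v z = 0} \<inter> {z. A 2 *v z = 0} = {0}"


section \<open>Automorphism germs\<close>

text \<open>Total functions representing the germs in \<open>Aut(M,0)\<close>; only their values near \<open>0\<close> matter.\<close>

definition Aut0 :: "('n::finite) ambient set \<Rightarrow> ('n ambient \<Rightarrow> 'n ambient) set" where
  "Aut0 M = {h. h 0 = 0 \<and>
     (\<exists>U h'. open U \<and> 0 \<in> U \<and> holo_on h U \<and>
        open (h ` U) \<and> holo_on h' (h ` U) \<and> (\<forall>p\<in>U. h' (h p) = p) \<and>
        h ` (M \<inter> U) \<subseteq> M)}"

definition germ_eq :: "(('n::finite) ambient \<Rightarrow> 'n ambient) \<Rightarrow> ('n ambient \<Rightarrow> 'n ambient) \<Rightarrow> bool" where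
  "germ_eq h k \<longleftrightarrow> (\<forall>\<^sub>F p in nhds 0. h p = k p)"

text \<open>The components in \<open>h(z,w) = (z + f(z,w), w + g(z,w))\<close>.\<close>

definition f_comp :: "(('n::finite) ambient \<Rightarrow> 'n ambient) \<Rightarrow> 'n \<Rightarrow> 'n ambient \<Rightarrow> complex" where
  "f_comp h j p = (fst (h p) - fst p) $ j"

definition g_comp :: "(('n::finite) ambient \<Rightarrow> 'n ambient) \<Rightarrow> 2 \<Rightarrow> 'n ambient \<Rightarrow> complex" where
  "g_comp h u p = (snd (h p) - snd p) $ u"

end

(* Let D = h - k and expand it in weighted homogeneous terms (z of weight 1, w of weight 2).
   If all terms of D of lower weight vanish, the lowest ones (f, g), of weights m and m + 1,
   satisfy the linearised equation Im g = 2 Re <Lz, A f> on the quadric Im w = <z, A z>, where L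
   is the complex tangential part of dk(0). Polarisation turns it into an identity for pairs of points
   (z, w), (zeta, omega) with w - cnj omega = 2 i <zeta, A z>. The rescaling z -> s z,
   zeta -> zeta / cnj s together with Liouville's theorem determines the dependence on z, and
   comparing degrees in w gives f = g = 0, except for the weights m = 1, 2, 3, in which the
   prescribed derivatives enter. Finite type two makes A_1, A_2 linearly independent over the reals,
   so that for generic z the map zeta -> <zeta, A z> is onto C^2. *)

theory Submission
  imports Defs "HOL-Complex_Analysis.Conformal_Mappings"
begin

text \<open>M is only of class C^3, so it has no Taylor expansion to set against terms of D of high
  weight. What helps is that, after subtraction, the remainders enter through R_j(h) - R_j(k). At
  points of weighted size t the gradient of R_j is o(t) in z-directions and o(1) in u-directions,
  while D has components O(t^m) and O(t^(m+1)); the error is therefore o(t^(m+1)) for every m.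
  Working with h - k avoids composing with an inverse germ. The price is that the matrices K_j, the
  adjoint of L times A_j, are in general not Hermitian; their trivial common kernel and their
  independence over the complex numbers take over. The exceptional weights come from arithmetic: the
  even weight 2 p leads to the factor 2^p - 2, the odd weight 2 p + 1 to 2^p + 2 (-1)^p, and both
  vanish at p = 1. This leaves the w-linear part of f (m = 2) and the w-quadratic part of g (m = 3),
  besides the leading terms with m = 1.\<close>

no_notation fps_nth (infixl "$" 75)

section \<open>Sesquilinear algebra\<close>

definition cdot :: "complex ^ ('n::finite) \<Rightarrow> complex ^ 'n \<Rightarrow> complex" where
  "cdot x y = (\<Sum>i\<in>UNIV. cnj (x $ i) * y $ i)"

lemma cdot_add_left: "cdot (x + y) z = cdot x z + cdot y z"
  by (simp add: cdot_def algebra_simps sum.distrib)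

lemma cdot_add_right: "cdot z (x + y) = cdot z x + cdot z y"
  by (simp add: cdot_def algebra_simps sum.distrib)

lemma cdot_diff_left: "cdot (x - y) z = cdot x z - cdot y z"
  by (simp add: cdot_def algebra_simps sum_subtractf)

lemma cdot_diff_right: "cdot z (x - y) = cdot z x - cdot z y"
  by (simp add: cdot_def algebra_simps sum_subtractf)

lemma cdot_scale_left: "cdot (c *s x) y = cnj c * cdot x y"
  by (simp add: cdot_def sum_distrib_left algebra_simps)

lemma cdot_scale_right: "cdot x (c *s y) = c * cdot x y"
  by (simp add: cdot_def sum_distrib_left algebra_simps)

lemma cdot_minus_left: "cdot (- x) y = - cdot x y"
  by (simp add: cdot_def sum_negf)

lemma cdot_minus_right: "cdot x (- y) = - cdot x y"
  by (simp add: cdot_def sum_negf)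

lemma cdot_zero [simp]: "cdot 0 x = 0" "cdot x 0 = 0"
  by (simp_all add: cdot_def)

lemma cnj_cdot: "cnj (cdot x y) = cdot y x"
  by (simp add: cdot_def mult.commute)

lemma cdot_axis: "cdot (axis i 1) y = y $ i"
proof -
  have "cdot (axis i 1) y = (\<Sum>k\<in>UNIV. if k = i then y $ i else 0)"
    unfolding cdot_def axis_def by (rule sum.cong) auto
  then show ?thesis by simp
qed

lemma cdot_eq_0_imp: "(\<And>x. cdot x y = 0) \<Longrightarrow> y = 0"
  by (simp add: vec_eq_iff flip: cdot_axis)

lemma cdot_hermitian:
  assumes "hermitian_matrix A"
  shows "cdot x (A *v y) = cnj (cdot y (A *v x))"
proof -
  have *: "A $ i $ k = cnj (A $ k $ i)" for i k
    using assms unfolding hermitian_matrix_def by blast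
  have "cdot x (A *v y) = (\<Sum>i\<in>UNIV. \<Sum>k\<in>UNIV. cnj (x $ i) * (A $ i $ k * y $ k))"
    by (simp add: cdot_def matrix_vector_mult_def sum_distrib_left)
  also have "\<dots> = (\<Sum>k\<in>UNIV. \<Sum>i\<in>UNIV. cnj (x $ i) * (A $ i $ k * y $ k))"
    by (rule sum.swap)
  also have "\<dots> = (\<Sum>k\<in>UNIV. \<Sum>i\<in>UNIV. cnj (cnj (y $ k) * (A $ k $ i * x $ i)))"
    proof (intro sum.cong refl)
    fix i k
    show "cnj (x $ i) * (A $ i $ k * y $ k) = cnj (cnj (y $ k) * (A $ k $ i * x $ i))"
      by (subst *) simp
  qed
  also have "\<dots> = cnj (cdot y (A *v x))"
    by (simp add: cdot_def matrix_vector_mult_def sum_distrib_left)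
  finally show ?thesis .
qed

lemmas cdot_linear = cdot_add_left cdot_add_right cdot_scale_left cdot_scale_right
  cdot_diff_left cdot_diff_right cdot_minus_left cdot_minus_right

lemma matrix_vector_mult_uminus: "A *v (- x) = - (A *v x)"
  for A :: "complex ^ 'n ^ 'm"
  by (simp add: matrix_vector_mult_def vec_eq_iff sum_negf)

lemmas matrix_linear = matrix_vector_right_distrib vector_scalar_commute
  matrix_vector_mult_diff_distrib matrix_vector_mult_uminus


section \<open>Polarisation of the tangency equation\<close>

text \<open>Quadratic curves with a linear first component: this class of curves is
  stable under weighted dilations, and the weighted homogeneous terms of a holomorphic map are
  easily seen to be entire along them.\<close>

definition curve_entire :: "((complex ^ ('n::finite)) \<times> (complex ^ 2) \<Rightarrow> complex) \<Rightarrow> bool" where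
  "curve_entire F \<longleftrightarrow> (\<forall>a b w0 w1 w2.
     (\<lambda>x. F (a + x *s b, w0 + x *s w1 + x\<^sup>2 *s w2)) holomorphic_on UNIV)"

lemma curve_entireD:
  "curve_entire F \<Longrightarrow> (\<lambda>x. F (a + x *s b, w0 + x *s w1 + x\<^sup>2 *s w2)) holomorphic_on S"
  unfolding curve_entire_def using holomorphic_on_subset subset_UNIV by blast

lemma curve_entire_line:
  assumes "curve_entire F" shows "(\<lambda>x. F (a + x *s b, w)) holomorphic_on S"
  using curve_entireD [OF assms, of a b w 0 0] by simp

lemma holomorphic_cdot_right:
  assumes "\<And>i. (\<lambda>x. F x $ i) holomorphic_on S"
  shows "(\<lambda>x. cdot \<zeta> (F x)) holomorphic_on S"
  unfolding cdot_def by (intro holomorphic_intros assms)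

lemma holomorphic_matrix_component:
  assumes "\<And>i. (\<lambda>x. F x $ i) holomorphic_on S"
  shows "(\<lambda>x. (K *v F x) $ i) holomorphic_on S"
  unfolding matrix_vector_mult_def by (simp, intro holomorphic_intros assms)

lemma entire_eq_on_reals:
  assumes "F holomorphic_on UNIV" "G holomorphic_on UNIV"
    and "\<And>x::real. F (of_real x) = G (of_real x)"
  shows "F z = G z"
proof -
  have "(\<lambda>z. F z - G z) z = 0"
  proof (rule analytic_continuation [where f = "\<lambda>z. F z - G z" and S = UNIV and U = "range complex_of_real" and \<xi> = 0])
    show "(\<lambda>z. F z - G z) holomorphic_on UNIV" by (intro holomorphic_intros assms)
    show "0 islimpt range complex_of_real"
    proof (rule islimptI)
      fix T :: "complex set" assume "0 \<in> T" "open T"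
      then obtain e where e: "e > 0" "ball 0 e \<subseteq> T" using open_contains_ball by blast
      then have "complex_of_real (e/2) \<in> T" by (auto simp: subset_iff dist_norm)
      then show "\<exists>y\<in>range complex_of_real. y \<in> T \<and> y \<noteq> 0"
        using e(1) by (intro bexI [of _ "complex_of_real (e/2)"] rangeI) auto
    qed
  qed (use assms(3) in auto)
  then show ?thesis by simp
qed

text \<open>The pair \<open>f\<close>, \<open>g\<close> stands for the leading weighted terms of h -
  k, and \<open>K j\<close> for the adjoint of the tangential derivative of k times
  \<open>A j\<close>. Holomorphy is asked for along curves, the form in which polarisation consumes
  it.\<close>

locale tangency_equation =
  fixes A K :: "2 \<Rightarrow> complex ^ ('n::finite) ^ 'n"
    and f :: "(complex ^ 'n) \<times> (complex ^ 2) \<Rightarrow> complex ^ 'n"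
    and g :: "(complex ^ 'n) \<times> (complex ^ 2) \<Rightarrow> complex ^ 2"
  assumes herm: "\<And>l. hermitian_matrix (A l)"
    and f_entire: "\<And>i. curve_entire (\<lambda>p. f p $ i)"
    and g_entire: "\<And>j. curve_entire (\<lambda>p. g p $ j)"
    and tangency: "\<And>z w j. (\<And>l. complex_of_real (Im (w $ l)) = cdot z (A l *v z)) \<Longrightarrow>
           Im (g (z, w) $ j) = 2 * Re (cdot z (K j *v f (z, w)))"
begin

definition q :: "complex ^ 'n \<Rightarrow> complex ^ 'n \<Rightarrow> complex ^ 2" where
  "q z \<zeta> = (\<chi> l. cdot \<zeta> (A l *v z))"

lemma q_nth [simp]: "q z \<zeta> $ l = cdot \<zeta> (A l *v z)"
  by (simp add: q_def)

text \<open>Both sides extend holomorphically along the complex curve through \<open>(z, w)\<close>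
  (at \<open>x = \<i>\<close>) and \<open>(\<zeta>, \<omega>)\<close> (at \<open>x = -\<i>\<close>) whose real points lie on the quadric.\<close>

lemma polarise:
  assumes rel: "\<And>l. w $ l - cnj (\<omega> $ l) = 2 * \<i> * cdot \<zeta> (A l *v z)"
  shows "g (z, w) $ j - cnj (g (\<zeta>, \<omega>) $ j)
    = 2 * \<i> * (cdot \<zeta> (K j *v f (z, w)) + cnj (cdot z (K j *v f (\<zeta>, \<omega>))))"
proof -
  \<comment> \<open>\<open>Z\<close> is the complex line with Z(\<i>) = z and Z(-\<i>) =
    \<zeta>.\<close>
  define a where "a = (1/2) *s (z + \<zeta>)"
  define b where "b = (1/(2*\<i>)) *s (z - \<zeta>)"
  define Z where "Z x = a + x *s b" for x
  \<comment> \<open>Real vectors keep the points with real parameter on the quadric. Since s0 + \<i>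
    s1 is the mean of w and cnj \<omega>, the relation \<open>rel\<close> gives W(\<i>) = w and
    W(-\<i>) = \<omega>.\<close>
  define s0 :: "complex ^ 2" where "s0 = (\<chi> l. of_real (Re ((w $ l + cnj (\<omega> $ l))/2)))"
  define s1 :: "complex ^ 2" where "s1 = (\<chi> l. of_real (Im ((w $ l + cnj (\<omega> $ l))/2)))"
  define w0 where "w0 = s0 + \<i> *s q a a"
  define w1 where "w1 = s1 + \<i> *s (q a b + q b a)"
  define w2 where "w2 = \<i> *s q b b"
  define W where "W x = w0 + x *s w1 + x\<^sup>2 *s w2" for x
  have W_nth: "W x $ l = s0 $ l + x * s1 $ l + \<i> * cdot (Z (cnj x)) (A l *v Z x)" for x l
    by (simp add: W_def w0_def w1_def w2_def Z_def cdot_linear matrix_linear algebra_simps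
        power2_eq_square)
  have Zi: "Z \<i> = z" "Z (-\<i>) = \<zeta>"
    by (simp_all add: Z_def a_def b_def vec_eq_iff field_simps)
  have s: "s0 $ l + \<i> * s1 $ l = (w $ l + cnj (\<omega> $ l)) / 2" for l
    unfolding s0_def s1_def by (simp add: complex_eq_iff)
  have s': "s0 $ l - \<i> * s1 $ l = cnj ((w $ l + cnj (\<omega> $ l)) / 2)" for l
    unfolding s [symmetric] by (simp add: s0_def s1_def)
  have Wi: "W \<i> = w"
    unfolding vec_eq_iff
  proof
    fix l
    have "W \<i> $ l = (w $ l + cnj (\<omega> $ l)) / 2 + \<i> * cdot \<zeta> (A l *v z)"
      using W_nth [of \<i> l] s [of l] by (simp add: Zi)
    also have "\<dots> = (w $ l + cnj (\<omega> $ l)) / 2 + (w $ l - cnj (\<omega> $ l)) / 2"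
      unfolding rel by simp
    finally show "W \<i> $ l = w $ l" by (simp add: field_simps)
  qed
  have Wi': "W (-\<i>) = \<omega>"
    unfolding vec_eq_iff
  proof
    fix l
    have "W (-\<i>) $ l = cnj ((w $ l + cnj (\<omega> $ l)) / 2) + \<i> * cdot z (A l *v \<zeta>)"
      using W_nth [of "-\<i>" l] s' [of l] by (simp add: Zi)
    also have "\<i> * cdot z (A l *v \<zeta>) = - cnj (\<i> * cdot \<zeta> (A l *v z))"
      using cdot_hermitian [OF herm, of z l \<zeta>] by simp
    also have "\<i> * cdot \<zeta> (A l *v z) = (w $ l - cnj (\<omega> $ l)) / 2"
      unfolding rel by simp
    finally show "W (-\<i>) $ l = \<omega> $ l" by (simp add: field_simps)
  qed
  define G where "G x = g (Z x, W x) $ j" for x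
  define F where "F x = f (Z x, W x)" for x
  have holG: "G holomorphic_on UNIV"
    unfolding G_def Z_def W_def by (rule curve_entireD [OF g_entire])
  have holF: "(\<lambda>x. F x $ i) holomorphic_on UNIV" for i
    unfolding F_def Z_def W_def by (rule curve_entireD [OF f_entire])
  define P where "P x = cdot (Z (cnj x)) (K j *v F x)" for x
  have holP: "P holomorphic_on UNIV"
  proof -
    \<comment> \<open>The conjugate-linear slot is evaluated at the conjugate parameter, so P is
      holomorphic in x.\<close>
    have "P = (\<lambda>x. cdot a (K j *v F x) + x * cdot b (K j *v F x))"
      by (simp add: P_def Z_def cdot_linear fun_eq_iff)
    then show ?thesis
      by (auto intro!: holomorphic_intros holomorphic_cdot_right holomorphic_matrix_component holF)
  qed
  have cc: "(\<lambda>x. cnj (H (cnj x))) holomorphic_on UNIV" if "H holomorphic_on UNIV" for H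
    using holomorphic_on_compose_cnj_cnj [of H UNIV] that
    by (simp add: o_def surjI [of cnj cnj])
  have main: "G x - cnj (G (cnj x)) = 2 * \<i> * (P x + cnj (P (cnj x)))" for x
  proof (rule entire_eq_on_reals [where F = "\<lambda>x. G x - cnj (G (cnj x))"])
    show "(\<lambda>x. G x - cnj (G (cnj x))) holomorphic_on UNIV"
      by (intro holomorphic_intros cc holG)
    show "(\<lambda>x. 2 * \<i> * (P x + cnj (P (cnj x)))) holomorphic_on UNIV"
      by (intro holomorphic_intros cc holP)
    fix x :: real
    let ?x = "complex_of_real x"
    have real: "Im (cdot (Z ?x) (A l *v Z ?x)) = 0" for l
      using arg_cong [OF cdot_hermitian [OF herm, of "Z ?x" l "Z ?x"], of Im] by simp
    have "complex_of_real (Im (W ?x $ l)) = cdot (Z ?x) (A l *v Z ?x)" for l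
      using real [of l] by (simp add: W_nth s0_def s1_def complex_eq_iff)
    from tangency [OF this, of j]
    have "Im (G ?x) = 2 * Re (P ?x)" by (simp add: G_def P_def F_def)
    then show "G ?x - cnj (G (cnj ?x)) = 2 * \<i> * (P ?x + cnj (P (cnj ?x)))"
      by (simp add: complex_eq_iff)
  qed
  show ?thesis
    using main [of \<i>] by (simp add: G_def F_def P_def Zi Wi Wi')
qed

end


section \<open>Weighted homogeneous solutions\<close>

lemma cdot_self: "cdot x x = of_real ((norm x)\<^sup>2)"
proof -
  have "cdot x x = (\<Sum>i\<in>UNIV. of_real ((norm (x $ i))\<^sup>2))"
    unfolding cdot_def by (intro sum.cong refl) (metis complex_norm_square mult.commute of_real_power)
  also have "\<dots> = of_real (\<Sum>i\<in>UNIV. (norm (x $ i))\<^sup>2)" by simp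
  also have "(\<Sum>i\<in>UNIV. (norm (x $ i))\<^sup>2) = (norm x)\<^sup>2"
    by (simp add: norm_vec_def L2_set_def sum_nonneg)
  finally show ?thesis .
qed

lemma cdot_self_eq_0 [simp]: "cdot x x = 0 \<longleftrightarrow> x = 0"
  by (simp add: cdot_self)

text \<open>Subtract from x its projection to p: the rest is orthogonal to p, hence by assumption to
  x, hence to itself.\<close>

lemma cdot_annihilator:
  assumes "\<And>\<zeta>. cdot \<zeta> p = 0 \<Longrightarrow> cdot \<zeta> x = 0"
  obtains c where "x = c *s p"
proof (cases "p = 0")
  case True
  then have "x = 0" using assms by (simp add: cdot_eq_0_imp)
  then show ?thesis using that [of 0] by simp
next
  case False
  define c where "c = cdot p x / cdot p p"
  define \<zeta> where "\<zeta> = x - c *s p"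
  have "cdot p \<zeta> = 0"
    using False by (simp add: \<zeta>_def c_def cdot_linear)
  then have *: "cdot \<zeta> p = 0" by (metis cnj_cdot complex_cnj_zero)
  then have "cdot \<zeta> x = 0" by (rule assms)
  then have "cdot \<zeta> \<zeta> = 0"
    using * unfolding \<zeta>_def by (simp add: cdot_diff_right cdot_scale_right)
  then have "x = c *s p" by (simp add: \<zeta>_def)
  then show ?thesis by (rule that)
qed

text \<open>Evaluating the form at x + z and at x + \<i> z recovers the sesquilinear pairing from
  its diagonal.\<close>

lemma hermitian_form_0_imp:
  assumes "hermitian_matrix A" and 0: "\<And>z. cdot z (A *v z) = 0"
  shows "A *v z = 0"
proof (rule cdot_eq_0_imp)
  fix x
  have "cdot x (A *v z) + cdot z (A *v x) = 0"
    using 0 [of "x + z"] by (simp add: cdot_linear matrix_linear 0 add.commute)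
  moreover have "\<i> * cdot x (A *v z) - \<i> * cdot z (A *v x) = 0"
    using 0 [of "x + \<i> *s z"] by (simp add: cdot_linear matrix_linear 0)
  then have "cdot x (A *v z) = cdot z (A *v x)" by (simp flip: right_diff_distrib)
  ultimately show "cdot x (A *v z) = 0" by simp
qed

text \<open>If one of z, \<zeta> is 0, the relation between the two points in
  \<open>polarise\<close> becomes \<omega> = \<open>cjv w\<close>.\<close>

definition cjv :: "complex ^ 'n \<Rightarrow> complex ^ 'n" where
  "cjv w = (\<chi> l. cnj (w $ l))"

lemma cjv_nth [simp]: "cjv w $ l = cnj (w $ l)"
  by (simp add: cjv_def)

lemma cjv_simps [simp]: "cjv (cjv w) = w" "cjv 0 = 0" "cjv (c *s w) = cnj c *s cjv w"
  by (simp_all add: vec_eq_iff)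

text \<open>For large s the argument 1 / cnj s stays in the unit disc, where \<psi> is bounded, so
  \<phi> grows at most like s^2 and Liouville makes it a quadratic polynomial.\<close>

lemma quadratic_growth:
  assumes "\<psi> holomorphic_on UNIV" "\<phi> holomorphic_on UNIV"
    and eq: "\<And>s. s \<noteq> 0 \<Longrightarrow> \<phi> s = s * C - s\<^sup>2 * cnj (\<psi> (1 / cnj s))"
  obtains a b c where "\<And>s. \<phi> s = a + b * s + c * s\<^sup>2" "c = - cnj (\<psi> 0)"
proof -
  have cont: "continuous_on UNIV \<psi>" using assms(1) holomorphic_on_imp_continuous_on by blast
  have "compact (\<psi> ` cball 0 1)"
    by (intro compact_continuous_image continuous_on_subset [OF cont]) auto
  then obtain B where B: "\<And>r. norm r \<le> 1 \<Longrightarrow> norm (\<psi> r) \<le> B"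
    using compact_imp_bounded bounded_iff by (metis image_eqI mem_cball_0)
  have bound: "norm (\<phi> s) \<le> (norm C + B) * norm s ^ 2" if "1 \<le> norm s" for s
  proof -
    have "s \<noteq> 0" using that by auto
    have "norm (\<psi> (1 / cnj s)) \<le> B" using that by (intro B) (simp add: norm_divide divide_le_eq_1)
    then have "norm (s\<^sup>2 * cnj (\<psi> (1 / cnj s))) \<le> norm s ^ 2 * B"
      by (simp add: norm_mult norm_power mult_left_mono)
    moreover have "norm (s * C) \<le> norm s ^ 2 * norm C"
      using that self_le_power [of "norm s" 2] by (simp add: norm_mult mult_right_mono)
    ultimately show ?thesis
      unfolding eq [OF \<open>s \<noteq> 0\<close>] using norm_triangle_ineq4 [of "s * C" "s\<^sup>2 * cnj (\<psi> (1 / cnj s))"]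
      by (simp add: algebra_simps)
  qed
  have poly: "\<phi> s = (\<Sum>k\<le>2. (deriv ^^ k) \<phi> 0 / fact k * s ^ k)" for s
    by (rule Liouville_polynomial [OF assms(2)]) (use bound in auto)
  define a where "a = \<phi> 0"
  define b where "b = deriv \<phi> 0"
  define c where "c = (deriv ^^ 2) \<phi> 0 / 2"
  have abc: "\<phi> s = a + b * s + c * s\<^sup>2" for s
    unfolding poly [of s] by (simp add: a_def b_def c_def eval_nat_numeral)
  \<comment> \<open>The leading coefficient is the limit of \<phi>(s) / s^2 along s = 1 / r with r
    real and tending to 0.\<close>
  have "(\<lambda>n. 1 / complex_of_real (real (Suc n))) \<longlonglongrightarrow> 0"
    using LIMSEQ_inverse_real_of_nat
    by (metis (no_types, lifting) ext inverse_eq_divide of_real_0 of_real_1 of_real_divide tendsto_of_real)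
  then have r: "(\<lambda>n. complex_of_real (1 / real (Suc n))) \<longlonglongrightarrow> 0" by simp
  let ?r = "\<lambda>n. complex_of_real (1 / real (Suc n))"
  have "(\<lambda>n. C * ?r n - cnj (\<psi> (?r n)) - a * (?r n)\<^sup>2 - b * ?r n)
          \<longlonglongrightarrow> C * 0 - cnj (\<psi> 0) - a * 0\<^sup>2 - b * 0"
    by (intro tendsto_intros r continuous_on_tendsto_compose [OF cont]) auto
  moreover have "C * ?r n - cnj (\<psi> (?r n)) - a * (?r n)\<^sup>2 - b * ?r n = c" for n
  proof -
    define r where "r = ?r n"
    have r: "r \<noteq> 0" "cnj r = r" unfolding r_def by (auto simp del: of_nat_Suc)
    have "a + b * (1/r) + c * (1/r)\<^sup>2 = (1/r) * C - (1/r)\<^sup>2 * cnj (\<psi> r)"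
      using eq [of "1/r"] abc [of "1/r"] r by simp
    then have "C * r - cnj (\<psi> r) - a * r\<^sup>2 - b * r = c"
      using r(1) by (simp add: field_simps power2_eq_square)
    then show ?thesis by (simp add: r_def)
  qed
  ultimately have "c = - cnj (\<psi> 0)"
    using LIMSEQ_unique [OF tendsto_const] by fastforce
  with abc show ?thesis by (rule that)
qed

text \<open>Pairing f with a z-linear term raises the weight by one, whence m for f and m + 1 for g.
  Independence is real for the Hermitian \<open>A j\<close> but complex for
  \<open>K j\<close>.\<close>

locale homogeneous_tangency = tangency_equation A K f g
  for A K :: "2 \<Rightarrow> complex ^ ('n::finite) ^ 'n" and f g +
  fixes m :: nat
  assumes indep: "\<And>x y::real. (\<And>z. complex_of_real x *s (A 1 *v z) + of_real y *s (A 2 *v z) = 0)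
      \<Longrightarrow> x = 0 \<and> y = 0"
    and nondeg: "\<And>z. A 1 *v z = 0 \<Longrightarrow> A 2 *v z = 0 \<Longrightarrow> z = 0"
    and nondegK: "\<And>z. (\<And>j. K j *v z = 0) \<Longrightarrow> z = 0"
    and indepK: "\<And>c d. (\<And>z. c *s (K 1 *v z) = d *s (K 2 *v z)) \<Longrightarrow> c = 0 \<and> d = 0"
    and f_hom: "\<And>t z w. f (t *s z, t\<^sup>2 *s w) = t ^ m *s f (z, w)"
    and g_hom: "\<And>t z w. g (t *s z, t\<^sup>2 *s w) = t ^ (m + 1) *s g (z, w)"
    and m_pos: "m \<ge> 1"
begin

text \<open>Independence of A_1 z and A_2 z over the complex numbers. In terms of minors its failure
  is a polynomial condition on z.\<close>

definition good :: "complex ^ 'n \<Rightarrow> bool" where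
  "good z \<longleftrightarrow> (\<exists>i k. (A 1 *v z) $ i * (A 2 *v z) $ k \<noteq> (A 1 *v z) $ k * (A 2 *v z) $ i)"

text \<open>If \<open>A\<^sub>1 z\<close> and \<open>A\<^sub>2 z\<close> were always dependent, pick \<open>z\<close> on which the Hermitian forms do
  not both vanish: the combination \<open>B\<close> of the two matrices with \<open>B z = 0\<close> is then zero.\<close>

lemma good_exists: "\<exists>z. good z"
proof (rule ccontr)
  assume "\<nexists>z. good z"
  then have minor: "(A 1 *v z) $ i * (A 2 *v z) $ k = (A 1 *v z) $ k * (A 2 *v z) $ i" for z i k
    unfolding good_def by blast
  have "\<exists>z. cdot z (A 1 *v z) \<noteq> 0"
  proof (rule ccontr)
    assume "\<nexists>z. cdot z (A 1 *v z) \<noteq> 0"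
    then have "A 1 *v z = 0" for z using hermitian_form_0_imp [OF herm] by blast
    then show False using indep [of 1 0] by simp
  qed
  then obtain z where z: "cdot z (A 1 *v z) \<noteq> 0" by blast
  have real: "\<exists>r. cdot z (A l *v z) = complex_of_real r" for l
    using cdot_hermitian [OF herm, of z l z] by (metis Reals_cnj_iff Reals_cases)
  obtain \<alpha> \<beta> where ab: "cdot z (A 1 *v z) = complex_of_real \<alpha>" "cdot z (A 2 *v z) = complex_of_real \<beta>"
    using real by metis
  define B where "B x = of_real \<beta> *s (A 1 *v x) - of_real \<alpha> *s (A 2 *v x)" for x
  \<comment> \<open>B and C arise from A_1, A_2 by a matrix of determinant \<alpha>^2 + \<beta>^2,
    so their minors vanish as well; moreover <z, C z> = \<alpha>^2 + \<beta>^2 is nonzero.\<close>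
  define C where "C x = of_real \<alpha> *s (A 1 *v x) + of_real \<beta> *s (A 2 *v x)" for x
  have BC: "B x $ i * C x $ k = B x $ k * C x $ i" for x i k
  proof -
    have "B x $ i * C x $ k - B x $ k * C x $ i
      = (of_real \<beta> ^ 2 + of_real \<alpha> ^ 2) *
        ((A 1 *v x) $ i * (A 2 *v x) $ k - (A 1 *v x) $ k * (A 2 *v x) $ i)"
      by (simp add: B_def C_def algebra_simps power2_eq_square)
    then show ?thesis using minor [of x i k] by simp
  qed
  have Badd: "B (x + y) = B x + B y" "C (x + y) = C x + C y" for x y
    by (simp_all add: B_def C_def matrix_linear vec_eq_iff algebra_simps)
  have "B z = 0"
    unfolding vec_eq_iff
  proof
    fix i
    have "(A 1 *v z) $ i * cdot z (A 2 *v z) = cdot z (A 1 *v z) * (A 2 *v z) $ i"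
      unfolding cdot_def sum_distrib_left sum_distrib_right
      using minor [of z i] by (intro sum.cong refl) (simp add: algebra_simps)
    then show "B z $ i = 0 $ i" by (simp add: B_def ab mult.commute)
  qed
  have "B \<zeta> = 0" for \<zeta>
    unfolding vec_eq_iff
  proof
    fix i
    \<comment> \<open>In the minor at z + \<zeta> everything cancels except the products of B
      \<zeta> with C z, because B z = 0. Pairing with z then gives B \<zeta> <z, C z> = <z, B
      \<zeta>> C z, and <z, B \<zeta>> is conjugate to <\<zeta>, B z> = 0.\<close>
    have "B \<zeta> $ i * C z $ k = B \<zeta> $ k * C z $ i" for k
      using BC [of "z + \<zeta>" i k] BC [of \<zeta> i k] by (simp add: Badd \<open>B z = 0\<close> algebra_simps)
    then have "B \<zeta> $ i * cdot z (C z) = cdot z (B \<zeta>) * C z $ i"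
      unfolding cdot_def sum_distrib_left sum_distrib_right
      by (intro sum.cong refl) (simp add: algebra_simps)
    moreover have "cdot z (B \<zeta>) = cnj (cdot \<zeta> (B z))"
      using cdot_hermitian [OF herm, of z 1 \<zeta>] cdot_hermitian [OF herm, of z 2 \<zeta>]
      by (simp add: B_def cdot_linear)
    moreover have "cdot z (C z) = of_real (\<alpha>^2 + \<beta>^2)"
      by (simp add: C_def cdot_linear ab power2_eq_square)
    moreover have "\<alpha> \<noteq> 0" using z ab by auto
    then have "complex_of_real (\<alpha>^2 + \<beta>^2) \<noteq> 0"
      by (metis of_real_eq_0_iff power2_less_0 sum_power2_eq_zero_iff)
    ultimately show "B \<zeta> $ i = 0 $ i" using \<open>B z = 0\<close> by simp
  qed
  then have "of_real \<beta> *s (A 1 *v x) + of_real (- \<alpha>) *s (A 2 *v x) = 0" for x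
    unfolding B_def by (simp add: vec_eq_iff)
  then have "\<alpha> = 0" using indep by (metis neg_equal_0_iff_equal)
  then show False using z ab by simp
qed

lemma good_independent:
  assumes "good z" "a *s (A 1 *v z) + b *s (A 2 *v z) = 0"
  shows "a = 0" "b = 0"
proof -
  obtain i k where ik: "(A 1 *v z) $ i * (A 2 *v z) $ k \<noteq> (A 1 *v z) $ k * (A 2 *v z) $ i"
    using assms(1) good_def by blast
  have *: "a * (A 1 *v z) $ i + b * (A 2 *v z) $ i = 0" for i
    using arg_cong [OF assms(2), of "\<lambda>v. v $ i"] by simp
  show "a = 0" using *[of i] *[of k] ik by algebra
  show "b = 0" using *[of i] *[of k] ik by algebra
qed

text \<open>Cramer's rule for a nonzero minor; \<zeta> is supported on its two coordinates, with
  conjugated coefficients because \<open>q\<close> is conjugate-linear in \<zeta>.\<close>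

lemma good_onto:
  assumes "good z" obtains \<zeta> where "q z \<zeta> = \<eta>"
proof -
  obtain i k where ik: "(A 1 *v z) $ i * (A 2 *v z) $ k \<noteq> (A 1 *v z) $ k * (A 2 *v z) $ i"
    using assms good_def by blast
  define d where "d = (A 1 *v z) $ i * (A 2 *v z) $ k - (A 1 *v z) $ k * (A 2 *v z) $ i"
  have "d \<noteq> 0" using ik by (simp add: d_def)
  define a where "a = (\<eta> $ 1 * (A 2 *v z) $ k - \<eta> $ 2 * (A 1 *v z) $ k) / d"
  define b where "b = ((A 1 *v z) $ i * \<eta> $ 2 - (A 2 *v z) $ i * \<eta> $ 1) / d"
  have "q z (cnj a *s axis i 1 + cnj b *s axis k 1) $ l = \<eta> $ l" for l
  proof -
    have "d * (a * (A 1 *v z) $ i + b * (A 1 *v z) $ k) = d * \<eta> $ 1"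
      "d * (a * (A 2 *v z) $ i + b * (A 2 *v z) $ k) = d * \<eta> $ 2"
      using \<open>d \<noteq> 0\<close> by (simp_all add: a_def b_def distrib_left) (simp_all add: d_def algebra_simps)
    then have "\<forall>l. a * (A l *v z) $ i + b * (A l *v z) $ k = \<eta> $ l"
      using \<open>d \<noteq> 0\<close> by (simp add: forall_2)
    then show ?thesis by (simp add: cdot_linear cdot_axis)
  qed
  then have "q z (cnj a *s axis i 1 + cnj b *s axis k 1) = \<eta>" by (simp add: vec_eq_iff)
  then show ?thesis by (rule that)
qed

text \<open>Along the line a minor is a quadratic polynomial in t whose leading coefficient is the
  minor at z.\<close>

lemma finite_not_good:
  assumes "good z" shows "finite {t. \<not> good (y + t *s z)}"
proof -
  obtain i k where ik: "(A 1 *v z) $ i * (A 2 *v z) $ k \<noteq> (A 1 *v z) $ k * (A 2 *v z) $ i"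
    using assms good_def by blast
  let ?m = "\<lambda>x y. (A 1 *v x) $ i * (A 2 *v y) $ k - (A 1 *v x) $ k * (A 2 *v y) $ i"
  let ?p = "[:?m y y, ?m y z + ?m z y, ?m z z:]"
  have "finite {t. poly ?p t = 0}" by (rule poly_roots_finite) (use ik in simp)
  moreover have "poly ?p t = ?m (y + t *s z) (y + t *s z)" for t
    by (simp add: matrix_linear algebra_simps)
  then have "{t. \<not> good (y + t *s z)} \<subseteq> {t. poly ?p t = 0}" by (auto simp: good_def)
  ultimately show ?thesis by (rule finite_subset [rotated])
qed

text \<open>On a line y + t z with q z y nonzero, all but finitely many points are admissible. The
  pairing with x is affine in cnj t, so two zeros make it vanish at t = 0 too.\<close>

lemma generic_separates:
  assumes z: "good z" and 0: "\<And>\<zeta>. good \<zeta> \<Longrightarrow> q z \<zeta> \<noteq> 0 \<Longrightarrow> cdot \<zeta> x = 0"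
  shows "x = 0"
proof -
  have *: "cdot y x = 0" if y: "q z y \<noteq> 0" for y
  proof -
    obtain l where l: "q z y $ l \<noteq> 0" using y by (auto simp: vec_eq_iff)
    \<comment> \<open>A component l in which q z y is nonzero already determines t, if there is a
      solution at all.\<close>
    have "{t. q z (y + t *s z) = 0} \<subseteq> {- cnj (q z y $ l / q z z $ l)}"
    proof clarify
      fix t assume "q z (y + t *s z) = 0"
      then have "q z (y + t *s z) $ l = 0" by simp
      then have "q z y $ l + cnj t * q z z $ l = 0" by (simp add: cdot_linear)
      moreover from this have "q z z $ l \<noteq> 0" using l by auto
      ultimately have "cnj t = - (q z y $ l / q z z $ l)"
        by (simp add: field_simps del: q_nth) (metis add.commute eq_neg_iff_add_eq_0)
      then show "t = - cnj (q z y $ l / q z z $ l)"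
        by (metis complex_cnj_cnj complex_cnj_minus)
    qed
    then have "finite ({t. q z (y + t *s z) = 0} \<union> {t. \<not> good (y + t *s z)})"
      using finite_not_good [OF z] finite_subset by blast
    then obtain s t where "s \<notin> {t. q z (y + t *s z) = 0} \<union> {t. \<not> good (y + t *s z)}"
      "t \<notin> insert s ({t. q z (y + t *s z) = 0} \<union> {t. \<not> good (y + t *s z)})"
      by (metis ex_new_if_finite finite.insertI infinite_UNIV_char_0)
    then have s: "q z (y + s *s z) \<noteq> 0" "good (y + s *s z)"
      and t: "q z (y + t *s z) \<noteq> 0" "good (y + t *s z)" "t \<noteq> s" by auto
    have "cdot y x + cnj s * cdot z x = 0" "cdot y x + cnj t * cdot z x = 0"
      using 0 [OF s(2,1)] 0 [OF t(2,1)] by (simp_all add: cdot_linear)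
    moreover have "cnj s \<noteq> cnj t" using t by simp
    ultimately show ?thesis by algebra
  qed
  obtain \<xi> where \<xi>: "q z \<xi> = axis 1 1" using good_onto [OF z] .
  have ne: "axis 1 1 \<noteq> (0 :: complex ^ 2)" by (simp add: axis_eq_0_iff)
  show ?thesis
  proof (rule cdot_eq_0_imp)
    fix y
    show "cdot y x = 0"
    proof (cases "q z y = 0")
      case True
      \<comment> \<open>A vector y in the kernel of q z is the difference of y + \<xi> and \<xi>,
        both outside it.\<close>
      have "q z (y + \<xi>) = q z y + q z \<xi>" by (simp add: vec_eq_iff cdot_linear)
      then have "cdot (y + \<xi>) x = 0" using True \<xi> ne by (intro *) simp
      then show ?thesis using *[of \<xi>] \<xi> ne by (simp add: cdot_linear)
    qed (rule *)
  qed
qed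

lemma good_separates: "(\<And>\<zeta>. good \<zeta> \<Longrightarrow> cdot \<zeta> x = 0) \<Longrightarrow> x = 0"
  using generic_separates good_exists by blast

end

section \<open>Elimination of g away from the axis z = 0\<close>

context homogeneous_tangency
begin

text \<open>Polarisation against the axis point (0, \<open>cjv w\<close>): g is determined by the
  values of f and g on the axis.\<close>

lemma g_from_axis:
  "g (z, w) $ j = cnj (g (0, cjv w) $ j) + 2 * \<i> * cnj (cdot z (K j *v f (0, cjv w)))"
  using polarise [of w "cjv w" 0 z j] by (simp add: algebra_simps)

text \<open>Inserting \<open>g_from_axis\<close> at both points of \<open>polarise\<close> leaves an
  equation for f in which g occurs on the axis alone.\<close>

lemma axis_difference:
  assumes "w - w' = 2 * \<i> *s q z \<zeta>"
  shows "g (0, w) $ j - g (0, w') $ j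
    = 2 * \<i> * (cdot \<zeta> (K j *v (f (z, w) - f (0, w')))
        + cnj (cdot z (K j *v (f (\<zeta>, cjv w') - f (0, cjv w)))))"
proof -
  have "w $ l - cnj (cjv w' $ l) = 2 * \<i> * cdot \<zeta> (A l *v z)" for l
    using arg_cong [OF assms, of "\<lambda>v. v $ l"] by simp
  from polarise [OF this, of j] show ?thesis
    using g_from_axis [of z w j] g_from_axis [of \<zeta> "cjv w'" j] g_from_axis [of 0 w j]
    by (simp add: cdot_linear matrix_linear algebra_simps)
qed

text \<open>The dilation by -1 fixes the axis and multiplies f by (-1)^m.\<close>

lemma f_axis_odd:
  assumes "odd m" shows "f (0, w) = 0"
proof -
  have "f (0, w) = - f (0, w)"
    using f_hom [of "-1" 0 w] assms by (simp add: vec_eq_iff)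
  then show ?thesis by (simp add: vec_eq_iff)
qed

lemma g_axis_even:
  assumes "even m" shows "g (0, w) = 0"
proof -
  have "g (0, w) = - g (0, w)"
    using g_hom [of "-1" 0 w] assms by (simp add: vec_eq_iff)
  then show ?thesis by (simp add: vec_eq_iff)
qed

lemma entire_pairing: "(\<lambda>s. cdot \<zeta> (K j *v f (s *s z, w))) holomorphic_on S"
  using curve_entire_line [OF f_entire, of 0 z w]
  by (intro holomorphic_cdot_right holomorphic_matrix_component) simp

lemma K_separates: "(\<And>\<zeta> j. cdot \<zeta> (K j *v x) = 0) \<Longrightarrow> x = 0"
  using nondegK cdot_eq_0_imp by metis

lemma K_separates': "(\<And>\<zeta> j. cdot \<zeta> (K j *v x) = cdot \<zeta> (K j *v y)) \<Longrightarrow> x = y"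
  using K_separates [of "x - y"] by (simp add: matrix_linear cdot_linear)


subsection \<open>Odd weight\<close>

text \<open>Replacing \<open>(z, \<zeta>)\<close> by \<open>(s z, \<zeta> / cnj s)\<close> preserves \<open>q z \<zeta>\<close>; a growth estimate in
  \<open>s\<close> then forces linearity.\<close>

lemma f_linear_scaling:
  assumes "odd m" shows "f (s *s z, w) = s *s f (z, w)"
proof (rule K_separates')
  fix \<zeta> j
  \<comment> \<open>The axis point paired with w; it is unchanged when z and \<zeta> are
    rescaled.\<close>
  define w' where "w' = w - 2 * \<i> *s q z \<zeta>"
  define \<phi> where "\<phi> s = cdot \<zeta> (K j *v f (s *s z, w))" for s
  define \<psi> where "\<psi> r = cdot z (K j *v f (r *s \<zeta>, cjv w'))" for r
  define C where "C = (g (0, w) $ j - g (0, w') $ j) / (2 * \<i>)"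
  have hol: "\<phi> holomorphic_on UNIV" "\<psi> holomorphic_on UNIV"
    unfolding \<phi>_def \<psi>_def by (rule entire_pairing)+
  have 0: "\<phi> 0 = 0" "\<psi> 0 = 0" by (simp_all add: \<phi>_def \<psi>_def f_axis_odd [OF assms])
  have eq: "\<phi> s = s * C - s\<^sup>2 * cnj (\<psi> (1 / cnj s))" if "s \<noteq> 0" for s
  proof -
    have "q (s *s z) ((1 / cnj s) *s \<zeta>) = q z \<zeta>"
      using that by (simp add: vec_eq_iff cdot_linear matrix_linear)
    then have "w - w' = 2 * \<i> *s q (s *s z) ((1 / cnj s) *s \<zeta>)" by (simp add: w'_def)
    from axis_difference [OF this, of j]
    have "C = (1 / s) * \<phi> s + s * cnj (\<psi> (1 / cnj s))"
      by (simp add: C_def \<phi>_def \<psi>_def f_axis_odd [OF assms] cdot_linear)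
    then show ?thesis using that by (simp add: field_simps power2_eq_square)
  qed
  obtain a b c where abc: "\<And>s. \<phi> s = a + b * s + c * s\<^sup>2" "c = - cnj (\<psi> 0)"
    using quadratic_growth [OF hol(2,1) eq] by blast
  \<comment> \<open>f vanishes on the axis, so \<phi>(0) = 0 removes the constant term and \<psi>(0)
    = 0 the quadratic one.\<close>
  then have "\<phi> s = b * s" for s using 0 abc(1) [of 0] by simp
  then have "\<phi> s = s * \<phi> 1" by simp
  then show "cdot \<zeta> (K j *v f (s *s z, w)) = cdot \<zeta> (K j *v (s *s f (z, w)))"
    by (simp add: \<phi>_def cdot_linear matrix_linear)
qed

text \<open>Linearity in z lets z absorb the factor \<tau> / (2 \<i>), so w - w' may be any multiple
  of q z \<zeta>.\<close>

lemma axis_difference_odd: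
  assumes "odd m" "w - w' = \<tau> *s q z \<zeta>"
  shows "g (0, w) $ j - g (0, w') $ j
    = \<tau> * (cdot \<zeta> (K j *v f (z, w)) + cnj (cdot z (K j *v f (\<zeta>, cjv w'))))"
proof -
  have "w - w' = 2 * \<i> *s q ((\<tau> / (2 * \<i>)) *s z) \<zeta>"
    unfolding assms(2) by (simp add: q_def matrix_linear cdot_linear vec_eq_iff field_simps del: q_nth)
  from axis_difference [OF this, of j] show ?thesis
    by (simp add: f_axis_odd [OF assms(1)] f_linear_scaling [OF assms(1)] cdot_linear matrix_linear
        algebra_simps)
qed

text \<open>Degree one in z and weight 2 p + 1 leave degree p in w. At w = 0 degree one and degree m
  in z collide, so f vanishes there; this covers x = 0.\<close>

lemma f_hom_normal:
  assumes "m = 2 * p + 1" "p \<ge> 1"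
  shows "f (z, x *s w) = x ^ p *s f (z, w)"
proof -
  have "odd m" using assms by simp
  have "f (2 *s z, 0) = 2 ^ m *s f (z, 0)" using f_hom [of 2 z 0] by simp
  then have "(2::complex) *s f (z, 0) = 2 ^ m *s f (z, 0)"
    by (simp add: f_linear_scaling [OF \<open>odd m\<close>])
  then have eq: "(2::complex) * f (z, 0) $ i = 2 ^ m * f (z, 0) $ i" for i
    by (metis vector_smult_component)
  have "(2::nat) ^ m \<noteq> 2 ^ 1" using assms by (subst power_inject_exp) auto
  then have "(2::complex) ^ m \<noteq> 2"
    by (metis numeral_power_eq_of_nat_cancel_iff of_nat_numeral of_nat_power power_one_right)
  then have 0: "f (z, 0) = 0" using eq by (simp add: vec_eq_iff)
  show ?thesis
  proof (cases "x = 0")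
    case True then show ?thesis using 0 assms by simp
  next
    case False
    \<comment> \<open>Dilating by t scales w by x; the accompanying scaling of z is undone by
      linearity.\<close>
    define t where "t = csqrt x"
    have t: "t\<^sup>2 = x" "t \<noteq> 0" using False by (auto simp: t_def)
    have "f (t *s ((1 / t) *s z), t\<^sup>2 *s w) = t ^ m *s ((1 / t) *s f (z, w))"
      using f_linear_scaling [OF \<open>odd m\<close>, of "1 / t" z w] f_hom [of t "(1 / t) *s z" w]
        f_linear_scaling [OF \<open>odd m\<close>, of "1 / t" z w] by (simp only:)
    moreover have "t ^ m * (1 / t) = x ^ p"
      using t(2) by (simp add: assms(1) power_mult flip: t(1))
    ultimately show ?thesis using t(2) by (simp add: vector_smult_assoc t(1))
  qed
qed

lemma g_hom_normal:
  assumes "m = 2 * p + 1"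
  shows "g (0, x *s w) = x ^ (p + 1) *s g (0, w)"
proof -
  define t where "t = csqrt x"
  have "g (t *s 0, t\<^sup>2 *s w) = t ^ (m + 1) *s g (0, w)" by (rule g_hom)
  moreover have "t ^ (m + 1) = (t\<^sup>2) ^ (p + 1)"
    unfolding assms by (simp only: power_mult [symmetric]) simp
  ultimately show ?thesis by (simp add: t_def)
qed

text \<open>Restricting w and w' to multiples T \<eta> and b \<eta> of one vector \<eta> = q z
  \<zeta> turns the equation into a polynomial identity in T and b. For p = 1 that identity is T^2 -
  b^2 = (T - b) (T + b) and gives nothing.\<close>

lemma g_axis_odd:
  assumes m: "m = 2 * p + 1" "p \<ge> 2"
  shows "g (0, \<eta>) = 0"
proof -
  have "odd m" using m by simp
  note diff = axis_difference_odd [OF \<open>odd m\<close>]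
  note hom = f_hom_normal [OF m(1)] g_hom_normal [OF m(1)]
  obtain z where "good z" using good_exists by blast
  then obtain \<zeta> where \<eta>: "q z \<zeta> = \<eta>" using good_onto by blast
  have "g (0, \<eta>) $ j = 0" for j
  proof -
    define \<gamma> where "\<gamma> = g (0, \<eta>) $ j"
    define \<alpha> where "\<alpha> = cdot \<zeta> (K j *v f (z, \<eta>))"
    define \<beta> where "\<beta> = cnj (cdot z (K j *v f (\<zeta>, cjv \<eta>)))"
    have key: "T ^ (p + 1) * \<gamma> - b ^ (p + 1) * \<gamma> = (T - b) * (T ^ p * \<alpha> + b ^ p * \<beta>)" for T b
    proof -
      have "T *s \<eta> - b *s \<eta> = (T - b) *s q z \<zeta>" by (simp add: \<eta> vec_eq_iff algebra_simps)
      from diff [OF this, of j] show ?thesis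
        using m(2) by (simp add: hom \<gamma>_def \<alpha>_def \<beta>_def cdot_linear matrix_linear)
    qed
    have "p \<noteq> 0" using m by simp
    have "\<gamma> = \<alpha>" "\<gamma> = \<beta>" using key [of 1 0] key [of 0 1] \<open>p \<noteq> 0\<close> by (simp_all add: power_0_left)
    \<comment> \<open>With \<alpha> = \<beta> = \<gamma> any further independent pair may be tried;
      (2, -1) yields a factor that is nonzero for p \<ge> 2.\<close>
    moreover have "2 ^ (p + 1) * \<gamma> - (-1) ^ (p + 1) * \<gamma> = 3 * (2 ^ p * \<alpha> + (-1) ^ p * \<beta>)"
      using key [of 2 "-1"] by simp
    ultimately have eq: "(2 ^ p + 2 * (-1) ^ p) * \<gamma> = 0"
      by (simp add: algebra_simps)
    have "(2::real) ^ 2 \<le> 2 ^ p" using m(2) by (intro power_increasing) auto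
    then have "norm ((2::complex) ^ p) > norm (2 * (-1) ^ p :: complex)"
      by (simp add: norm_power norm_mult)
    then have "(2::complex) ^ p + 2 * (-1) ^ p \<noteq> 0"
      by (metis add_eq_0_iff norm_minus_cancel less_irrefl)
    then show ?thesis using eq by (simp add: \<gamma>_def)
  qed
  then show ?thesis by (simp add: vec_eq_iff)
qed

text \<open>Without g on the axis, the pairing of \<zeta> with K_j f(z, w) does not change when w
  moves along q z \<zeta>. This rigidity forces K_j f(z, w) = \<gamma>_j (w_2 A_1 z - w_1 A_2 z),
  and a nonzero \<gamma>_j would make K_1 and K_2 proportional.\<close>

lemma f_0_odd:
  assumes m: "odd m" "m \<ge> 3" and g0: "\<And>w. g (0, w) = 0"
  shows "f (y, w) = 0"
proof -
  define p where "p = m div 2"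
  have p: "m = 2 * p + 1" "p \<ge> 1" using m by (auto simp: p_def)
  have f0: "f (z, 0) = 0" for z using f_hom_normal [OF p, of z 0 0] p(2) by (simp add: power_0_left)
  have inv_nz: "cdot \<zeta> (K j *v f (z, w + \<tau> *s q z \<zeta>)) = - cnj (cdot z (K j *v f (\<zeta>, cjv w)))"
    if "\<tau> \<noteq> 0" for z \<zeta> w \<tau> j
    using axis_difference_odd [OF m(1), of "w + \<tau> *s q z \<zeta>" w \<tau> z \<zeta> j] that
    by (simp add: g0 eq_neg_iff_add_eq_0)
  \<comment> \<open>The case \<tau> = 0, in which the equation degenerates to 0 = 0, follows by
    continuity.\<close>
  have inv: "cdot \<zeta> (K j *v f (z, w + \<tau> *s q z \<zeta>)) = - cnj (cdot z (K j *v f (\<zeta>, cjv w)))"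
    for z \<zeta> w \<tau> j
  proof (cases "\<tau> = 0")
    case True
    define H where "H x = cdot \<zeta> (K j *v f (z, w + x *s q z \<zeta>))" for x
    have "H holomorphic_on UNIV"
      using curve_entireD [OF f_entire, of z 0 w "q z \<zeta>" 0] unfolding H_def
      by (intro holomorphic_cdot_right holomorphic_matrix_component) simp
    then have "isCont H 0"
      by (meson continuous_on_eq_continuous_at holomorphic_on_imp_continuous_on iso_tuple_UNIV_I open_UNIV)
    then have "(H \<longlongrightarrow> H 0) (at 0)" by (simp add: isCont_def)
    moreover have "(H \<longlongrightarrow> - cnj (cdot z (K j *v f (\<zeta>, cjv w)))) (at 0)"
      by (rule Lim_transform_eventually [OF tendsto_const])
         (auto simp: eventually_at_filter H_def inv_nz)
    ultimately have "H 0 = - cnj (cdot z (K j *v f (\<zeta>, cjv w)))"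
      using tendsto_unique trivial_limit_at by blast
    then show ?thesis using True by (simp add: H_def)
  qed (rule inv_nz)
  have skew: "cdot \<zeta> (K j *v f (z, w)) = - cnj (cdot z (K j *v f (\<zeta>, cjv w)))" for z \<zeta> w j
    using inv [of \<zeta> j z w 0] by simp
  have inv': "cdot \<zeta> (K j *v f (z, w + \<tau> *s q z \<zeta>)) = cdot \<zeta> (K j *v f (z, w))" for z \<zeta> w \<tau> j
    using inv [of \<zeta> j z w \<tau>] skew [of \<zeta> j z w] by (simp only:)
  \<comment> \<open>Pairing with \<open>perp z \<eta>\<close> gives the determinant of \<eta> and q
    z \<zeta> up to sign; for \<eta> \<noteq> 0 it vanishes exactly when q z \<zeta> is a multiple
    of \<eta>.\<close>
  define perp where "perp z \<eta> = \<eta> $ 2 *s (A 1 *v z) - \<eta> $ 1 *s (A 2 *v z)"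
    for z and \<eta> :: "complex ^ 2"
  have cdot_perp: "cdot \<zeta> (perp z \<eta>) = \<eta> $ 2 * q z \<zeta> $ 1 - \<eta> $ 1 * q z \<zeta> $ 2" for \<zeta> z \<eta>
    by (simp add: perp_def cdot_linear)
  \<comment> \<open>All \<zeta> with q z \<zeta> parallel to \<eta> annihilate the increment, so
    \<open>cdot_annihilator\<close> puts it on the line of \<open>perp z \<eta>\<close>. If q z
    \<zeta> = 0, shifting \<zeta> by a preimage of \<eta> reduces to the nonzero case.\<close>
  have step: "\<exists>c. K j *v f (z, w + \<eta>) - K j *v f (z, w) = c *s perp z \<eta>" if z: "good z" for z w \<eta> j
  proof (cases "\<eta> = 0")
    case False
    have colinear: "cdot \<zeta> (K j *v f (z, w + \<eta>) - K j *v f (z, w)) = 0" if "q z \<zeta> = k *s \<eta>" "k \<noteq> 0"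
      for \<zeta> k
      using inv' [of \<zeta> j z w "1 / k"] that by (simp add: vector_smult_assoc cdot_linear)
    show ?thesis
    proof (rule cdot_annihilator)
      fix \<zeta> assume "cdot \<zeta> (perp z \<eta>) = 0"
      then have eq: "\<eta> $ 2 * q z \<zeta> $ 1 = \<eta> $ 1 * q z \<zeta> $ 2" by (simp add: cdot_perp)
      have "\<exists>k. q z \<zeta> = k *s \<eta>"
      proof (cases "\<eta> $ 1 = 0")
        case True
        then have "\<eta> $ 2 \<noteq> 0" using False by (auto simp: vec_eq_iff forall_2)
        then show ?thesis
          using eq True by (intro exI [of _ "q z \<zeta> $ 2 / \<eta> $ 2"])
            (simp add: vec_eq_iff forall_2 del: q_nth)
      next
        case nz: False
        then show ?thesis
          using eq by (intro exI [of _ "q z \<zeta> $ 1 / \<eta> $ 1"])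
            (simp add: vec_eq_iff forall_2 field_simps del: q_nth)
      qed
      then obtain k where k: "q z \<zeta> = k *s \<eta>" by blast
      obtain \<xi> where \<xi>: "q z \<xi> = \<eta>" using good_onto [OF z] .
      show "cdot \<zeta> (K j *v f (z, w + \<eta>) - K j *v f (z, w)) = 0"
      proof (cases "k = 0")
        case True
        have "q z (\<zeta> + \<xi>) = q z \<zeta> + q z \<xi>" by (simp add: vec_eq_iff cdot_linear)
        then have "q z (\<zeta> + \<xi>) = 1 *s \<eta>" using k \<xi> True by simp
        from colinear [OF this] colinear [of \<xi> 1] \<xi> show ?thesis by (simp add: cdot_linear)
      qed (rule colinear [OF k])
    qed blast
  qed (simp add: perp_def)
  have const: "\<exists>\<gamma>. \<forall>\<eta>. K j *v f (z, \<eta>) = \<gamma> *s perp z \<eta>" if z: "good z" for z j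
  proof -
    have "\<forall>\<eta>. \<exists>c. K j *v f (z, \<eta>) = c *s perp z \<eta>"
      using step [OF z, of j 0] by (simp add: f0)
    then obtain c where c: "\<And>\<eta>. K j *v f (z, \<eta>) = c \<eta> *s perp z \<eta>" by metis
    \<comment> \<open>Comparing coefficients of the independent vectors A_1 z and A_2 z gives (c(v +
      \<eta>) - c(v)) v + (c(v + \<eta>) - d) \<eta> = 0 with v, \<eta> independent.\<close>
    have shift: "c (v + \<eta>) = c v" if nz: "v $ 1 * \<eta> $ 2 \<noteq> v $ 2 * \<eta> $ 1" for v \<eta>
    proof -
      obtain d where d: "K j *v f (z, v + \<eta>) - K j *v f (z, v) = d *s perp z \<eta>"
        using step [OF z] by blast
      have "((c (v + \<eta>) - c v) * v $ 2 + (c (v + \<eta>) - d) * \<eta> $ 2) *s (A 1 *v z)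
          + (- ((c (v + \<eta>) - c v) * v $ 1 + (c (v + \<eta>) - d) * \<eta> $ 1)) *s (A 2 *v z) = 0"
        using d unfolding c perp_def by (simp add: vec_eq_iff algebra_simps)
      from good_independent [OF z this] show ?thesis using nz by algebra
    qed
    have c_eq: "c v = c \<eta>" if "v $ 1 * \<eta> $ 2 \<noteq> v $ 2 * \<eta> $ 1" for v \<eta>
      using shift [of v \<eta>] shift [of \<eta> v] that by (simp add: add.commute mult.commute)
    define e where "e = (\<chi> l::2. if l = 1 then 1 else (0::complex))"
    define e' where "e' = (\<chi> l::2. if l = 1 then 0 else (1::complex))"
    have "K j *v f (z, \<eta>) = c e *s perp z \<eta>" for \<eta>
    proof -
      \<comment> \<open>\<open>c_eq\<close> compares independent vectors, so multiples of
        \<open>e\<close> are reached through \<open>e'\<close>.\<close>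
      consider "\<eta> $ 2 \<noteq> 0" | "\<eta> $ 2 = 0" "\<eta> $ 1 \<noteq> 0" | "\<eta> = 0"
        by (auto simp: vec_eq_iff forall_2)
      then show ?thesis
      proof cases
        case 1 then have "c e = c \<eta>" by (intro c_eq) (simp add: e_def)
        then show ?thesis by (simp add: c)
      next
        case 2 then have "c e' = c \<eta>" "c e = c e'" by (auto intro!: c_eq simp: e_def e'_def)
        then show ?thesis by (simp add: c)
      next
        case 3 then show ?thesis by (simp add: f0 perp_def)
      qed
    qed
    then show ?thesis by blast
  qed
  obtain z0 where z0: "good z0" using good_exists by blast
  define \<gamma> where "\<gamma> j = (SOME \<gamma>. \<forall>\<eta>. K j *v f (z0, \<eta>) = \<gamma> *s perp z0 \<eta>)" for j
  have \<gamma>: "K j *v f (z0, \<eta>) = \<gamma> j *s perp z0 \<eta>" for j \<eta>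
    using someI_ex [OF const [OF z0]] unfolding \<gamma>_def by blast
  \<comment> \<open>The symmetry \<open>skew\<close> links the factor c at a good \<zeta> with the
    one at z0: -cnj c = \<gamma>_j. A second use of \<open>skew\<close> carries this to arbitrary y,
    and such \<zeta> separate vectors.\<close>
  have global: "K j *v f (y, w) = \<gamma> j *s perp y w" for j y w
  proof -
    have "K j *v f (y, w) - \<gamma> j *s perp y w = 0"
    proof (rule generic_separates [OF z0])
      fix \<zeta> assume \<zeta>: "good \<zeta>" "q z0 \<zeta> \<noteq> 0"
      obtain c where c: "\<And>\<eta>. K j *v f (\<zeta>, \<eta>) = c *s perp \<zeta> \<eta>" using const [OF \<zeta>(1)] by blast
      have conj: "cnj (cdot z (perp \<zeta> (cjv \<eta>))) = cdot \<zeta> (perp z \<eta>)" for z \<eta>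
        using cdot_hermitian [OF herm, of z 1 \<zeta>] cdot_hermitian [OF herm, of z 2 \<zeta>]
        by (simp add: perp_def cdot_linear)
      have "\<exists>\<eta>. cdot \<zeta> (perp z0 \<eta>) \<noteq> 0"
      proof (cases "q z0 \<zeta> $ 1 = 0")
        case True
        then have "q z0 \<zeta> $ 2 \<noteq> 0" using \<zeta>(2) by (auto simp: vec_eq_iff forall_2)
        then show ?thesis
          by (intro exI [of _ "\<chi> l. if l = 1 then 1 else 0"]) (simp add: cdot_perp del: q_nth)
      next
        case False
        then show ?thesis
          by (intro exI [of _ "\<chi> l. if l = 1 then 0 else 1"]) (simp add: cdot_perp del: q_nth)
      qed
      then obtain \<eta> where \<eta>: "cdot \<zeta> (perp z0 \<eta>) \<noteq> 0" by blast
      have "\<gamma> j * cdot \<zeta> (perp z0 \<eta>) = - cnj c * cdot \<zeta> (perp z0 \<eta>)"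
        using skew [of \<zeta> j z0 \<eta>] conj [of z0 \<eta>] by (simp add: \<gamma> c cdot_linear)
      then have "- cnj c = \<gamma> j" using \<eta> by (metis mult_right_cancel)
      then show "cdot \<zeta> (K j *v f (y, w) - \<gamma> j *s perp y w) = 0"
        using skew [of \<zeta> j y w] conj [of y w] by (simp add: c cdot_linear flip: \<open>- cnj c = \<gamma> j\<close>)
    qed
    then show ?thesis by simp
  qed
  have "\<gamma> j = 0" for j
  proof (rule ccontr)
    assume nz: "\<gamma> j \<noteq> 0"
    \<comment> \<open>H is positive definite, since by nondegeneracy A_1 and A_2 have no common
      kernel.\<close>
    define H where "H = A 1 ** A 1 + A 2 ** A 2"
    have H: "H *v y = A 1 *v (A 1 *v y) + A 2 *v (A 2 *v y)" for y
      by (simp add: H_def matrix_vector_mult_add_rdistrib matrix_vector_mul_assoc)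
    have "y = 0" if "H *v y = 0" for y
    proof -
      have "cdot y (H *v y) = cnj (cdot (A 1 *v y) (A 1 *v y)) + cnj (cdot (A 2 *v y) (A 2 *v y))"
        using cdot_hermitian [OF herm, of y 1 "A 1 *v y"] cdot_hermitian [OF herm, of y 2 "A 2 *v y"]
        by (simp add: H cdot_linear)
      also have "\<dots> = complex_of_real ((norm (A 1 *v y))\<^sup>2 + (norm (A 2 *v y))\<^sup>2)"
        by (simp add: cdot_self)
      finally have "(norm (A 1 *v y))\<^sup>2 + (norm (A 2 *v y))\<^sup>2 = 0"
        using that by (metis cdot_zero(2) of_real_eq_0_iff)
      then show ?thesis using nondeg by (simp add: sum_power2_eq_zero_iff)
    qed
    then have "inj ((*v) H)"
      by (intro injI) (metis eq_iff_diff_eq_0 matrix_vector_mult_diff_distrib)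
    then have surjH: "surj ((*v) H)"
      using vec.linear_injective_imp_surjective matrix_vector_mul_linear_gen by blast
    define e where "e = (\<chi> l::2. if l = 1 then 1 else (0::complex))"
    define e' where "e' = (\<chi> l::2. if l = 1 then 0 else (1::complex))"
    \<comment> \<open>The directions e' and e single out the terms A_1 y' and -A_2 y' of
      \<open>perp\<close>; at y' = A_1 y and y' = A_2 y their combination is H y. Hence K_j is
      invertible and every K_l is a multiple of it.\<close>
    define u where "u y = (1 / \<gamma> j) *s (f (A 1 *v y, e') - f (A 2 *v y, e))" for y
    have Ku: "K l *v u y = (\<gamma> l / \<gamma> j) *s (H *v y)" for l y
      unfolding u_def matrix_linear global H
      by (simp add: perp_def e_def e'_def vec_eq_iff algebra_simps)
    have "surj ((*v) (K j))"
    proof (rule surjI [where f = "\<lambda>x. u (inv ((*v) H) x)"])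
      show "K j *v u (inv ((*v) H) x) = x" for x
        using nz by (simp add: Ku surj_f_inv_f [OF surjH])
    qed
    then have injK: "inj ((*v) (K j))"
      using vec.linear_surjective_imp_injective matrix_vector_mul_linear_gen by blast
    have "K l *v x = (\<gamma> l / \<gamma> j) *s (K j *v x)" for l x
    proof -
      define y where "y = inv ((*v) H) (K j *v x)"
      have y: "H *v y = K j *v x" unfolding y_def by (rule surj_f_inv_f [OF surjH])
      then have "K j *v u y = K j *v x" using nz by (simp add: Ku)
      then have "u y = x" using injK by (simp add: inj_eq)
      then show ?thesis using Ku [of l y] y by simp
    qed
    then have "\<gamma> 2 *s (K 1 *v x) = \<gamma> 1 *s (K 2 *v x)" for x
      using nz by (metis mult.commute times_divide_eq_right vector_smult_assoc)
    then have "\<gamma> 2 = 0 \<and> \<gamma> 1 = 0" by (rule indepK)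
    then show False using nz exhaust_2 [of j] by auto
  qed
  then have "K j *v f (y, w) = 0" for j using global [of j y w] by simp
  then show ?thesis by (rule nondegK)
qed


subsection \<open>Even weight\<close>

text \<open>The rescaling used for odd weight, now with g absent from the axis. The quadratic
  polynomial \<phi> is even in s because f is even in z, and its leading coefficient is known from
  \<open>quadratic_growth\<close>.\<close>

lemma f_deviation_even:
  assumes "even m" "w - w' = 2 * \<i> *s q z \<zeta>"
  shows "cdot \<zeta> (K j *v (f (z, w) - f (0, w)))
    = cnj (cdot z (K j *v (f (0, cjv w) - f (0, cjv w'))))"
proof -
  define \<phi> where "\<phi> s = cdot \<zeta> (K j *v (f (s *s z, w) - f (0, w')))" for s
  define \<psi> where "\<psi> r = cdot z (K j *v (f (r *s \<zeta>, cjv w') - f (0, cjv w)))" for r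
  have hol: "\<phi> holomorphic_on UNIV" "\<psi> holomorphic_on UNIV"
    unfolding \<phi>_def \<psi>_def matrix_linear cdot_linear by (intro holomorphic_intros entire_pairing)+
  have eq: "\<phi> s = s * 0 - s\<^sup>2 * cnj (\<psi> (1 / cnj s))" if "s \<noteq> 0" for s
  proof -
    have "q (s *s z) ((1 / cnj s) *s \<zeta>) = q z \<zeta>"
      using that by (simp add: vec_eq_iff cdot_linear matrix_linear)
    then have "w - w' = 2 * \<i> *s q (s *s z) ((1 / cnj s) *s \<zeta>)" using assms(2) by simp
    from axis_difference [OF this, of j]
    have "0 = (1 / s) * \<phi> s + s * cnj (\<psi> (1 / cnj s))"
      by (simp add: \<phi>_def \<psi>_def g_axis_even [OF assms(1)] cdot_linear)
    then show ?thesis using that by (simp add: field_simps power2_eq_square eq_neg_iff_add_eq_0)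
  qed
  obtain a b c where abc: "\<And>s. \<phi> s = a + b * s + c * s\<^sup>2" "c = - cnj (\<psi> 0)"
    using quadratic_growth [OF hol(2,1) eq] by blast
  have "f ((-1) *s z, w) = f (z, w)"
    using f_hom [of "-1" z w] assms(1) by (simp add: vec_eq_iff)
  then have "\<phi> (-1) = \<phi> 1" by (simp add: \<phi>_def)
  then have "b = 0" using abc(1) [of 1] abc(1) [of "-1"] by simp
  then have "\<phi> 1 = \<phi> 0 - cnj (\<psi> 0)" using abc(1) [of 1] abc(1) [of 0] abc(2) by simp
  then show ?thesis by (simp add: \<phi>_def \<psi>_def cdot_linear matrix_linear algebra_simps)
qed

text \<open>At w = 0 one side of \<open>f_deviation_even\<close> has degree one in cnj \<zeta>, the
  other degree p. Doubling \<zeta> multiplies them by 2 and 2^p, so both vanish unless p =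
  1.\<close>

lemma f_axis_even:
  assumes m: "m = 2 * p" "p \<ge> 2"
  shows "f (0, \<eta>) = 0"
proof -
  have "even m" using m by simp
  have f0: "f (0, 0) = 0" using f_hom [of 0 0 0] m by (simp add: power_0_left)
  have hom2: "f (0, 2 *s w) = 2 ^ p *s f (0, w)" for w
  proof -
    have "f (csqrt 2 *s 0, (csqrt 2)\<^sup>2 *s w) = (csqrt 2) ^ m *s f (0, w)" by (rule f_hom)
    then show ?thesis by (simp add: m(1) power_mult del: csqrt_of_real_nonneg)
  qed
  have dev: "cdot \<zeta> (K j *v f (z, 0)) = - cnj (cdot z (K j *v f (0, cjv (- (2 * \<i> *s q z \<zeta>)))))"
    for \<zeta> j z
    using f_deviation_even [OF \<open>even m\<close>, of 0 "- (2 * \<i> *s q z \<zeta>)" z \<zeta> j] f0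
    by (simp add: cdot_linear matrix_linear)
  have zero: "cdot z (K j *v f (0, cjv (- (2 * \<i> *s q z \<zeta>)))) = 0" for z \<zeta> j
  proof -
    have "cjv (- (2 * \<i> *s q z (2 *s \<zeta>))) = 2 *s cjv (- (2 * \<i> *s q z \<zeta>))"
      by (simp add: vec_eq_iff cdot_linear)
    then have "2 * cdot \<zeta> (K j *v f (z, 0))
        = 2 ^ p * - cnj (cdot z (K j *v f (0, cjv (- (2 * \<i> *s q z \<zeta>)))))"
      using dev [of "2 *s \<zeta>" j z] by (simp add: hom2 cdot_linear matrix_linear)
    then have "2 * cdot \<zeta> (K j *v f (z, 0)) = 2 ^ p * cdot \<zeta> (K j *v f (z, 0))"
      unfolding dev [symmetric] .
    moreover have "(2::nat) ^ p \<noteq> 2 ^ 1" using m by (subst power_inject_exp) auto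
    then have "(2::complex) ^ p \<noteq> 2"
      by (metis numeral_power_eq_of_nat_cancel_iff of_nat_numeral of_nat_power power_one_right)
    ultimately have "cdot \<zeta> (K j *v f (z, 0)) = 0" by simp
    then show ?thesis using dev [of \<zeta> j z] by simp
  qed
  have "K j *v f (0, \<eta>) = 0" for j
  proof (rule good_separates)
    fix z assume "good z"
    then obtain \<zeta> where \<zeta>: "q z \<zeta> = (- (1 / (2 * \<i>))) *s cjv \<eta>" using good_onto by blast
    have "cjv (- (2 * \<i> *s q z \<zeta>)) = \<eta>" unfolding \<zeta> by (simp add: vec_eq_iff)
    then show "cdot z (K j *v f (0, \<eta>)) = 0" using zero [of z j \<zeta>] by simp
  qed
  then show ?thesis by (rule nondegK)
qed

lemma f_0_even:
  assumes m: "even m" and f0: "\<And>w. f (0, w) = 0"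
  shows "f (z, w) = 0"
proof (rule K_separates)
  fix \<zeta> j
  show "cdot \<zeta> (K j *v f (z, w)) = 0"
    using f_deviation_even [OF m, of w "w - 2 * \<i> *s q z \<zeta>" z \<zeta> j] by (simp add: f0)
qed

text \<open>The hypotheses cover precisely the weights left open by \<open>f_axis_even\<close>,
  \<open>g_axis_odd\<close> and \<open>f_0_odd\<close>. Once f and the axis values of g vanish,
  \<open>g_from_axis\<close> removes the rest of g.\<close>

theorem vanishing:
  assumes g0: "\<And>w. m = 1 \<or> m = 3 \<Longrightarrow> g (0, w) = 0"
    and f0: "\<And>w. m = 2 \<Longrightarrow> f (0, w) = 0"
    and f1: "\<And>z w. m = 1 \<Longrightarrow> f (z, w) = 0"
  shows "f (z, w) = 0" "g (z, w) = 0"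
proof -
  define p where "p = m div 2"
  have "(\<forall>z w. f (z, w) = 0) \<and> (\<forall>w. g (0, w) = 0)"
  proof (cases "even m")
    case True
    then have "m = 2 * p" by (simp add: p_def)
    then have "f (0, w) = 0" for w
      using f0 [of w] f_axis_even [of p w] m_pos by (cases "p \<ge> 2") auto
    then show ?thesis using f_0_even g_axis_even True by blast
  next
    case False
    then have p: "m = 2 * p + 1" by (simp add: p_def)
    then have "g (0, w) = 0" for w
      using g0 [of w] g_axis_odd [of p w] by (cases "p \<ge> 2") (auto simp: not_le less_2_cases_iff)
    moreover from this have "f (z, w) = 0" for z w
      using f1 [of z w] f_0_odd [of z w] False p by (cases "p \<ge> 1") auto
    ultimately show ?thesis by blast
  qed
  then show "f (z, w) = 0" "g (z, w) = 0"
    using g_from_axis [of z w] by (simp_all add: vec_eq_iff [of "g (z, w)"])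
qed

end


section \<open>Weighted Taylor coefficients\<close>

lemma norm_vector_smult: "norm (c *s v) = norm c * norm v"
  for v :: "complex ^ 'n::finite"
  by (simp add: norm_vec_def norm_mult L2_set_right_distrib)

lemma bounded_linear_smult_left: "bounded_linear (\<lambda>c::complex. c *s (v :: complex ^ 'n::finite))"
  by (rule bounded_linear_intro [where K = "norm v"])
     (simp_all add: vec_eq_iff algebra_simps norm_vector_smult)

lemma continuous_on_smult [continuous_intros]:
  fixes g :: "'a::topological_space \<Rightarrow> complex ^ 'n::finite"
  assumes "continuous_on S c" "continuous_on S g"
  shows "continuous_on S (\<lambda>x. c x *s g x)"
  unfolding vector_scalar_mult_def
  by (intro continuous_on_vec_lambda continuous_on_mult assms(1) continuous_on_component assms(2))

definition holo_fun :: "(('n::finite) ambient \<Rightarrow> complex) \<Rightarrow> 'n ambient set \<Rightarrow> bool" where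
  "holo_fun F U \<longleftrightarrow>
     (\<forall>p\<in>U. \<exists>L. (F has_derivative L) (at p) \<and> (\<forall>c v. L (cscale c v) = c * L v))"

definition dil :: "complex \<Rightarrow> ('n::finite) ambient \<Rightarrow> 'n ambient" where
  "dil t p = (t *s fst p, t\<^sup>2 *s snd p)"

text \<open>The part of weight m in the Taylor series of F at 0, evaluated at p. One-variable
  derivatives along the dilations replace multivariate power series, and p need not lie in the
  domain of F.\<close>

definition wcoef :: "(('n::finite) ambient \<Rightarrow> complex) \<Rightarrow> nat \<Rightarrow> 'n ambient \<Rightarrow> complex" where
  "wcoef F m p = (deriv ^^ m) (\<lambda>t. F (dil t p)) 0 / fact m"

lemma dil_pair [simp]: "dil t (z, w) = (t *s z, t\<^sup>2 *s w)"
  by (simp add: dil_def)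

lemma dil_0 [simp]: "dil 0 p = 0"
  by (simp add: dil_def zero_prod_def)

lemma dil_1 [simp]: "dil 1 p = p"
  by (simp add: dil_def)

lemma dil_dil: "dil t (dil s p) = dil (t * s) p"
  by (simp add: dil_def vector_smult_assoc power_mult_distrib)

lemma norm_dil_le:
  assumes "norm t \<le> 1" shows "norm (dil t p) \<le> 2 * norm t * norm p"
proof -
  have "norm (dil t p) \<le> norm (t *s fst p) + norm (t\<^sup>2 *s snd p)"
    unfolding dil_def by (rule norm_Pair_le)
  also have "\<dots> = norm t * norm (fst p) + norm t ^ 2 * norm (snd p)"
    by (simp add: norm_vector_smult norm_power)
  also have "\<dots> \<le> norm t * norm p + norm t * norm p"
  proof (intro add_mono mult_mono mult_left_mono)
    show "norm t ^ 2 \<le> norm t" using assms by (simp add: power2_eq_square mult_left_le)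
    show "norm (fst p) \<le> norm p" by (metis norm_fst_le prod.collapse)
    show "norm (snd p) \<le> norm p" by (metis norm_snd_le prod.collapse)
  qed auto
  finally show ?thesis by simp
qed

lemma holo_fun_imp_continuous_on: "holo_fun F U \<Longrightarrow> continuous_on U F"
  unfolding holo_fun_def
  by (meson continuous_at_imp_continuous_on has_derivative_continuous)

lemma holo_fun_diff:
  assumes "holo_fun F U" "holo_fun G U" shows "holo_fun (\<lambda>p. F p - G p) U"
  unfolding holo_fun_def
proof
  fix p assume "p \<in> U"
  then obtain L L' where "(F has_derivative L) (at p)" "\<And>c v. L (cscale c v) = c * L v"
    "(G has_derivative L') (at p)" "\<And>c v. L' (cscale c v) = c * L' v"
    using assms unfolding holo_fun_def by metis
  then show "\<exists>L. ((\<lambda>p. F p - G p) has_derivative L) (at p) \<and> (\<forall>c v. L (cscale c v) = c * L v)"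
    by (intro exI [of _ "\<lambda>v. L v - L' v"]) (auto intro: has_derivative_diff simp: algebra_simps)
qed

lemma holo_fun_along_curve:
  assumes F: "holo_fun F U" and S: "open S"
    and U: "\<And>x. x \<in> S \<Longrightarrow> (a + x *s b, w0 + x *s w1 + x\<^sup>2 *s w2) \<in> U"
  shows "(\<lambda>x. F (a + x *s b, w0 + x *s w1 + x\<^sup>2 *s w2)) holomorphic_on S"
  unfolding holomorphic_on_open [OF S]
proof
  fix x assume "x \<in> S"
  let ?c = "\<lambda>x. (a + x *s b, w0 + x *s w1 + x\<^sup>2 *s w2)"
  let ?v = "(b, w1 + (2 * x) *s w2)"
  have sq: "((\<lambda>x. x\<^sup>2 *s w2) has_derivative (\<lambda>h. (2 * x * h) *s w2)) (at x)"
    by (rule has_derivative_eq_rhs)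
       (rule bounded_linear.has_derivative [OF bounded_linear_smult_left],
        rule has_derivative_power [OF has_derivative_ident], simp add: algebra_simps)
  have "(?c has_derivative (\<lambda>h. (h *s b, h *s w1 + (2 * x * h) *s w2))) (at x)"
    by (rule has_derivative_eq_rhs)
       (rule has_derivative_Pair has_derivative_add has_derivative_const sq
         bounded_linear.has_derivative [OF bounded_linear_smult_left] has_derivative_ident | simp)+
  then have c: "(?c has_derivative (\<lambda>h. cscale h ?v)) (at x)"
    by (simp add: cscale_def vec_eq_iff algebra_simps)
  obtain L where L: "(F has_derivative L) (at (?c x))" "\<And>c v. L (cscale c v) = c * L v"
    using F U [OF \<open>x \<in> S\<close>] unfolding holo_fun_def by blast
  have "((\<lambda>x. F (?c x)) has_derivative (\<lambda>h. L (cscale h ?v))) (at x)"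
    by (rule has_derivative_compose [OF c L(1)])
  then have "((\<lambda>x. F (?c x)) has_field_derivative L ?v) (at x)"
    by (simp add: has_field_derivative_def L(2) mult.commute [of _ "L ?v"])
  then show "\<exists>f'. ((\<lambda>x. F (?c x)) has_field_derivative f') (at x)" ..
qed

lemma holo_fun_along_dil:
  assumes "holo_fun F U" "open S" "\<And>t. t \<in> S \<Longrightarrow> dil t p \<in> U"
  shows "(\<lambda>t. F (dil t p)) holomorphic_on S"
  using holo_fun_along_curve [OF assms(1,2), of 0 "fst p" 0 0 "snd p"] assms(3)
  by (simp add: dil_def)

text \<open>Cauchy's inequality on the circle of radius \<delta> dominates the tail by a geometric
  series of ratio 1/2, whose sum is the factor 2.\<close>

lemma taylor_remainder:
  assumes hol: "G holomorphic_on ball 0 (2 * \<delta>)" and "\<delta> > 0"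
    and B: "\<And>t. t \<in> ball 0 (2 * \<delta>) \<Longrightarrow> norm (G t) \<le> B"
    and 0: "\<And>k. k < m \<Longrightarrow> (deriv ^^ k) G 0 = 0"
    and t: "norm t \<le> \<delta> / 2"
  shows "norm (G t - t ^ m * ((deriv ^^ m) G 0 / fact m)) \<le> 2 * B / \<delta> ^ (m + 1) * norm t ^ (m + 1)"
proof -
  define c where "c k = (deriv ^^ k) G 0 / fact k" for k
  have tb: "t \<in> ball 0 (2 * \<delta>)" using t \<open>\<delta> > 0\<close> by (simp add: dist_norm)
  have cont: "continuous_on (cball 0 \<delta>) G"
    using holomorphic_on_imp_continuous_on [OF hol]
    by (rule continuous_on_subset) (use \<open>\<delta> > 0\<close> in \<open>simp add: cball_subset_ball_iff\<close>)
  have hol': "G holomorphic_on ball 0 \<delta>"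
    using hol by (rule holomorphic_on_subset) (use \<open>\<delta> > 0\<close> in \<open>simp add: ball_subset_ball_iff\<close>)
  have cB: "norm (c k) \<le> B / \<delta> ^ k" for k
  proof -
    have "norm ((deriv ^^ k) G 0) \<le> fact k * B / \<delta> ^ k"
      by (rule Cauchy_inequality [OF hol' cont \<open>\<delta> > 0\<close>]) (use B \<open>\<delta> > 0\<close> in auto)
    then show ?thesis by (simp add: c_def norm_divide field_simps)
  qed
  have "B \<ge> 0" using B [OF tb] norm_ge_zero order_trans by blast
  have sums: "(\<lambda>k. c k * t ^ k) sums G t"
    using holomorphic_power_series [OF hol tb] by (simp add: c_def)
  have "(\<Sum>k<m+1. c k * t ^ k) = (\<Sum>k\<in>{m}. c k * t ^ k)"
    by (rule sum.mono_neutral_right) (use 0 in \<open>auto simp: c_def less_Suc_eq\<close>)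
  then have "(\<lambda>k. c (k + (m + 1)) * t ^ (k + (m + 1))) sums (G t - t ^ m * c m)"
    using sums_split_initial_segment [OF sums, of "m + 1"] by (simp add: mult.commute)
  moreover have "(\<lambda>k. B * (norm t / \<delta>) ^ (m + 1) * (1 / 2) ^ k) sums (B * (norm t / \<delta>) ^ (m + 1) * 2)"
    using geometric_sums [of "1 / 2 :: real"] by (intro sums_mult) simp
  moreover have "norm (c (k + (m + 1)) * t ^ (k + (m + 1))) \<le> B * (norm t / \<delta>) ^ (m + 1) * (1 / 2) ^ k"
    for k
  proof -
    have "norm (c (k + (m + 1)) * t ^ (k + (m + 1))) \<le> B / \<delta> ^ (k + (m + 1)) * norm t ^ (k + (m + 1))"
      by (simp only: norm_mult norm_power) (intro mult_right_mono cB, simp)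
    also have "\<dots> = B * (norm t / \<delta>) ^ (m + 1) * (norm t / \<delta>) ^ k"
      by (simp add: power_add power_divide mult_ac)
    also have "\<dots> \<le> B * (norm t / \<delta>) ^ (m + 1) * (1 / 2) ^ k"
      using t \<open>\<delta> > 0\<close> \<open>B \<ge> 0\<close> by (intro mult_left_mono power_mono) (auto simp: field_simps)
    finally show ?thesis .
  qed
  ultimately have "norm (G t - t ^ m * c m) \<le> B * (norm t / \<delta>) ^ (m + 1) * 2"
    by (metis (no_types, lifting) norm_suminf_le sums_iff)
  also have "\<dots> = 2 * B / \<delta> ^ (m + 1) * norm t ^ (m + 1)" by (simp add: power_divide)
  finally show ?thesis by (simp add: c_def)
qed

lemma weighted_expansion:
  assumes F: "holo_fun F U" "open U" "0 \<in> U" and 0: "\<And>k p. k < m \<Longrightarrow> wcoef F k p = 0"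
  obtains C \<delta> where "\<delta> > 0" "C \<ge> 0"
    "\<And>p t. norm p \<le> N \<Longrightarrow> norm t \<le> \<delta> \<Longrightarrow> dil t p \<in> U"
    "\<And>p t. norm p \<le> N \<Longrightarrow> norm t \<le> \<delta> \<Longrightarrow> norm (F (dil t p) - t ^ m * wcoef F m p) \<le> C * norm t ^ (m + 1)"
proof -
  obtain e where e: "e > 0" "cball 0 e \<subseteq> U" using F(2,3) open_contains_cball by blast
  have "compact (F ` cball 0 e)"
    by (intro compact_continuous_image continuous_on_subset [OF holo_fun_imp_continuous_on [OF F(1)] e(2)])
       auto
  then obtain B where B: "\<And>p. p \<in> cball 0 e \<Longrightarrow> norm (F p) \<le> B"
    using compact_imp_bounded bounded_iff by (metis image_eqI)
  \<comment> \<open>For |t| < 2 \<delta> this gives |t| \<le> 1, as \<open>norm_dil_le\<close>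
    demands, and 2 |t| |p| \<le> e.\<close>
  define \<delta> where "\<delta> = min (1 / 2) (e / (4 * (\<bar>N\<bar> + 1)))"
  have \<delta>: "\<delta> > 0" using e(1) by (simp add: \<delta>_def)
  have in_ball: "dil t p \<in> cball 0 e" if p: "norm p \<le> N" and t: "norm t < 2 * \<delta>" for p t
  proof -
    have "norm t \<le> 1" using t by (simp add: \<delta>_def)
    then have "norm (dil t p) \<le> 2 * norm t * norm p" by (rule norm_dil_le)
    also have "\<dots> \<le> 2 * (2 * \<delta>) * (\<bar>N\<bar> + 1)" using t p \<delta> by (intro mult_mono) auto
    also have "\<dots> \<le> 2 * (2 * (e / (4 * (\<bar>N\<bar> + 1)))) * (\<bar>N\<bar> + 1)"
      by (intro mult_right_mono mult_left_mono) (auto simp: \<delta>_def)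
    also have "\<dots> = e" by (simp add: field_simps)
    finally show ?thesis by simp
  qed
  have "B \<ge> 0" using B [of 0] e(1) by (metis centre_in_cball less_imp_le norm_ge_zero order_trans)
  show ?thesis
  proof
    show "\<delta> / 2 > 0" "2 * B / \<delta> ^ (m + 1) \<ge> 0" using \<delta> \<open>B \<ge> 0\<close> by simp_all
    fix p :: "'a ambient" and t :: complex
    assume p: "norm p \<le> N" and t: "norm t \<le> \<delta> / 2"
    show "dil t p \<in> U" using in_ball [OF p, of t] t \<delta> e by auto
    show "norm (F (dil t p) - t ^ m * wcoef F m p) \<le> 2 * B / \<delta> ^ (m + 1) * norm t ^ (m + 1)"
      unfolding wcoef_def
    proof (rule taylor_remainder [OF _ \<delta> _ _ t])
      show "(\<lambda>t. F (dil t p)) holomorphic_on ball 0 (2 * \<delta>)"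
        by (rule holo_fun_along_dil [OF F(1)]) (use in_ball [OF p] e(2) in auto)
      show "norm (F (dil t p)) \<le> B" if "t \<in> ball 0 (2 * \<delta>)" for t
        using B in_ball [OF p, of t] that by simp
      show "(deriv ^^ k) (\<lambda>t. F (dil t p)) 0 = 0" if "k < m" for k
        using 0 [OF that, of p] by (simp add: wcoef_def)
    qed
  qed
qed

text \<open>Rescaled copies of F converge on balls of any size, which is how a locally defined F
  acquires a globally regular leading term.\<close>

lemma wcoef_uniform_limit:
  assumes F: "holo_fun F U" "open U" "0 \<in> U" and 0: "\<And>k p. k < m \<Longrightarrow> wcoef F k p = 0"
  shows "\<exists>\<tau> :: nat \<Rightarrow> complex. (\<forall>n. \<tau> n \<noteq> 0) \<and> (\<forall>n p. norm p \<le> N \<longrightarrow> dil (\<tau> n) p \<in> U) \<and>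
    uniform_limit (cball 0 N) (\<lambda>n p. F (dil (\<tau> n) p) / \<tau> n ^ m) (wcoef F m) sequentially"
proof -
  obtain C \<delta> where C: "\<delta> > 0" "C \<ge> 0"
    "\<And>p t. norm p \<le> N \<Longrightarrow> norm t \<le> \<delta> \<Longrightarrow> dil t p \<in> U"
    "\<And>p t. norm p \<le> N \<Longrightarrow> norm t \<le> \<delta> \<Longrightarrow> norm (F (dil t p) - t ^ m * wcoef F m p) \<le> C * norm t ^ (m + 1)"
    using weighted_expansion [OF F 0, where N = N and m = m] by metis
  define \<tau> where "\<tau> n = complex_of_real (\<delta> / real (Suc n))" for n
  have norm: "norm (\<tau> n) = \<delta> / real (Suc n)" for n
    using C(1) by (simp add: \<tau>_def norm_divide del: of_nat_Suc)
  have \<tau>: "\<tau> n \<noteq> 0" "norm (\<tau> n) \<le> \<delta>" for n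
  proof -
    show "\<tau> n \<noteq> 0" using C(1) by (simp add: \<tau>_def del: of_nat_Suc)
    have "\<delta> / real (Suc n) \<le> \<delta> / 1" using C(1) by (intro divide_left_mono) auto
    then show "norm (\<tau> n) \<le> \<delta>" by (simp only: norm div_by_1)
  qed
  have "uniform_limit (cball 0 N) (\<lambda>n p. F (dil (\<tau> n) p) / \<tau> n ^ m) (wcoef F m) sequentially"
  proof (rule uniform_limitI)
    fix e :: real assume "e > 0"
    have "(\<lambda>n. C * \<delta> * (1 / real (Suc n))) \<longlonglongrightarrow> C * \<delta> * 0"
      by (intro tendsto_intros LIMSEQ_Suc [OF lim_1_over_n])
    then have "\<forall>\<^sub>F n in sequentially. C * \<delta> * (1 / real (Suc n)) < e"
      using \<open>e > 0\<close> order_tendstoD(2) by fastforce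
    then show "\<forall>\<^sub>F n in sequentially. \<forall>p\<in>cball 0 N. dist (F (dil (\<tau> n) p) / \<tau> n ^ m) (wcoef F m p) < e"
    proof eventually_elim
      case (elim n)
      show ?case
      proof
        fix p :: "'a ambient" assume "p \<in> cball 0 N"
        then have "norm (F (dil (\<tau> n) p) - \<tau> n ^ m * wcoef F m p) \<le> C * norm (\<tau> n) ^ (m + 1)"
          using C(4) \<tau> by simp
        moreover have "F (dil (\<tau> n) p) / \<tau> n ^ m - wcoef F m p
            = (F (dil (\<tau> n) p) - \<tau> n ^ m * wcoef F m p) / \<tau> n ^ m"
          using \<tau> by (simp add: diff_divide_distrib)
        ultimately have "norm (F (dil (\<tau> n) p) / \<tau> n ^ m - wcoef F m p) \<le> C * norm (\<tau> n)"
          using \<tau>(1) [of n] by (simp add: norm_divide norm_power field_simps)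
        also have "\<dots> = C * \<delta> * (1 / real (Suc n))" by (simp add: norm)
        finally show "dist (F (dil (\<tau> n) p) / \<tau> n ^ m) (wcoef F m p) < e"
          using elim by (simp add: dist_norm)
      qed
    qed
  qed
  with \<tau> C(3) show ?thesis by blast
qed

lemma isCont_wcoef:
  assumes F: "holo_fun F U" "open U" "0 \<in> U" and 0: "\<And>k p. k < m \<Longrightarrow> wcoef F k p = 0"
  shows "isCont (wcoef F m) p"
proof -
  obtain \<tau> :: "nat \<Rightarrow> complex" where \<tau>: "\<And>n. \<tau> n \<noteq> 0"
    "\<And>n q. norm q \<le> norm p + 1 \<Longrightarrow> dil (\<tau> n) q \<in> U"
    "uniform_limit (cball 0 (norm p + 1)) (\<lambda>n p. F (dil (\<tau> n) p) / \<tau> n ^ m) (wcoef F m) sequentially"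
    using wcoef_uniform_limit [OF F 0, where N = "norm p + 1" and m = m] by blast
  have dil: "continuous_on S (dil (\<tau> n))" for S n
    unfolding dil_def by (intro continuous_intros)
  have "continuous_on (cball 0 (norm p + 1)) (wcoef F m)"
  proof (rule uniform_limit_theorem [OF _ \<tau>(3)])
    show "\<forall>\<^sub>F n in sequentially. continuous_on (cball 0 (norm p + 1)) (\<lambda>p. F (dil (\<tau> n) p) / \<tau> n ^ m)"
    proof (intro always_eventually allI continuous_intros)
      fix n
      show "continuous_on (cball 0 (norm p + 1)) (\<lambda>p. F (dil (\<tau> n) p))"
        by (rule continuous_on_compose2 [OF holo_fun_imp_continuous_on [OF F(1)] dil])
           (use \<tau>(2) in auto)
      show "\<forall>p\<in>cball 0 (norm p + 1). \<tau> n ^ m \<noteq> 0" using \<tau>(1) by simp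
    qed
  qed simp
  then have "continuous_on (ball 0 (norm p + 1)) (wcoef F m)"
    by (rule continuous_on_subset) auto
  then show ?thesis
    by (rule continuous_on_interior) simp
qed

text \<open>Weierstrass' convergence theorem on each disc, applied to the rescaled functions along
  the curve.\<close>

lemma curve_entire_wcoef:
  assumes F: "holo_fun F U" "open U" "0 \<in> U" and 0: "\<And>k p. k < m \<Longrightarrow> wcoef F k p = 0"
  shows "curve_entire (wcoef F m)"
  unfolding curve_entire_def
proof (intro allI)
  fix a b :: "complex ^ 'a" and w0 w1 w2 :: "complex ^ 2"
  let ?c = "\<lambda>x::complex. (a + x *s b, w0 + x *s w1 + x\<^sup>2 *s w2)"
  have cont: "continuous_on S ?c" for S
    by (intro continuous_intros)
  have "(\<lambda>x. wcoef F m (?c x)) holomorphic_on ball 0 R" if "R > 0" for R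
  proof -
    have "compact (?c ` cball 0 R)" by (intro compact_continuous_image cont) auto
    then obtain N where N: "\<And>x. norm x \<le> R \<Longrightarrow> norm (?c x) \<le> N"
      using compact_imp_bounded bounded_iff by (metis (no_types, lifting) image_eqI mem_cball_0)
    obtain \<tau> :: "nat \<Rightarrow> complex" where \<tau>: "\<And>n. \<tau> n \<noteq> 0"
      "\<And>n q. norm q \<le> N \<Longrightarrow> dil (\<tau> n) q \<in> U"
      "uniform_limit (cball 0 N) (\<lambda>n p. F (dil (\<tau> n) p) / \<tau> n ^ m) (wcoef F m) sequentially"
      using wcoef_uniform_limit [OF F 0, where N = N and m = m] by blast
    show ?thesis
    proof (rule holomorphic_uniform_sequence [where f = "\<lambda>n x. F (dil (\<tau> n) (?c x)) / \<tau> n ^ m"])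
      fix n
      \<comment> \<open>A dilation maps a quadratic curve with linear first component to one of the
        same kind.\<close>
      have eq: "dil (\<tau> n) (?c x) = (\<tau> n *s a + x *s (\<tau> n *s b),
          (\<tau> n)\<^sup>2 *s w0 + x *s ((\<tau> n)\<^sup>2 *s w1) + x\<^sup>2 *s ((\<tau> n)\<^sup>2 *s w2))" for x
        by (simp add: vec_eq_iff algebra_simps)
      have inU: "dil (\<tau> n) (?c x) \<in> U" if "x \<in> ball 0 R" for x
        by (rule \<tau>(2)) (use N that in simp)
      show "(\<lambda>x. F (dil (\<tau> n) (?c x)) / \<tau> n ^ m) holomorphic_on ball 0 R"
        using inU unfolding eq
        by (intro holomorphic_intros holo_fun_along_curve [OF F(1)]) (use \<tau>(1) in auto)
    next
      fix x :: complex assume "x \<in> ball 0 R"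
      then obtain d where d: "d > 0" "cball x d \<subseteq> ball 0 R"
        using open_contains_cball open_ball by blast
      have "uniform_limit (cball x d) (\<lambda>n x. F (dil (\<tau> n) (?c x)) / \<tau> n ^ m)
          (\<lambda>x. wcoef F m (?c x)) sequentially"
        by (rule uniform_limit_compose' [OF \<tau>(3)]) (use d(2) N in force)
      then show "\<exists>d>0. cball x d \<subseteq> ball 0 R \<and> uniform_limit (cball x d)
          (\<lambda>n x. F (dil (\<tau> n) (?c x)) / \<tau> n ^ m) (\<lambda>x. wcoef F m (?c x)) sequentially"
        using d by blast
    qed auto
  qed
  then have "(\<lambda>x. wcoef F m (?c x)) field_differentiable at x" for x
    by (rule holomorphic_on_imp_differentiable_at [of _ "ball 0 (norm x + 1)"])
       (simp_all add: add_nonneg_pos)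
  then show "(\<lambda>x. wcoef F m (?c x)) holomorphic_on UNIV"
    by (simp add: holomorphic_on_def field_differentiable_at_within)
qed

text \<open>F at the point dilated by t s is expanded twice, about p and about
  \<open>dil s p\<close>. A discrepancy between the leading terms would be bounded by M t for all
  small t > 0.\<close>

lemma wcoef_dil:
  assumes F: "holo_fun F U" "open U" "0 \<in> U" and 0: "\<And>k p. k < m \<Longrightarrow> wcoef F k p = 0"
  shows "wcoef F m (dil s p) = s ^ m * wcoef F m p"
proof (rule ccontr)
  define N where "N = max (norm p) (norm (dil s p))"
  obtain C \<delta> where C: "\<delta> > 0" "C \<ge> 0"
    "\<And>p t. norm p \<le> N \<Longrightarrow> norm t \<le> \<delta> \<Longrightarrow> norm (F (dil t p) - t ^ m * wcoef F m p) \<le> C * norm t ^ (m + 1)"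
    using weighted_expansion [OF F 0, where N = N and m = m] by metis
  define D where "D = norm (wcoef F m (dil s p) - s ^ m * wcoef F m p)"
  assume "\<not> ?thesis"
  then have D: "D > 0" by (simp add: D_def)
  define M where "M = C + C * norm s ^ (m + 1)"
  have M: "M \<ge> 0" using C by (simp add: M_def)
  have "D \<le> M * t" if t: "t > 0" "t \<le> \<delta>" "t * norm s \<le> \<delta>" for t :: real
  proof -
    let ?t = "complex_of_real t"
    have 1: "norm (F (dil ?t (dil s p)) - ?t ^ m * wcoef F m (dil s p)) \<le> C * t ^ (m + 1)"
      using C(3) [of "dil s p" ?t] t by (simp add: N_def)
    have 2: "norm (F (dil (?t * s) p) - (?t * s) ^ m * wcoef F m p) \<le> C * (t * norm s) ^ (m + 1)"
      using C(3) [of p "?t * s"] t by (simp add: N_def norm_mult)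
    have "t ^ m * D = norm (?t ^ m * wcoef F m (dil s p) - (?t * s) ^ m * wcoef F m p)"
    proof -
      have "?t ^ m * wcoef F m (dil s p) - (?t * s) ^ m * wcoef F m p
          = ?t ^ m * (wcoef F m (dil s p) - s ^ m * wcoef F m p)"
        by (simp add: algebra_simps power_mult_distrib)
      then show ?thesis using t by (simp add: D_def norm_mult norm_power)
    qed
    also have "\<dots> \<le> C * t ^ (m + 1) + C * (t * norm s) ^ (m + 1)"
      using norm_triangle_le_diff [OF add_mono [OF 2 1]] by (simp add: dil_dil norm_minus_commute)
    also have "\<dots> = t ^ m * (M * t)" by (simp add: M_def algebra_simps power_mult_distrib)
    finally show ?thesis using t(1) by simp
  qed
  moreover have "\<exists>t>0. t \<le> \<delta> \<and> t * norm s \<le> \<delta> \<and> M * t < D"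
  proof (intro exI conjI)
    \<comment> \<open>The first bound keeps t and t |s| below \<delta>, the second makes M t smaller
      than D; adding 1 avoids zero denominators.\<close>
    let ?t = "min (\<delta> / (1 + norm s)) (D / (1 + M))"
    have pos: "1 + norm s > 0" "1 + M > 0" using M by (auto intro: add_pos_nonneg)
    show "?t > 0" using C(1) D pos by simp
    have le: "?t * (1 + norm s) \<le> \<delta>" using pos 
      by (metis min.cobounded1 pos_le_divide_eq)
    have "?t * 1 \<le> ?t * (1 + norm s)" "?t * norm s \<le> ?t * (1 + norm s)"
      using \<open>?t > 0\<close> by (intro mult_left_mono; simp)+
    with le show "?t \<le> \<delta>" "?t * norm s \<le> \<delta>" by auto
    have "M * ?t \<le> M * (D / (1 + M))" using M by (intro mult_left_mono) auto
    also have "\<dots> < D" using D M pos by (simp add: field_simps)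
    finally show "M * ?t < D" .
  qed
  ultimately show False by (meson not_less)
qed

text \<open>For p near 0 the power series in t converges at t = 1, where the dilation is the
  identity.\<close>

lemma all_wcoef_0_imp:
  assumes F: "holo_fun F U" "open U" "0 \<in> U" and 0: "\<And>k p. wcoef F k p = 0"
  shows "\<forall>\<^sub>F p in nhds 0. F p = 0"
proof -
  obtain e where e: "e > 0" "ball 0 e \<subseteq> U" using F(2,3) open_contains_ball by blast
  \<comment> \<open>For |t| < 2 the dilated point has norm at most (2 + 4) |p|, and 6/8 < 1.\<close>
  have "F p = 0" if p: "norm p < e / 8" for p
  proof -
    have "dil t p \<in> U" if t: "t \<in> ball 0 2" for t
    proof -
      have "norm (dil t p) \<le> norm (t *s fst p) + norm (t\<^sup>2 *s snd p)"
        unfolding dil_def by (rule norm_Pair_le)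
      also have "\<dots> = norm t * norm (fst p) + norm t ^ 2 * norm (snd p)"
        by (simp add: norm_vector_smult norm_power)
      also have "\<dots> \<le> 2 * norm p + 2 ^ 2 * norm p"
        using t norm_fst_le [of "fst p" "snd p"] norm_snd_le [of "snd p" "fst p"]
        by (intro add_mono mult_mono power_mono) auto
      also have "\<dots> < e" using p e(1) by simp
      finally show ?thesis using e(2) by auto
    qed
    then have "(\<lambda>t. F (dil t p)) holomorphic_on ball 0 2"
      by (intro holo_fun_along_dil [OF F(1)]) auto
    from holomorphic_power_series [OF this, of 1]
    have "(\<lambda>n. wcoef F n p) sums F p" by (simp add: wcoef_def)
    then have "(\<lambda>n. 0) sums F p" by (simp add: 0)
    then show ?thesis by (metis sums_0 sums_unique2)
  qed
  then show ?thesis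
    using e(1) unfolding eventually_nhds_metric by (intro exI [of _ "e / 8"]) auto
qed


section \<open>The Levi forms of a manifold of finite type two\<close>

definition re_part :: "('n::finite) ambient \<Rightarrow> (complex ^ 'n) \<times> (real ^ 2)" where
  "re_part p = (fst p, \<chi> l. Re (snd p $ l))"

lemma bounded_linear_re_part: "bounded_linear re_part"
  unfolding linear_conv_bounded_linear [symmetric]
  by (rule linearI) (simp_all add: re_part_def vec_eq_iff)

lemma re_part_0 [simp]: "re_part 0 = 0"
  by (simp add: re_part_def zero_prod_def vec_eq_iff)

lemma hermitian_form_eq: "hermitian_form A z = cdot z (A *v z)"
  by (simp add: hermitian_form_def cdot_def)

lemma bounded_bilinear_cdot: "bounded_bilinear (cdot :: complex ^ ('n::finite) \<Rightarrow> _)"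
  unfolding bilinear_conv_bounded_bilinear [symmetric] bilinear_def
proof (intro conjI allI linearI)
  fix x y z :: "complex ^ 'n" and r :: real
  have r: "r *\<^sub>R v = complex_of_real r *s v" for v :: "complex ^ 'n"
    unfolding vec_eq_iff vector_scaleR_component vector_smult_component by (simp add: scaleR_conv_of_real)
  show "cdot x (y + z) = cdot x y + cdot x z" "cdot (y + z) x = cdot y x + cdot z x"
    by (simp_all add: cdot_linear)
  show "cdot x (r *\<^sub>R y) = r *\<^sub>R cdot x y" "cdot (r *\<^sub>R y) x = r *\<^sub>R cdot y x"
    unfolding r by (simp_all add: cdot_linear scaleR_conv_of_real)
qed

lemma bounded_linear_matrix_vector: "bounded_linear ((*v) (A :: complex ^ 'n::finite ^ 'm::finite))"
  unfolding linear_conv_bounded_linear [symmetric]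
  by (rule linearI) (simp_all add: matrix_vector_mult_def vec_eq_iff algebra_simps sum.distrib
      scaleR_sum_right)

declare split_paired_All [simp del]

section \<open>Weighted estimates for a remainder function and its gradient\<close>

locale graph_function =
  fixes V :: "((complex ^ ('n::finite)) \<times> (real ^ 2)) set" and r
  assumes V: "open V" "0 \<in> V" and C3: "Ck_on 3 r V" and vanish: "vanishes_to_weighted_order_2 r"
begin

definition D :: "(complex ^ 'n) \<times> (real ^ 2) \<Rightarrow> (complex ^ 'n) \<times> (real ^ 2) \<Rightarrow> real" where
  "D p v = frechet_derivative r (at p) v"

lemma r_0: "r 0 = 0"
  using vanish by (simp add: vanishes_to_weighted_order_2_def)

lemma has_derivative_r:
  assumes "p \<in> V" shows "(r has_derivative D p) (at p)"
proof -
  have "r differentiable_on V" using C3 by (simp add: eval_nat_numeral)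
  then have "r differentiable (at p)"
    using V(1) assms by (simp add: differentiable_on_eq_differentiable_at)
  then show ?thesis unfolding D_def [abs_def] using frechet_derivative_works by blast
qed

lemma linear_D: "p \<in> V \<Longrightarrow> linear (D p)"
  using has_derivative_r has_derivative_linear by blast

lemma differentiable_D:
  assumes "p \<in> V" shows "(\<lambda>x. D x v) differentiable (at p)"
proof -
  have "(\<lambda>x. frechet_derivative r (at x) v) differentiable_on V"
    using C3 by (simp add: eval_nat_numeral)
  then show ?thesis
    using V(1) assms by (simp add: differentiable_on_eq_differentiable_at D_def)
qed

lemma D_0: "D 0 v = 0"
proof -
  have "D 0 v = D 0 ((fst v, 0) + (0, snd v))" by simp
  also have "\<dots> = D 0 (fst v, 0) + D 0 (0, snd v)"
    by (rule linear_add [OF linear_D [OF V(2)]])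
  also have "\<dots> = 0" using vanish by (simp add: vanishes_to_weighted_order_2_def D_def)
  finally show ?thesis .
qed

definition DD :: "(complex ^ 'n) \<times> (real ^ 2) \<Rightarrow> (complex ^ 'n) \<times> (real ^ 2) \<Rightarrow> real" where
  "DD v = frechet_derivative (\<lambda>x. D x v) (at 0)"

lemma has_derivative_D: "((\<lambda>x. D x v) has_derivative DD v) (at 0)"
  unfolding DD_def using differentiable_D [OF V(2)] frechet_derivative_works by blast

lemma DD_0: "DD (\<zeta>, 0) (\<zeta>', 0) = 0"
  using vanish by (simp add: vanishes_to_weighted_order_2_def DD_def D_def)

text \<open>The product rule, with the linear form \<open>D (p t)\<close> expanded in a basis; all the terms
  vanish at \<open>t = 0\<close>.\<close>

lemma D_along_curve:
  fixes p a :: "real \<Rightarrow> (complex ^ 'n) \<times> (real ^ 2)"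
  assumes p: "p 0 = 0" "(p has_vector_derivative v) (at 0)" "snd v = 0"
    and a: "(a has_vector_derivative a') (at 0)" "snd (a 0) = 0"
  shows "((\<lambda>t. D (p t) (a t)) has_real_derivative 0) (at 0)"
proof -
  have Dp: "((\<lambda>t. D (p t) b) has_real_derivative DD b v) (at 0)" for b
  proof -
    have "((\<lambda>x. D x b) has_derivative DD b) (at (p 0))" using has_derivative_D p(1) by simp
    then have "((\<lambda>t. D (p t) b) has_derivative (\<lambda>h. DD b (h *\<^sub>R v))) (at 0)"
      using p(2) unfolding has_vector_derivative_def by (rule has_derivative_compose [rotated])
    moreover have "linear (DD b)" using has_derivative_D has_derivative_linear by blast
    then have "DD b (h *\<^sub>R v) = DD b v * h" for h by (simp add: linear_scale)
    ultimately show ?thesis by (simp add: has_field_derivative_def)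
  qed
  have ai: "((\<lambda>t. a t \<bullet> b) has_real_derivative (a' \<bullet> b)) (at 0)" for b
    using bounded_linear.has_vector_derivative [OF bounded_linear_inner_left a(1)]
    by (simp add: has_real_derivative_iff_has_vector_derivative)
  have zero: "(a 0 \<bullet> b) * DD b v = 0" if "b \<in> Basis" for b
  proof (cases "snd b = 0")
    case True
    then have "DD b v = DD (fst b, 0) (fst v, 0)" using p(3) by (metis prod.collapse)
    then show ?thesis by (simp add: DD_0)
  next
    case False
    then have "fst b = 0" using that by (auto simp: Basis_prod_def)
    then show ?thesis using a(2) by (simp add: inner_prod_def)
  qed
  have "((\<lambda>t. \<Sum>b\<in>Basis. (a t \<bullet> b) * D (p t) b) has_real_derivative
      (\<Sum>b\<in>Basis. (a' \<bullet> b) * D (p 0) b + DD b v * (a 0 \<bullet> b))) (at 0)"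
    by (intro DERIV_sum DERIV_mult ai Dp)
  moreover have "(\<Sum>b\<in>Basis. (a' \<bullet> b) * D (p 0) b + DD b v * (a 0 \<bullet> b)) = 0"
    using zero by (intro sum.neutral) (auto simp: p(1) D_0 mult.commute)
  moreover have ev: "\<forall>\<^sub>F t in nhds 0. (\<Sum>b\<in>Basis. (a t \<bullet> b) * D (p t) b) = D (p t) (a t)"
  proof -
    have "isCont p 0" using p(2) has_vector_derivative_continuous by blast
    then have "(p \<longlongrightarrow> p 0) (nhds 0)" by (simp add: continuous_at tendsto_nhds_iff)
    then have "\<forall>\<^sub>F t in nhds 0. p t \<in> V"
      using V p(1) by (intro topological_tendstoD) auto
    then show ?thesis
    proof eventually_elim
      case (elim t)
      have "D (p t) (\<Sum>b\<in>Basis. (a t \<bullet> b) *\<^sub>R b) = (\<Sum>b\<in>Basis. (a t \<bullet> b) *\<^sub>R D (p t) b)"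
        by (simp add: linear_sum [OF linear_D [OF elim]] linear_scale [OF linear_D [OF elim]])
      then show ?case by (simp add: euclidean_representation)
    qed
  qed
  ultimately show ?thesis
    using DERIV_cong_ev [OF refl ev refl] by simp
qed

text \<open>The Hessian at 0 has no z-z block, so on a box of size t in z and t^2 in u the
  z-gradient is O(t^2) plus the differentiability error o(t). For the u-gradient continuity
  suffices.\<close>

lemma gradient_estimate:
  assumes "\<epsilon> > 0" "C > 0"
  shows "\<forall>\<^sub>F t in at_right 0. \<forall>p. norm (fst p) \<le> C * t \<longrightarrow> norm (snd p) \<le> C * t\<^sup>2 \<longrightarrow>
     p \<in> V \<and> (\<forall>\<zeta>. \<bar>D p (\<zeta>, 0)\<bar> \<le> \<epsilon> * t * norm \<zeta>) \<and> (\<forall>\<eta>. \<bar>D p (0, \<eta>)\<bar> \<le> \<epsilon> * norm \<eta>)"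
proof -
  let ?P = "\<lambda>t (p :: (complex ^ 'n) \<times> (real ^ 2)). norm (fst p) \<le> C * t \<and> norm (snd p) \<le> C * t\<^sup>2"
  have norm_le: "norm p \<le> 2 * C * t" if "?P t p" "0 < t" "t \<le> 1"
    for p :: "(complex ^ 'n) \<times> (real ^ 2)" and t
  proof -
    have "norm p \<le> norm (fst p) + norm (snd p)"
      using norm_Pair_le [of "fst p" "snd p"] by simp
    also have "\<dots> \<le> C * t + C * t\<^sup>2" using that by simp
    also have "C * t\<^sup>2 \<le> C * t" using that assms by (simp add: power2_eq_square)
    finally show ?thesis by simp
  qed
  have small: "\<forall>\<^sub>F t in at_right 0. t < d \<and> 0 < t \<and> t \<le> 1" if "d > 0" for d :: real
    unfolding eventually_at_right_field using that by (intro exI [of _ "min d 1"]) auto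
  have near: "\<forall>\<^sub>F t in at_right 0. \<forall>p. ?P t p \<longrightarrow> norm p < d" if "d > 0"
    for d
  proof -
    have "\<forall>\<^sub>F t in at_right 0. t < d / (2 * C) \<and> 0 < t \<and> t \<le> 1"
      using assms that by (intro small) simp
    then show ?thesis
    proof eventually_elim
      case (elim t)
      then have "2 * C * t < d" using assms by (simp add: field_simps)
      then show ?case using norm_le [of _ t] elim by (meson le_less_trans)
    qed
  qed
  obtain dV where "dV > 0" "ball 0 dV \<subseteq> V" using V open_contains_ball by blast
  then have inV: "\<forall>\<^sub>F t in at_right 0. \<forall>p. ?P t p \<longrightarrow> p \<in> V"
    by (intro eventually_mono [OF near [of dV]]) (simp_all add: subset_iff)
  \<comment> \<open>The bound e t is split in two: t < e / (2 C K) controls the Hessian term, and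
    the factor e / (4 C) matches norm p \<le> 2 C t in the differentiability error.\<close>
  have sharp: "\<forall>\<^sub>F t in at_right 0. \<forall>p. ?P t p \<longrightarrow> \<bar>D p (b, 0)\<bar> \<le> e * t" if "e > 0" for e b
  proof -
    have lin: "bounded_linear (DD (b, 0))" using has_derivative_D has_derivative_bounded_linear by blast
    then obtain K where K: "K > 0" "\<And>x. norm (DD (b, 0) x) \<le> norm x * K"
      using bounded_linear.pos_bounded by blast
    have "e / (4 * C) > 0" using assms that by simp
    then obtain d where d: "d > 0" "\<And>p. norm p < d \<Longrightarrow>
        norm (D p (b, 0) - DD (b, 0) p) \<le> e / (4 * C) * norm p"
      using has_derivative_D [of "(b, 0)"] unfolding has_derivative_at_alt by (auto simp: D_0)
    have "\<forall>\<^sub>F t in at_right 0. t < e / (2 * C * K) \<and> 0 < t \<and> t \<le> 1"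
      using assms that K by (intro small) simp
    with near [OF d(1)] show ?thesis
    proof eventually_elim
      case (elim t)
      show ?case
      proof (intro allI impI)
        fix p :: "(complex ^ 'n) \<times> (real ^ 2)" assume p: "?P t p"
        have "DD (b, 0) p = DD (b, 0) ((fst p, 0) + (0, snd p))" by simp
        also have "\<dots> = DD (b, 0) (0, snd p)"
          unfolding linear_add [OF bounded_linear.linear [OF lin]] by (simp add: DD_0)
        finally have "\<bar>DD (b, 0) p\<bar> \<le> norm (snd p) * K"
          using K(2) [of "(0, snd p)"] by simp
        also have "\<dots> \<le> C * t\<^sup>2 * K" using p K(1) by (intro mult_right_mono) auto
        also have "\<dots> = (C * K * t) * t" by (simp add: power2_eq_square)
        also have "\<dots> \<le> (e / 2) * t"
          using elim K(1) assms by (intro mult_right_mono) (auto simp: field_simps)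
        finally have 1: "\<bar>DD (b, 0) p\<bar> \<le> (e / 2) * t" .
        have "\<bar>D p (b, 0) - DD (b, 0) p\<bar> \<le> e / (4 * C) * norm p"
          using d(2) elim p by auto
        also have "\<dots> \<le> e / (4 * C) * (2 * C * t)"
          using norm_le p elim assms that by (intro mult_left_mono) auto
        also have "\<dots> = (e / 2) * t" using assms by (simp add: field_simps)
        finally show "\<bar>D p (b, 0)\<bar> \<le> e * t" using 1 by linarith
      qed
    qed
  qed
  have soft: "\<forall>\<^sub>F t in at_right 0. \<forall>p. ?P t p \<longrightarrow> \<bar>D p (0, b)\<bar> \<le> e" if "e > 0" for e b
  proof -
    have "isCont (\<lambda>p. D p (0, b)) 0"
      using differentiable_D [OF V(2)] differentiable_imp_continuous_within by blast
    then have "\<exists>d>0. \<forall>p. norm p < d \<longrightarrow> \<bar>D p (0, b)\<bar> < e"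
      using that unfolding continuous_at_eps_delta dist_norm by (simp add: D_0)
    then obtain d where d: "d > 0" "\<And>p. norm p < d \<Longrightarrow> \<bar>D p (0, b)\<bar> < e" by blast
    show ?thesis using near [OF d(1)] by eventually_elim (use d(2) less_imp_le in blast)
  qed
  \<comment> \<open>The estimates hold for t small depending on the direction; finitely many basis
    directions make them uniform.\<close>
  have basis_bound: "\<bar>L x\<bar> \<le> real DIM('b) * k * norm x"
    if "linear L" "\<And>b. b \<in> Basis \<Longrightarrow> \<bar>L b\<bar> \<le> k" for L :: "'b::euclidean_space \<Rightarrow> real" and k x
  proof -
    have "L x = (\<Sum>b\<in>Basis. (x \<bullet> b) * L b)"
      using linear_sum [OF that(1), of "\<lambda>b. (x \<bullet> b) *\<^sub>R b" Basis]
      by (simp add: euclidean_representation linear_scale [OF that(1)])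
    also have "\<bar>\<dots>\<bar> \<le> (\<Sum>b\<in>Basis. \<bar>(x \<bullet> b) * L b\<bar>)" by (rule sum_abs)
    also have "\<dots> \<le> (\<Sum>b\<in>(Basis::'b set). norm x * k)"
      unfolding abs_mult by (intro sum_mono mult_mono that(2) Basis_le_norm) auto
    finally show ?thesis by (simp add: mult_ac)
  qed
  define e where "e = \<epsilon> / (real DIM(complex ^ 'n) + real DIM(real ^ 2))"
  have e: "e > 0" using assms(1) by (simp add: e_def)
  have e1: "real DIM(complex ^ 'n) * e \<le> \<epsilon>" "real DIM(real ^ 2) * e \<le> \<epsilon>"
    using assms(1) by (simp_all add: e_def field_simps)
  have "\<forall>\<^sub>F t in at_right 0. \<forall>b\<in>Basis. \<forall>p. ?P t p \<longrightarrow> \<bar>D p (b, 0)\<bar> \<le> e * t"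
    by (intro eventually_ball_finite ballI sharp e) auto
  moreover have "\<forall>\<^sub>F t in at_right 0. \<forall>b\<in>Basis. \<forall>p. ?P t p \<longrightarrow> \<bar>D p (0, b)\<bar> \<le> e"
    by (intro eventually_ball_finite ballI soft e) auto
  ultimately show ?thesis
    using inV small [OF zero_less_one]
  proof eventually_elim
    case (elim t)
    show ?case
    proof (intro allI impI)
      fix p :: "(complex ^ 'n) \<times> (real ^ 2)"
      assume "norm (fst p) \<le> C * t" "norm (snd p) \<le> C * t\<^sup>2"
      then have p: "?P t p" by simp
      then have pV: "p \<in> V" using elim by blast
      note lin = linear_D [OF pV]
      have "linear (D p \<circ> (\<lambda>\<zeta>. (\<zeta>, 0)))" "linear (D p \<circ> (\<lambda>\<eta>. (0, \<eta>)))"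
        by (intro linear_compose lin linearI; simp)+
      then have l1: "linear (\<lambda>\<zeta>. D p (\<zeta>, 0))" and l2: "linear (\<lambda>\<eta>. D p (0, \<eta>))"
        by (simp_all add: o_def)
      have "\<bar>D p (\<zeta>, 0)\<bar> \<le> \<epsilon> * t * norm \<zeta>" for \<zeta>
      proof -
        have "\<bar>D p (\<zeta>, 0)\<bar> \<le> real DIM(complex ^ 'n) * (e * t) * norm \<zeta>"
          by (rule basis_bound [OF l1]) (use elim p in blast)
        also have "\<dots> = (real DIM(complex ^ 'n) * e) * (t * norm \<zeta>)" by simp
        also have "\<dots> \<le> \<epsilon> * (t * norm \<zeta>)" using e1 elim by (intro mult_right_mono) auto
        finally show ?thesis by simp
      qed
      moreover have "\<bar>D p (0, \<eta>)\<bar> \<le> \<epsilon> * norm \<eta>" for \<eta>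
      proof -
        have "\<bar>D p (0, \<eta>)\<bar> \<le> real DIM(real ^ 2) * e * norm \<eta>"
          by (rule basis_bound [OF l2]) (use elim p in blast)
        also have "\<dots> \<le> \<epsilon> * norm \<eta>" using e1 by (intro mult_right_mono) auto
        finally show ?thesis .
      qed
      ultimately show "p \<in> V \<and> (\<forall>\<zeta>. \<bar>D p (\<zeta>, 0)\<bar> \<le> \<epsilon> * t * norm \<zeta>) \<and>
          (\<forall>\<eta>. \<bar>D p (0, \<eta>)\<bar> \<le> \<epsilon> * norm \<eta>)"
        using pV by blast
    qed
  qed
qed

text \<open>Mean value theorem on the segment from a to b, which stays in the convex weighted box.
  Increments O(t^m) in z and O(t^(m+1)) in u then cost only o(t^(m+1)).\<close>

lemma difference_estimate:
  assumes "\<epsilon> > 0" "C > 0"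
  shows "\<forall>\<^sub>F t in at_right 0. \<forall>a b. norm (fst a) \<le> C * t \<longrightarrow> norm (snd a) \<le> C * t\<^sup>2 \<longrightarrow>
     norm (fst b) \<le> C * t \<longrightarrow> norm (snd b) \<le> C * t\<^sup>2 \<longrightarrow>
     \<bar>r b - r a\<bar> \<le> \<epsilon> * (t * norm (fst b - fst a) + norm (snd b - snd a))"
  using gradient_estimate [OF assms]
proof eventually_elim
  case (elim t)
  show ?case
  proof (intro allI impI)
    fix a b :: "(complex ^ 'n) \<times> (real ^ 2)"
    assume ab: "norm (fst a) \<le> C * t" "norm (snd a) \<le> C * t\<^sup>2"
      "norm (fst b) \<le> C * t" "norm (snd b) \<le> C * t\<^sup>2"
    define \<phi> where "\<phi> s = a + s *\<^sub>R (b - a)" for s :: real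
    have \<phi>: "norm (fst (\<phi> s)) \<le> C * t" "norm (snd (\<phi> s)) \<le> C * t\<^sup>2" if "0 \<le> s" "s \<le> 1" for s
    proof -
      have "\<phi> s = (1 - s) *\<^sub>R a + s *\<^sub>R b" by (simp add: \<phi>_def algebra_simps)
      moreover have "(1 - s) *\<^sub>R fst a + s *\<^sub>R fst b \<in> cball 0 (C * t)"
        by (rule convexD [OF convex_cball]) (use ab that in auto)
      moreover have "(1 - s) *\<^sub>R snd a + s *\<^sub>R snd b \<in> cball 0 (C * t\<^sup>2)"
        by (rule convexD [OF convex_cball]) (use ab that in auto)
      ultimately show "norm (fst (\<phi> s)) \<le> C * t" "norm (snd (\<phi> s)) \<le> C * t\<^sup>2" by simp_all
    qed
    have "\<exists>s. 0 < s \<and> s < 1 \<and> r (\<phi> 1) - r (\<phi> 0) = (1 - 0) * D (\<phi> s) (b - a)"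
    proof (rule MVT2)
      fix s :: real assume s: "0 \<le> s" "s \<le> 1"
      then have inV: "\<phi> s \<in> V" using elim \<phi> by blast
      have "(\<phi> has_derivative (\<lambda>h. h *\<^sub>R (b - a))) (at s)"
        unfolding \<phi>_def by (auto intro!: derivative_eq_intros)
      from has_derivative_compose [OF this has_derivative_r [OF inV]]
      show "((\<lambda>s. r (\<phi> s)) has_real_derivative D (\<phi> s) (b - a)) (at s)"
        by (simp add: has_field_derivative_def linear_scale [OF linear_D [OF inV]] mult.commute [of _ "D _ _"])
    qed simp
    then obtain s where s: "0 < s" "s < 1" "r b - r a = D (\<phi> s) (b - a)"
      by (auto simp: \<phi>_def)
    then have D: "\<phi> s \<in> V" "\<And>\<zeta>. \<bar>D (\<phi> s) (\<zeta>, 0)\<bar> \<le> \<epsilon> * t * norm \<zeta>"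
      "\<And>\<eta>. \<bar>D (\<phi> s) (0, \<eta>)\<bar> \<le> \<epsilon> * norm \<eta>"
      using elim \<phi> [of s] by auto
    have "D (\<phi> s) (b - a) = D (\<phi> s) (fst b - fst a, 0) + D (\<phi> s) (0, snd b - snd a)"
      using linear_add [OF linear_D [OF D(1)], of "(fst b - fst a, 0)" "(0, snd b - snd a)"]
      by (simp add: minus_prod_def)
    then show "\<bar>r b - r a\<bar> \<le> \<epsilon> * (t * norm (fst b - fst a) + norm (snd b - snd a))"
      using D(2) [of "fst b - fst a"] D(3) [of "snd b - snd a"] s(3) by (simp add: algebra_simps)
  qed
qed

end


lemma bounded_linear_cscale: "bounded_linear (cscale c :: ('n::finite) ambient \<Rightarrow> _)"
  unfolding linear_conv_bounded_linear [symmetric]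
  by (rule linearI) (simp_all add: cscale_def vec_eq_iff algebra_simps)

lemma has_vector_derivative_vec:
  fixes F :: "real \<Rightarrow> complex ^ 'n::finite"
  assumes "\<And>i. ((\<lambda>t. F t $ i) has_vector_derivative F' $ i) (at x)"
  shows "(F has_vector_derivative F') (at x)"
proof -
  have "((\<lambda>t. \<Sum>i\<in>UNIV. (F t $ i) *s axis i 1) has_vector_derivative
      (\<Sum>i\<in>UNIV. (F' $ i) *s axis i (1::complex))) (at x)"
    by (intro has_vector_derivative_sum assms
        bounded_linear.has_vector_derivative [OF bounded_linear_smult_left])
  then show ?thesis by (simp add: basis_expansion)
qed

lemma tangent_space_0:
  assumes "\<And>t. \<gamma> t \<in> M" "(\<gamma> has_vector_derivative v) (at 0)"
  shows "v \<in> tangent_space M (\<gamma> 0)"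
  using assms unfolding tangent_space_def by blast

section \<open>Tangent vectors of M in standard coordinates, and independence of the Levi
  matrices\<close>

locale standard_manifold =
  fixes M :: "('n::finite) ambient set" and A :: "2 \<Rightarrow> complex ^ 'n ^ 'n"
    and R :: "2 \<Rightarrow> (complex ^ 'n) \<times> (real ^ 2) \<Rightarrow> real" and U V
  assumes herm: "\<And>j. hermitian_matrix (A j)"
    and U: "open U" "0 \<in> U" and V: "open V" "0 \<in> V"
    and C3: "\<And>j. Ck_on 3 (R j) V" and vanish: "\<And>j. vanishes_to_weighted_order_2 (R j)"
    and re_part_V: "\<And>p. p \<in> U \<Longrightarrow> re_part p \<in> V"
    and mem_M': "\<And>p. p \<in> U \<Longrightarrow> p \<in> M \<longleftrightarrow>
      (\<forall>j. complex_of_real (Im (snd p $ j)) = hermitian_form (A j) (fst p) + complex_of_real (R j (re_part p)))"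
begin

sublocale R: graph_function V "R j" for j
  by unfold_locales (use V C3 vanish in auto)

lemma Im_cdot_self: "Im (cdot z (A j *v z)) = 0"
  using arg_cong [OF cdot_hermitian [OF herm, of z j z], of Im] by simp

lemma mem_M:
  assumes "p \<in> U"
  shows "p \<in> M \<longleftrightarrow> (\<forall>j. Im (snd p $ j) = Re (cdot (fst p) (A j *v fst p)) + R j (re_part p))"
  unfolding mem_M' [OF assms] by (simp add: complex_eq_iff hermitian_form_eq Im_cdot_self)

text \<open>The defining equations differentiated along a curve in M. Points other than 0 are
  included because tangent fields are followed along curves later.\<close>

lemma tangent_vector:
  assumes p: "p \<in> M" "p \<in> U" and v: "v \<in> tangent_space M p"
  shows "Im (snd v $ j) = Re (cdot (fst v) (A j *v fst p)) + Re (cdot (fst p) (A j *v fst v))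
    + R.D j (re_part p) (re_part v)"
proof -
  obtain \<gamma> where \<gamma>: "\<gamma> 0 = p" "\<And>t. \<gamma> t \<in> M" "(\<gamma> has_vector_derivative v) (at 0)"
    using v unfolding tangent_space_def by blast
  have lin_im: "bounded_linear (\<lambda>p::'n ambient. Im (snd p $ j))"
    unfolding linear_conv_bounded_linear [symmetric] by (rule linearI) simp_all
  have 1: "((\<lambda>t. Im (snd (\<gamma> t) $ j)) has_real_derivative Im (snd v $ j)) (at 0)"
    using bounded_linear.has_vector_derivative [OF lin_im \<gamma>(3)]
    by (simp add: has_real_derivative_iff_has_vector_derivative)
  have z: "((\<lambda>t. fst (\<gamma> t)) has_vector_derivative fst v) (at 0)"
    by (rule bounded_linear.has_vector_derivative [OF bounded_linear_fst \<gamma>(3)])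
  have Az: "((\<lambda>t. A j *v fst (\<gamma> t)) has_vector_derivative A j *v fst v) (at 0)"
    by (rule bounded_linear.has_vector_derivative [OF bounded_linear_matrix_vector z])
  have "((\<lambda>t. Re (cdot (fst (\<gamma> t)) (A j *v fst (\<gamma> t)))) has_vector_derivative
      Re (cdot (fst (\<gamma> 0)) (A j *v fst v) + cdot (fst v) (A j *v fst (\<gamma> 0)))) (at 0)"
    by (rule bounded_linear.has_vector_derivative [OF bounded_linear_Re
          bounded_bilinear.has_vector_derivative [OF bounded_bilinear_cdot z Az]])
  then have 2: "((\<lambda>t. Re (cdot (fst (\<gamma> t)) (A j *v fst (\<gamma> t)))) has_real_derivative
      Re (cdot (fst p) (A j *v fst v) + cdot (fst v) (A j *v fst p))) (at 0)"
    by (simp add: has_real_derivative_iff_has_vector_derivative \<gamma>(1))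
  have re: "((\<lambda>t. re_part (\<gamma> t)) has_derivative (\<lambda>h. h *\<^sub>R re_part v)) (at 0)"
    using bounded_linear.has_vector_derivative [OF bounded_linear_re_part \<gamma>(3)]
    by (simp add: has_vector_derivative_def)
  have inV: "re_part p \<in> V" using re_part_V p(2) .
  have "(R j has_derivative R.D j (re_part p)) (at (re_part (\<gamma> 0)))"
    using R.has_derivative_r [OF inV] \<gamma>(1) by simp
  from has_derivative_compose [OF re this]
  have 3: "((\<lambda>t. R j (re_part (\<gamma> t))) has_real_derivative R.D j (re_part p) (re_part v)) (at 0)"
    unfolding has_field_derivative_def
    by (rule has_derivative_eq_rhs) (simp add: fun_eq_iff linear_scale [OF R.linear_D [OF inV]])
  have "isCont \<gamma> 0" using \<gamma>(3) has_vector_derivative_continuous by blast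
  then have "(\<gamma> \<longlongrightarrow> p) (nhds 0)" by (simp add: continuous_at tendsto_nhds_iff \<gamma>(1))
  then have "\<forall>\<^sub>F t in nhds 0. \<gamma> t \<in> U" using U(1) p(2) by (intro topological_tendstoD) auto
  then have ev: "\<forall>\<^sub>F t in nhds 0.
      Im (snd (\<gamma> t) $ j) = Re (cdot (fst (\<gamma> t)) (A j *v fst (\<gamma> t))) + R j (re_part (\<gamma> t))"
    by eventually_elim (use \<gamma>(2) mem_M in blast)
  from DERIV_unique [OF 1 [unfolded DERIV_cong_ev [OF refl ev refl]] DERIV_add [OF 2 3]]
  show ?thesis by simp
qed

lemma tangent_at_0: "0 \<in> M \<Longrightarrow> v \<in> tangent_space M 0 \<Longrightarrow> Im (snd v $ j) = 0"
  using tangent_vector [of 0 v j] U(2) by (simp add: R.D_0)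

lemma complex_tangent_at_0:
  assumes "0 \<in> M" "v \<in> complex_tangent_space M 0" shows "snd v = 0"
proof -
  have v: "v \<in> tangent_space M 0" "cscale \<i> v \<in> tangent_space M 0"
    using assms(2) by (auto simp: complex_tangent_space_def)
  have "snd v $ j = 0" for j
    using tangent_at_0 [OF assms(1) v(1), of j] tangent_at_0 [OF assms(1) v(2), of j]
    by (simp add: cscale_def complex_eq_iff)
  then show ?thesis by (simp add: vec_eq_iff)
qed

text \<open>The line t (z, c) is lifted to the graph; the terms of weight at least 2 have no first
  derivative at t = 0.\<close>

lemma tangent_space_at_0I:
  assumes M_0: "0 \<in> M"
  shows "(z, \<chi> j. complex_of_real (c $ j)) \<in> tangent_space M 0"
proof -
  define W where "W t = (\<chi> j. Complex (t * c $ j) (t\<^sup>2 * Re (cdot z (A j *v z)) + R j (t *\<^sub>R z, t *\<^sub>R c)))" for t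
  \<comment> \<open>\<open>tangent_space\<close> asks for curves that stay in M for all t, so
    outside U the curve takes the value 0, a point of M.\<close>
  define \<gamma> :: "real \<Rightarrow> 'n ambient" where "\<gamma> t = (if (t *\<^sub>R z, W t) \<in> U then (t *\<^sub>R z, W t) else 0)" for t
  have W0: "W 0 = 0" using R.r_0 by (simp add: W_def vec_eq_iff complex_eq_iff zero_prod_def)
  have re: "re_part (t *\<^sub>R z, W t) = (t *\<^sub>R z, t *\<^sub>R c)" for t by (simp add: re_part_def W_def vec_eq_iff)
  have mem: "\<gamma> t \<in> M" for t
  proof (cases "(t *\<^sub>R z, W t) \<in> U")
    case True
    have "Re (cdot (t *\<^sub>R z) (A j *v (t *\<^sub>R z))) = t\<^sup>2 * Re (cdot z (A j *v z))" for j
    proof -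
      have "t *\<^sub>R z = complex_of_real t *s z"
        unfolding vec_eq_iff vector_scaleR_component vector_smult_component
        by (simp add: scaleR_conv_of_real)
      then show ?thesis
        by (simp add: matrix_linear cdot_linear power2_eq_square flip: of_real_mult mult.assoc)
    qed
    then show ?thesis using True mem_M [OF True] by (simp add: \<gamma>_def re) (simp add: W_def)
  next
    case False
    then show ?thesis using M_0 by (simp add: \<gamma>_def)
  qed
  have Rj: "((\<lambda>t. t\<^sup>2 * Re (cdot z (A j *v z)) + R j (t *\<^sub>R z, t *\<^sub>R c)) has_vector_derivative 0) (at 0)" for j
  proof -
    have "((\<lambda>t. (t *\<^sub>R z, t *\<^sub>R c)) has_derivative (\<lambda>h. (h *\<^sub>R z, h *\<^sub>R c))) (at 0)"
      by (auto intro!: derivative_eq_intros)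
    moreover have "(R j has_derivative R.D j 0) (at (0 *\<^sub>R z, 0 *\<^sub>R c))"
      using R.has_derivative_r [OF V(2)] by (simp add: zero_prod_def)
    ultimately have "((\<lambda>t. R j (t *\<^sub>R z, t *\<^sub>R c)) has_derivative (\<lambda>h. R.D j 0 (h *\<^sub>R z, h *\<^sub>R c))) (at 0)"
      by (rule has_derivative_compose)
    then have "((\<lambda>t. R j (t *\<^sub>R z, t *\<^sub>R c)) has_real_derivative 0) (at 0)"
      by (simp add: has_real_derivative_iff_has_vector_derivative has_vector_derivative_def R.D_0)
    moreover have "((\<lambda>t. t\<^sup>2 * Re (cdot z (A j *v z))) has_real_derivative 0) (at 0)"
      by (auto intro!: derivative_eq_intros)
    ultimately show ?thesis
      using DERIV_add by (fastforce simp flip: has_real_derivative_iff_has_vector_derivative)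
  qed
  have "(W has_vector_derivative (\<chi> j. complex_of_real (c $ j))) (at 0)"
  proof (rule has_vector_derivative_vec)
    fix j
    have "((\<lambda>t. t * c $ j) has_vector_derivative c $ j) (at 0)"
      by (auto intro!: derivative_eq_intros simp: has_vector_derivative_def)
    from has_vector_derivative_add [OF
        bounded_linear.has_vector_derivative [OF bounded_linear_of_real this]
        has_vector_derivative_mult_right [OF
          bounded_linear.has_vector_derivative [OF bounded_linear_of_real Rj [of j]], of \<i>]]
    show "((\<lambda>t. W t $ j) has_vector_derivative (\<chi> j. complex_of_real (c $ j)) $ j) (at 0)"
      by (simp add: W_def Complex_eq)
  qed
  moreover have "((\<lambda>t. t *\<^sub>R z) has_vector_derivative z) (at 0)"
    by (auto intro!: derivative_eq_intros simp: has_vector_derivative_def)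
  ultimately have g: "((\<lambda>t. (t *\<^sub>R z, W t)) has_vector_derivative (z, \<chi> j. complex_of_real (c $ j))) (at 0)"
    by (intro has_vector_derivative_Pair)
  then have "isCont (\<lambda>t. (t *\<^sub>R z, W t)) 0" using has_vector_derivative_continuous by blast
  then have "((\<lambda>t. (t *\<^sub>R z, W t)) \<longlongrightarrow> 0) (nhds 0)"
    by (simp add: continuous_at tendsto_nhds_iff W0 zero_prod_def)
  then have "\<forall>\<^sub>F t in nhds 0. (t *\<^sub>R z, W t) \<in> U" using U by (intro topological_tendstoD) auto
  then have "\<forall>\<^sub>F t in nhds 0. \<gamma> t = (t *\<^sub>R z, W t)" by eventually_elim (simp add: \<gamma>_def)
  then have "(\<gamma> has_vector_derivative (z, \<chi> j. complex_of_real (c $ j))) (at 0)"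
    using g by (subst has_vector_derivative_cong_ev) (auto elim: eventually_mono simp: \<gamma>_def W0 U(2) zero_prod_def [symmetric])
  from tangent_space_0 [OF mem this] show ?thesis
    using U(2) W0 by (simp add: \<gamma>_def zero_prod_def)
qed

context
  fixes x y :: real
  assumes dependent: "\<And>z. complex_of_real x *s (A 1 *v z) + of_real y *s (A 2 *v z) = 0"
    and M_0: "0 \<in> M"
begin

lemma dependent_cdot: "x * Re (cdot u (A 1 *v z)) + y * Re (cdot u (A 2 *v z)) = 0"
proof -
  have "cdot u (complex_of_real x *s (A 1 *v z) + of_real y *s (A 2 *v z)) = 0"
    by (simp add: dependent)
  from arg_cong [OF this, of Re] show ?thesis by (simp add: cdot_linear)
qed

text \<open>In the combination with coefficients x, y the Levi terms of the tangency condition for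
  \<i> X cancel. The gradient terms of R are left, and by \<open>D_along_curve\<close> they have
  derivative 0 along a complex tangent direction.\<close>

lemma field_derivative:
  assumes X: "complex_tangent_field M 0 X" and v: "v \<in> complex_tangent_space M 0"
  shows "x * Re (snd (frechet_derivative X (at 0) v) $ 1)
    + y * Re (snd (frechet_derivative X (at 0) v) $ 2) = 0"
proof -
  obtain W where W: "open W" "0 \<in> W" "Ck_on 2 X W"
    "\<And>q. q \<in> M \<Longrightarrow> q \<in> W \<Longrightarrow> X q \<in> complex_tangent_space M q"
    using X unfolding complex_tangent_field_def by blast
  have "X differentiable_on W" using W(3) by (simp add: eval_nat_numeral)
  then have "X differentiable (at 0)"
    using W(1,2) by (simp add: differentiable_on_eq_differentiable_at)
  then have DX: "(X has_derivative frechet_derivative X (at 0)) (at 0)"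
    using frechet_derivative_works by blast
  define w where "w = frechet_derivative X (at 0) v"
  have "v \<in> tangent_space M 0" using v by (simp add: complex_tangent_space_def)
  then obtain \<gamma> where \<gamma>: "\<gamma> 0 = 0" "\<And>t. \<gamma> t \<in> M" "(\<gamma> has_vector_derivative v) (at 0)"
    unfolding tangent_space_def by blast
  have "(X has_derivative frechet_derivative X (at 0)) (at (\<gamma> 0))" using DX \<gamma>(1) by simp
  from has_derivative_compose [OF \<gamma>(3) [unfolded has_vector_derivative_def] this]
  have \<xi>: "((\<lambda>t. X (\<gamma> t)) has_vector_derivative w) (at 0)"
    by (simp add: has_vector_derivative_def w_def linear_scale [OF has_derivative_linear [OF DX]])
  have re: "((\<lambda>t. re_part (\<gamma> t)) has_vector_derivative re_part v) (at 0)"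
    by (rule bounded_linear.has_vector_derivative [OF bounded_linear_re_part \<gamma>(3)])
  have a: "((\<lambda>t. re_part (cscale \<i> (X (\<gamma> t)))) has_vector_derivative re_part (cscale \<i> w)) (at 0)"
    by (intro bounded_linear.has_vector_derivative [OF bounded_linear_re_part]
        bounded_linear.has_vector_derivative [OF bounded_linear_cscale] \<xi>)
  have X0: "snd (X 0) = 0"
    using complex_tangent_at_0 [OF M_0] W(2,4) M_0 by blast
  have RD: "((\<lambda>t. R.D j (re_part (\<gamma> t)) (re_part (cscale \<i> (X (\<gamma> t))))) has_real_derivative 0) (at 0)"
    for j
    by (rule R.D_along_curve [OF _ re _ a])
       (simp_all add: \<gamma>(1), simp_all add: re_part_def complex_tangent_at_0 [OF M_0 v] X0 cscale_def vec_eq_iff)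
  have lin: "bounded_linear (\<lambda>p::'n ambient. Re (snd p $ j))" for j
    unfolding linear_conv_bounded_linear [symmetric] by (rule linearI) simp_all
  have L: "((\<lambda>t. Re (snd (X (\<gamma> t)) $ j)) has_real_derivative Re (snd w $ j)) (at 0)" for j
    using bounded_linear.has_vector_derivative [OF lin \<xi>]
    by (simp add: has_real_derivative_iff_has_vector_derivative)
  have "isCont \<gamma> 0" using \<gamma>(3) has_vector_derivative_continuous by blast
  then have "(\<gamma> \<longlongrightarrow> 0) (nhds 0)" by (simp add: continuous_at tendsto_nhds_iff \<gamma>(1))
  then have "\<forall>\<^sub>F t in nhds 0. \<gamma> t \<in> U \<inter> W" using U W(1,2) by (intro topological_tendstoD) auto
  then have ev: "\<forall>\<^sub>F t in nhds 0. x * Re (snd (X (\<gamma> t)) $ 1) + y * Re (snd (X (\<gamma> t)) $ 2)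
      = x * R.D 1 (re_part (\<gamma> t)) (re_part (cscale \<i> (X (\<gamma> t))))
      + y * R.D 2 (re_part (\<gamma> t)) (re_part (cscale \<i> (X (\<gamma> t))))"
  proof eventually_elim
    case (elim t)
    then have "cscale \<i> (X (\<gamma> t)) \<in> tangent_space M (\<gamma> t)"
      using W(4) \<gamma>(2) by (auto simp: complex_tangent_space_def)
    note * = tangent_vector [OF \<gamma>(2) _ this]
    \<comment> \<open>Tangency constrains imaginary parts of w-components; applied to \<i> X it
      yields the real parts of those of X.\<close>
    have "Im (snd (cscale \<i> (X (\<gamma> t))) $ j) = Re (snd (X (\<gamma> t)) $ j)" for j
      by (simp add: cscale_def)
    then have "Re (snd (X (\<gamma> t)) $ j) =
        Re (cdot (fst (cscale \<i> (X (\<gamma> t)))) (A j *v fst (\<gamma> t)))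
      + Re (cdot (fst (\<gamma> t)) (A j *v fst (cscale \<i> (X (\<gamma> t)))))
      + R.D j (re_part (\<gamma> t)) (re_part (cscale \<i> (X (\<gamma> t))))" for j
      using *[of j] elim by simp
    then show ?case
      using dependent_cdot [of "fst (cscale \<i> (X (\<gamma> t)))" "fst (\<gamma> t)"]
        dependent_cdot [of "fst (\<gamma> t)" "fst (cscale \<i> (X (\<gamma> t)))"]
      by (simp only: distrib_left)
  qed
  have "((\<lambda>t. x * Re (snd (X (\<gamma> t)) $ 1) + y * Re (snd (X (\<gamma> t)) $ 2)) has_real_derivative
      x * Re (snd w $ 1) + y * Re (snd w $ 2)) (at 0)"
    by (intro DERIV_add DERIV_cmult L)
  moreover have "((\<lambda>t. x * R.D 1 (re_part (\<gamma> t)) (re_part (cscale \<i> (X (\<gamma> t))))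
      + y * R.D 2 (re_part (\<gamma> t)) (re_part (cscale \<i> (X (\<gamma> t))))) has_real_derivative
      x * 0 + y * 0) (at 0)"
    by (intro DERIV_add DERIV_cmult RD)
  ultimately show ?thesis
    unfolding w_def [symmetric] using DERIV_unique DERIV_cong_ev [OF refl ev refl] by fastforce
qed

text \<open>A real relation between A_1 and A_2 confines complex tangent vectors and brackets to the
  set H cut out by that relation, which must then contain the whole tangent space.\<close>

lemma finite_type_independent:
  assumes "finite_type_2 M 0" shows "x = 0 \<and> y = 0"
proof -
  define H where "H = {v :: 'n ambient. x * Re (snd v $ 1) + y * Re (snd v $ 2) = 0}"
  have H: "subspace H" unfolding H_def 
  proof (rule subspaceI)
    show "r *\<^sub>R v \<in> {v :: 'n ambient. x * Re (snd v $ 1) + y * Re (snd v $ 2) = 0}"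
      if "v \<in> {v :: 'n ambient. x * Re (snd v $ 1) + y * Re (snd v $ 2) = 0}" for r v
    proof -
      have "x * (r * Re (snd v $ 1)) + y * (r * Re (snd v $ 2))
          = r * (x * Re (snd v $ 1) + y * Re (snd v $ 2))" by (simp add: algebra_simps)
      then show ?thesis using that by simp
    qed
  qed (simp_all add: algebra_simps)
  have "complex_tangent_space M 0 \<subseteq> H"
    using complex_tangent_at_0 [OF M_0] by (simp add: H_def subset_eq)
  moreover have "lie_bracket X Y 0 \<in> H"
    if X: "complex_tangent_field M 0 X" and Y: "complex_tangent_field M 0 Y" for X Y
  proof -
    have "X 0 \<in> complex_tangent_space M 0" "Y 0 \<in> complex_tangent_space M 0"
      using X Y M_0 unfolding complex_tangent_field_def by blast+
    then show ?thesis
      using field_derivative [OF X, of "Y 0"] field_derivative [OF Y, of "X 0"]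
      by (simp add: H_def lie_bracket_def algebra_simps)
  qed
  ultimately have "span (complex_tangent_space M 0 \<union>
      {lie_bracket X Y 0 | X Y. complex_tangent_field M 0 X \<and> complex_tangent_field M 0 Y}) \<subseteq> H"
    by (intro span_minimal H) auto
  then have sub: "tangent_space M 0 \<subseteq> H" using assms by (simp add: finite_type_2_def)
  \<comment> \<open>The coefficient vector of the relation as a tangent vector; it lies in H only if
    x^2 + y^2 = 0.\<close>
  define c :: "real ^ 2" where "c = (\<chi> j. if j = 1 then x else y)"
  have "(0, \<chi> j. complex_of_real (c $ j)) \<in> H" using sub tangent_space_at_0I [OF M_0] by blast
  then have "x * x + y * y = 0" by (simp add: H_def c_def)
  then show ?thesis by (simp add: sum_squares_eq_zero_iff)
qed

end

end


section \<open>Low order coefficients and partial derivatives\<close>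

text \<open>The base point may move with t, as it does when points of the quadric are corrected to
  lie on M. Uniformity in p of \<open>weighted_expansion\<close> makes this possible.\<close>

lemma tendsto_wcoef:
  assumes F: "holo_fun F U" "open U" "0 \<in> U" and 0: "\<And>k p. k < m \<Longrightarrow> wcoef F k p = 0"
    and p: "(p \<longlongrightarrow> p0) (at_right 0)"
  shows "((\<lambda>t. F (dil (of_real t) (p t)) / of_real t ^ m) \<longlongrightarrow> wcoef F m p0) (at_right (0::real))"
proof -
  define N where "N = norm p0 + 1"
  obtain C \<delta> where C: "\<delta> > 0" "C \<ge> 0"
    "\<And>p t. norm p \<le> N \<Longrightarrow> norm t \<le> \<delta> \<Longrightarrow> norm (F (dil t p) - t ^ m * wcoef F m p) \<le> C * norm t ^ (m + 1)"
    using weighted_expansion [OF F 0, where N = N and m = m] by metis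
  have "((\<lambda>t. norm (p t)) \<longlongrightarrow> norm p0) (at_right 0)" by (intro tendsto_norm p)
  then have "\<forall>\<^sub>F t in at_right 0. norm (p t) < N"
    by (rule order_tendstoD) (simp add: N_def)
  moreover have "\<forall>\<^sub>F t in at_right (0::real). 0 < t \<and> t < \<delta>"
    using C(1) unfolding eventually_at_right_field by auto
  ultimately have "\<forall>\<^sub>F t in at_right 0.
      norm (F (dil (of_real t) (p t)) / of_real t ^ m - wcoef F m (p t)) \<le> C * t"
  proof eventually_elim
    case (elim t)
    have "norm (F (dil (of_real t) (p t)) - of_real t ^ m * wcoef F m (p t)) \<le> C * t ^ (m + 1)"
      using C(3) [of "p t" "of_real t"] elim by simp
    moreover have "F (dil (of_real t) (p t)) / of_real t ^ m - wcoef F m (p t)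
        = (F (dil (of_real t) (p t)) - of_real t ^ m * wcoef F m (p t)) / of_real t ^ m"
      using elim by (simp add: diff_divide_distrib)
    ultimately show ?case using elim by (simp add: norm_divide norm_power field_simps)
  qed
  moreover have "((\<lambda>t. C * t) \<longlongrightarrow> C * 0) (at_right 0)" by (intro tendsto_intros)
  ultimately have "((\<lambda>t. F (dil (of_real t) (p t)) / of_real t ^ m - wcoef F m (p t)) \<longlongrightarrow> 0) (at_right 0)"
    by (simp add: Lim_null_comparison [where g = "\<lambda>t. C * t"])
  moreover have "((\<lambda>t. wcoef F m (p t)) \<longlongrightarrow> wcoef F m p0) (at_right 0)"
    by (rule isCont_tendsto_compose [OF isCont_wcoef [OF F 0] p])
  ultimately have "((\<lambda>t. (F (dil (of_real t) (p t)) / of_real t ^ m - wcoef F m (p t)) + wcoef F m (p t))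
      \<longlongrightarrow> 0 + wcoef F m p0) (at_right 0)"
    by (rule tendsto_add)
  then show ?thesis by simp
qed

lemma wcoef_0 [simp]: "wcoef F 0 p = F 0"
  by (simp add: wcoef_def)

text \<open>The dilation curve has velocity (z, 0) at t = 0, since w enters with t^2.\<close>

lemma wcoef_1:
  assumes "(F has_derivative L) (at 0)" "\<And>c v. L (cscale c v) = c * L v"
  shows "wcoef F 1 p = L (fst p, 0)"
proof -
  have sq: "((\<lambda>t. t\<^sup>2 *s snd p) has_derivative (\<lambda>h. 0)) (at (0::complex))"
    by (rule has_derivative_eq_rhs)
       (rule bounded_linear.has_derivative [OF bounded_linear_smult_left],
        rule has_derivative_power [OF has_derivative_ident], simp)
  have "((\<lambda>t. dil t p) has_derivative (\<lambda>h. (h *s fst p, 0))) (at 0)"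
    unfolding dil_def
    by (intro has_derivative_Pair sq bounded_linear.has_derivative [OF bounded_linear_smult_left]
        has_derivative_ident)
  then have "((\<lambda>t. F (dil t p)) has_derivative (\<lambda>h. L (h *s fst p, 0))) (at 0)"
    by (rule has_derivative_compose) (use assms(1) in simp)
  moreover have "L (h *s fst p, 0) = h * L (fst p, 0)" for h
    using assms(2) [of h "(fst p, 0)"] by (simp add: cscale_def)
  ultimately have "((\<lambda>t. F (dil t p)) has_field_derivative L (fst p, 0)) (at 0)"
    by (simp add: has_field_derivative_def mult.commute [of _ "L _"])
  then show ?thesis by (simp add: wcoef_def DERIV_imp_deriv)
qed

lemma has_field_derivative_along_w:
  assumes F: "(F has_derivative L) (at p)" "\<And>c v. L (cscale c v) = c * L v"
  shows "((\<lambda>t. F (p + (0, t *s w))) has_field_derivative L (0, w)) (at 0)"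
proof -
  have "((\<lambda>t. p + (0, t *s w)) has_derivative (\<lambda>h. 0 + (0, h *s w))) (at 0)"
    by (intro has_derivative_add has_derivative_Pair has_derivative_const
        bounded_linear.has_derivative [OF bounded_linear_smult_left] has_derivative_ident)
  then have "((\<lambda>t. F (p + (0, t *s w))) has_derivative (\<lambda>h. L (0 + (0, h *s w)))) (at 0)"
    by (rule has_derivative_compose) (use F(1) in \<open>simp flip: zero_prod_def\<close>)
  moreover have "L (0 + (0, h *s w)) = h * L (0, w)" for h
    using F(2) [of h "(0, w)"] by (simp add: cscale_def)
  ultimately show ?thesis
    by (simp add: has_field_derivative_def mult.commute [of _ "L _"])
qed

lemma filterlim_square_at_right: "filterlim (\<lambda>t::real. (complex_of_real t)\<^sup>2) (at 0) (at_right 0)"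
proof (rule filterlim_atI)
  have "((\<lambda>t::real. (complex_of_real t)\<^sup>2) \<longlongrightarrow> (of_real 0)\<^sup>2) (at_right 0)"
    by (intro tendsto_intros)
  then show "((\<lambda>t::real. (complex_of_real t)\<^sup>2) \<longlongrightarrow> 0) (at_right 0)" by simp
  show "\<forall>\<^sub>F t::real in at_right 0. (complex_of_real t)\<^sup>2 \<noteq> 0"
    unfolding eventually_at_right_field by (intro exI [of _ 1]) auto
qed

text \<open>On the axis the dilation is (0, t^2 w), so the substitution s = t^2 turns the limit into
  a first derivative.\<close>

lemma wcoef_2_axis:
  assumes F: "holo_fun F U" "open U" "0 \<in> U" and 0: "\<And>k p. k < 2 \<Longrightarrow> wcoef F k p = 0"
    and L: "(F has_derivative L) (at 0)" "\<And>c v. L (cscale c v) = c * L v"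
  shows "wcoef F 2 (0, w) = L (0, w)"
proof -
  have 1: "((\<lambda>t::real. F (dil (of_real t) (0, w)) / of_real t ^ 2) \<longlongrightarrow> wcoef F 2 (0, w)) (at_right 0)"
    by (rule tendsto_wcoef [OF F 0 tendsto_const])
  have "F 0 = 0" using 0 [of 0 0] by simp
  then have "((\<lambda>s. F (0, s *s w) / s) \<longlongrightarrow> L (0, w)) (at 0)"
    using DERIV_D [OF has_field_derivative_along_w [OF L, of w]] by (simp flip: zero_prod_def)
  then have "((\<lambda>t::real. F (0, (of_real t)\<^sup>2 *s w) / (of_real t)\<^sup>2) \<longlongrightarrow> L (0, w)) (at_right 0)"
    by (rule filterlim_compose [OF _ filterlim_square_at_right])
  then have 2: "((\<lambda>t::real. F (dil (of_real t) (0, w)) / of_real t ^ 2) \<longlongrightarrow> L (0, w)) (at_right 0)"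
    by simp
  show ?thesis by (rule tendsto_unique [OF trivial_limit_at_right_real 1 2])
qed

lemma axis_smult: "axis l t = t *s axis l (1::complex)"
  by (simp add: axis_def vec_eq_iff)

lemma cpartial_w_eq:
  assumes "(F has_derivative L) (at p)" "\<And>c v. L (cscale c v) = c * L v"
  shows "cpartial_w l F p = L (0, axis l 1)"
  unfolding cpartial_w_def using DERIV_imp_deriv [OF has_field_derivative_along_w [OF assms]]
  by (subst axis_smult) simp

lemma cpartial_z_eq:
  fixes F :: "('n::finite) ambient \<Rightarrow> complex"
  assumes F: "(F has_derivative L) (at p)" "\<And>c v. L (cscale c v) = c * L v"
  shows "cpartial_z l F p = L (axis l 1, 0)"
proof -
  let ?a = "axis l 1 :: complex ^ 'n"
  have "((\<lambda>t. p + (t *s ?a, 0)) has_derivative (\<lambda>h. 0 + (h *s ?a, 0))) (at 0)"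
    by (intro has_derivative_add has_derivative_Pair has_derivative_const
        bounded_linear.has_derivative [OF bounded_linear_smult_left] has_derivative_ident)
  then have "((\<lambda>t. F (p + (t *s ?a, 0))) has_derivative (\<lambda>h. L (0 + (h *s ?a, 0)))) (at 0)"
    by (rule has_derivative_compose) (use F(1) in \<open>simp flip: zero_prod_def\<close>)
  moreover have "L (0 + (h *s ?a, 0)) = h * L (?a, 0)" for h
    using F(2) [of h "(?a, 0)"] by (simp add: cscale_def)
  ultimately have "((\<lambda>t. F (p + (t *s ?a, 0))) has_field_derivative L (?a, 0)) (at 0)"
    by (simp add: has_field_derivative_def mult.commute [of _ "L _"])
  then show ?thesis
    unfolding cpartial_z_def by (subst axis_smult) (rule DERIV_imp_deriv)
qed

text \<open>Second normal derivatives are iterated values of \<open>deriv\<close>, which carry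
  information only if the inner derivative is itself differentiable. It is, as a uniform limit of
  holomorphic difference quotients.\<close>

lemma holomorphic_cpartial_w:
  fixes F :: "('n::finite) ambient \<Rightarrow> complex"
  assumes F: "holo_fun F U" "open U" "0 \<in> U"
  shows "\<exists>r>0. (\<lambda>x. cpartial_w l F (0, x *s v)) holomorphic_on ball 0 r"
proof -
  obtain e where e: "e > 0" "cball 0 e \<subseteq> U" using F(2,3) open_contains_cball by blast
  have "compact (F ` cball 0 e)"
    by (intro compact_continuous_image continuous_on_subset [OF holo_fun_imp_continuous_on [OF F(1)] e(2)])
       auto
  then obtain B where B: "\<And>p. p \<in> cball 0 e \<Longrightarrow> norm (F p) \<le> B"
    using compact_imp_bounded bounded_iff by (metis image_eqI)
  \<comment> \<open>Base point and increment each use half of the radius: |x v| \<le> e / 2, and |t|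
    < 2 \<delta> = e / 2.\<close>
  define r where "r = e / (2 * (norm v + 1))"
  define \<delta> where "\<delta> = e / 4"
  have r: "r > 0" "\<delta> > 0" using e(1) by (auto simp: r_def \<delta>_def intro!: divide_pos_pos add_nonneg_pos mult_pos_pos)
  let ?a = "axis l 1 :: complex ^ 2"
  have inB: "(0 :: complex ^ 'n, x *s v + t *s ?a) \<in> cball 0 e" if "x \<in> ball 0 r" "t \<in> ball 0 (2 * \<delta>)" for x t
  proof -
    have "norm (x *s v) \<le> r * (norm v + 1)"
      using that r(1) by (auto simp: norm_vector_smult intro!: mult_mono)
    also have "\<dots> = e / 2"
      unfolding r_def using norm_ge_zero [of v] by (simp add: field_simps add_nonneg_eq_0_iff)
    finally have "norm (x *s v) \<le> e / 2" .
    moreover have "norm (t *s ?a) \<le> e / 2"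
      using that by (simp add: norm_vector_smult \<delta>_def)
    ultimately have "norm (x *s v + t *s ?a) \<le> e"
      using norm_triangle_ineq [of "x *s v" "t *s ?a"] by linarith
    then show ?thesis unfolding mem_cball_0 by (simp add: norm_Pair)
  qed
  then have inU: "(0, x *s v + t *s ?a) \<in> U" if "x \<in> ball 0 r" "t \<in> ball 0 (2 * \<delta>)" for x t
    using that e(2) by blast
  have hol: "(\<lambda>x. F (0, b + x *s w)) holomorphic_on S"
    if "open S" "\<And>x. x \<in> S \<Longrightarrow> (0, b + x *s w) \<in> U" for S b w
    using holo_fun_along_curve [OF F(1) that(1), of 0 0 b w 0] that(2) by simp
  \<comment> \<open>Subtracting the value at t = 0 removes the order-0 coefficient, so
    \<open>taylor_remainder\<close> applies with m = 1.\<close>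
  define G where "G x t = F (0, x *s v + t *s ?a) - F (0, x *s v)" for x t
  have est: "norm (G x t - t * cpartial_w l F (0, x *s v)) \<le> 2 * (2 * B) / \<delta> ^ 2 * norm t ^ 2"
    if x: "x \<in> ball 0 r" and t: "norm t \<le> \<delta> / 2" for x t
  proof -
    have x0: "(0 :: complex ^ 'n, x *s v) \<in> cball 0 e" using inB [OF x, of 0] r by simp
    have "norm (G x t - t ^ 1 * ((deriv ^^ 1) (G x) 0 / fact 1)) \<le> 2 * (2 * B) / \<delta> ^ (1 + 1) * norm t ^ (1 + 1)"
    proof (rule taylor_remainder [OF _ r(2) _ _ t])
      show "G x holomorphic_on ball 0 (2 * \<delta>)"
        unfolding G_def by (intro holomorphic_intros hol inU x) auto
      show "norm (G x t) \<le> 2 * B" if "t \<in> ball 0 (2 * \<delta>)" for t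
        using B [OF inB [OF x that]] B [OF x0] norm_triangle_ineq4 [of "F (0, x *s v + t *s ?a)" "F (0, x *s v)"]
        unfolding G_def by linarith
      show "(deriv ^^ k) (G x) 0 = 0" if "k < 1" for k using that by (simp add: G_def)
    qed
    moreover have "deriv (G x) 0 = cpartial_w l F (0, x *s v)"
    proof -
      have "(0, x *s v) \<in> U" using x0 e(2) by blast
      then obtain L where L: "(F has_derivative L) (at (0, x *s v))" "\<And>c v. L (cscale c v) = c * L v"
        using F(1) unfolding holo_fun_def by blast
      have "(G x has_field_derivative L (0, ?a) - 0) (at 0)"
        unfolding G_def using has_field_derivative_along_w [OF L, of ?a]
        by (intro DERIV_diff DERIV_const) simp
      then show ?thesis by (simp add: DERIV_imp_deriv cpartial_w_eq [OF L])
    qed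
    ultimately show ?thesis by (simp add: eval_nat_numeral)
  qed
  have "B \<ge> 0" using B [of 0] e(1) by (metis centre_in_cball less_imp_le norm_ge_zero order_trans)
  define \<tau> where "\<tau> n = complex_of_real (\<delta> / 2 / real (Suc n))" for n
  have norm: "norm (\<tau> n) = \<delta> / 2 / real (Suc n)" for n
    using r(2) by (simp add: \<tau>_def norm_divide del: of_nat_Suc)
  have \<tau>: "\<tau> n \<noteq> 0" "norm (\<tau> n) \<le> \<delta> / 2" for n
  proof -
    show "\<tau> n \<noteq> 0" using r(2) by (simp add: \<tau>_def del: of_nat_Suc)
    have "\<delta> / 2 / real (Suc n) \<le> \<delta> / 2 / 1" using r(2) by (intro divide_left_mono) auto
    then show "norm (\<tau> n) \<le> \<delta> / 2" by (simp only: norm div_by_1)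
  qed
  have unif: "uniform_limit (ball 0 r) (\<lambda>n x. G x (\<tau> n) / \<tau> n) (\<lambda>x. cpartial_w l F (0, x *s v)) sequentially"
  proof (rule uniform_limitI)
    fix d :: real assume "d > 0"
    have "(\<lambda>n. 2 * (2 * B) / \<delta> ^ 2 * (\<delta> / 2) * (1 / real (Suc n))) \<longlonglongrightarrow> 2 * (2 * B) / \<delta> ^ 2 * (\<delta> / 2) * 0"
      by (intro tendsto_mult tendsto_const LIMSEQ_Suc [OF lim_1_over_n])
    then have "\<forall>\<^sub>F n in sequentially. 2 * (2 * B) / \<delta> ^ 2 * (\<delta> / 2) * (1 / real (Suc n)) < d"
      using \<open>d > 0\<close> order_tendstoD(2) by fastforce
    then show "\<forall>\<^sub>F n in sequentially. \<forall>x\<in>ball 0 r. dist (G x (\<tau> n) / \<tau> n) (cpartial_w l F (0, x *s v)) < d"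
    proof eventually_elim
      case (elim n)
      show ?case
      proof
        fix x assume "x \<in> ball (0::complex) r"
        from est [OF this \<tau>(2)]
        have "norm (G x (\<tau> n) - \<tau> n * cpartial_w l F (0, x *s v)) \<le> 2 * (2 * B) / \<delta> ^ 2 * norm (\<tau> n) * norm (\<tau> n)"
          by (simp add: power2_eq_square mult_ac)
        moreover have "G x (\<tau> n) / \<tau> n - cpartial_w l F (0, x *s v)
            = (G x (\<tau> n) - \<tau> n * cpartial_w l F (0, x *s v)) / \<tau> n"
          using \<tau> by (simp add: diff_divide_distrib)
        ultimately have "norm (G x (\<tau> n) / \<tau> n - cpartial_w l F (0, x *s v)) \<le> 2 * (2 * B) / \<delta> ^ 2 * norm (\<tau> n)"
          using \<tau>(1) [of n] by (simp add: norm_divide pos_divide_le_eq)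
        also have "\<dots> = 2 * (2 * B) / \<delta> ^ 2 * (\<delta> / 2) * (1 / real (Suc n))" 
          by (simp only: norm times_divide_eq_right mult_1_right)
        finally show "dist (G x (\<tau> n) / \<tau> n) (cpartial_w l F (0, x *s v)) < d"
          using elim by (simp only: dist_norm)
      qed
    qed
  qed
  have "(\<lambda>x. cpartial_w l F (0, x *s v)) holomorphic_on ball 0 r"
  proof (rule holomorphic_uniform_sequence [where f = "\<lambda>n x. G x (\<tau> n) / \<tau> n"])
    fix n
    have t: "\<tau> n \<in> ball 0 (2 * \<delta>)" using \<tau>(2) [of n] r(2) by simp
    have "(\<lambda>x. F (0, 0 + x *s v)) holomorphic_on ball 0 r"
      by (rule hol) (use inU [of _ 0] r in auto)
    moreover have "(\<lambda>x. F (0, \<tau> n *s ?a + x *s v)) holomorphic_on ball 0 r"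
      by (rule hol) (use inU [OF _ t] in \<open>auto simp: add.commute\<close>)
    ultimately show "(\<lambda>x. G x (\<tau> n) / \<tau> n) holomorphic_on ball 0 r"
      unfolding G_def using \<tau>(1) by (intro holomorphic_intros) (simp_all add: add.commute)
  next
    fix x :: complex assume "x \<in> ball 0 r"
    then obtain d where "d > 0" "cball x d \<subseteq> ball 0 r"
      using open_contains_cball open_ball by blast
    then show "\<exists>d>0. cball x d \<subseteq> ball 0 r \<and> uniform_limit (cball x d)
        (\<lambda>n x. G x (\<tau> n) / \<tau> n) (\<lambda>x. cpartial_w l F (0, x *s v)) sequentially"
      using uniform_limit_on_subset [OF unif] by blast
  qed auto
  then show ?thesis using r(1) by blast
qed


text \<open>The mixed coefficients of the quadratic form \<open>P\<close> are second derivatives: a Cauchy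
  estimate for \<open>F - P\<close> on circles of radius \<open>t\<^sup>2\<close> transfers the weighted expansion to
  the first order partial derivatives.\<close>

lemma wcoef_4_axis_eq_0:
  fixes F :: "('n::finite) ambient \<Rightarrow> complex"
  assumes F: "holo_fun F U" "open U" "0 \<in> U" and 0: "\<And>k p. k < 4 \<Longrightarrow> wcoef F k p = 0"
    and second: "\<And>k l. cpartial_w k (cpartial_w l F) 0 = 0"
  shows "wcoef F 4 (0, w) = 0"
proof -
  define P where "P w = wcoef F 4 (0, w)" for w
  have P_hom: "P (c *s w) = c\<^sup>2 * P w" for c w
  proof -
    have "wcoef F 4 (dil (csqrt c) (0, w)) = csqrt c ^ 4 * wcoef F 4 (0, w)"
      by (rule wcoef_dil [OF F 0])
    moreover have "csqrt c ^ 4 = ((csqrt c)\<^sup>2)\<^sup>2" by (simp only: power_mult [symmetric]) simp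
    ultimately show ?thesis by (simp add: P_def)
  qed
  have P_line: "(\<lambda>x. P (a + x *s b)) holomorphic_on S" for a b S
    using curve_entireD [OF curve_entire_wcoef [OF F 0], where a = 0 and b = 0 and ?w0.0 = a and ?w1.0 = b and ?w2.0 = 0] by (simp add: P_def)
  have DP: "deriv (\<lambda>y. P (axis k 1 + y *s axis l 1)) 0 = 0" for k l
  proof -
    let ?v = "axis k 1 :: complex ^ 2" and ?a = "axis l 1 :: complex ^ 2"
    obtain C \<delta> where C: "\<delta> > 0" "C \<ge> 0"
      "\<And>p t. norm p \<le> 3 \<Longrightarrow> norm t \<le> \<delta> \<Longrightarrow> dil t p \<in> U"
      "\<And>p t. norm p \<le> 3 \<Longrightarrow> norm t \<le> \<delta> \<Longrightarrow> norm (F (dil t p) - t ^ 4 * wcoef F 4 p) \<le> C * norm t ^ (4 + 1)"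
      using weighted_expansion [OF F 0, where N = 3 and m = 4] by metis
    have n3: "norm (0 :: complex ^ 'n, ?v + y *s ?a) \<le> 3" if "norm y \<le> 2" for y
      using norm_triangle_ineq [of ?v "y *s ?a"] that by (simp add: norm_Pair norm_vector_smult)
    define DP where "DP = deriv (\<lambda>y. P (?v + y *s ?a)) 0"
    have est: "norm (cpartial_w l F (0, (of_real t)\<^sup>2 *s ?v) / (of_real t)\<^sup>2 - DP) \<le> C * t"
      if t: "0 < t" "t < \<delta>" for t :: real
    proof -
      let ?t = "complex_of_real t"
      \<comment> \<open>The unit circle in y corresponds to a circle of radius t^2 in w; on it the
        remainder is O(t^5), and division by t^4 leaves O(t).\<close>
      define H where "H y = F (dil ?t (0, ?v + y *s ?a)) - ?t ^ 4 * P (?v + y *s ?a)" for y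
      have inU: "(0, ?t\<^sup>2 *s ?v + y *s (?t\<^sup>2 *s ?a)) \<in> U" if "norm y \<le> 2" for y
        using C(3) [OF n3 [OF that], of ?t] t by (simp add: algebra_simps)
      have eq: "F (dil ?t (0, ?v + y *s ?a)) = F (0, ?t\<^sup>2 *s ?v + y *s (?t\<^sup>2 *s ?a))" for y
        by (simp add: algebra_simps)
      have holF: "(\<lambda>y. F (0, ?t\<^sup>2 *s ?v + y *s (?t\<^sup>2 *s ?a))) holomorphic_on ball 0 2"
        using holo_fun_along_curve [OF F(1), of "ball 0 2" 0 0 "?t\<^sup>2 *s ?v" "?t\<^sup>2 *s ?a" 0] inU
        by simp
      have holH: "H holomorphic_on ball 0 2"
        unfolding H_def eq by (intro holomorphic_intros holF P_line)
      have bound: "norm (H y) \<le> C * t ^ 5" if "norm y = 1" for y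
        using C(4) [OF n3, of y ?t] that t by (simp add: H_def P_def)
      have "norm ((deriv ^^ 1) H 0) \<le> fact 1 * (C * t ^ 5) / 1 ^ 1"
      proof (rule Cauchy_inequality)
        show "H holomorphic_on ball 0 1" using holH 
          by (rule holomorphic_on_subset) (simp add: ball_subset_ball_iff)
        show "continuous_on (cball 0 1) H"
          using holomorphic_on_imp_continuous_on [OF holH] by (rule continuous_on_subset) auto
      qed (use bound in auto)
      moreover have "deriv H 0 = ?t\<^sup>2 * cpartial_w l F (0, ?t\<^sup>2 *s ?v) - ?t ^ 4 * DP"
      proof -
        have "(0, ?t\<^sup>2 *s ?v) \<in> U" using inU [of 0] by simp
        then obtain L where L: "(F has_derivative L) (at (0, ?t\<^sup>2 *s ?v))"
          "\<And>c v. L (cscale c v) = c * L v"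
          using F(1) unfolding holo_fun_def by blast
        have "((\<lambda>y. F (0, ?t\<^sup>2 *s ?v + y *s (?t\<^sup>2 *s ?a))) has_field_derivative L (0, ?t\<^sup>2 *s ?a)) (at 0)"
          using has_field_derivative_along_w [OF L, of "?t\<^sup>2 *s ?a"] by simp
        moreover have "L (0, ?t\<^sup>2 *s ?a) = ?t\<^sup>2 * cpartial_w l F (0, ?t\<^sup>2 *s ?v)"
          using L(2) [of "?t\<^sup>2" "(0, ?a)"] cpartial_w_eq [OF L, of l] by (simp add: cscale_def)
        moreover have "((\<lambda>y. P (?v + y *s ?a)) has_field_derivative DP) (at 0)"
          unfolding DP_def using P_line [of ?v ?a UNIV] holomorphic_derivI by blast
        ultimately have "(H has_field_derivative
            ?t\<^sup>2 * cpartial_w l F (0, ?t\<^sup>2 *s ?v) - ?t ^ 4 * DP) (at 0)"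
          unfolding H_def eq by (intro DERIV_diff DERIV_cmult) simp_all
        then show ?thesis by (rule DERIV_imp_deriv)
      qed
      ultimately have "norm (?t\<^sup>2 * cpartial_w l F (0, ?t\<^sup>2 *s ?v) - ?t ^ 4 * DP) \<le> C * t ^ 5" by simp
      moreover have "?t\<^sup>2 * cpartial_w l F (0, ?t\<^sup>2 *s ?v) - ?t ^ 4 * DP
          = ?t ^ 4 * (cpartial_w l F (0, ?t\<^sup>2 *s ?v) / ?t\<^sup>2 - DP)"
        using t by (simp add: field_simps eval_nat_numeral)
      ultimately have "t ^ 4 * norm (cpartial_w l F (0, ?t\<^sup>2 *s ?v) / ?t\<^sup>2 - DP) \<le> t ^ 4 * (C * t)"
        using t by (simp add: norm_mult norm_power eval_nat_numeral mult_ac)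
      then show ?thesis using t by simp
    qed
    have 1: "((\<lambda>t::real. cpartial_w l F (0, (of_real t)\<^sup>2 *s ?v) / (of_real t)\<^sup>2 - DP) \<longlongrightarrow> 0) (at_right 0)"
    proof (rule Lim_null_comparison)
      show "\<forall>\<^sub>F t in at_right 0.
          norm (cpartial_w l F (0, (complex_of_real t)\<^sup>2 *s ?v) / (of_real t)\<^sup>2 - DP) \<le> C * t"
        unfolding eventually_at_right_field using est C(1) by blast
      have "((\<lambda>t. C * t) \<longlongrightarrow> C * 0) (at_right 0)" by (intro tendsto_intros)
      then show "((\<lambda>t. C * t) \<longlongrightarrow> 0) (at_right 0)" by simp
    qed
    obtain r where r: "r > 0" "(\<lambda>x. cpartial_w l F (0, x *s ?v)) holomorphic_on ball 0 r"
      using holomorphic_cpartial_w [OF F] by blast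
    have "((\<lambda>x. cpartial_w l F (0, x *s ?v)) has_field_derivative
        deriv (\<lambda>x. cpartial_w l F (0, x *s ?v)) 0) (at 0)"
      using holomorphic_derivI [OF r(2)] r(1) by simp
    moreover have "deriv (\<lambda>x. cpartial_w l F (0, x *s ?v)) 0 = 0"
      using second [of k l] unfolding cpartial_w_def [of k]
      by (subst (asm) axis_smult) simp
    \<comment> \<open>The w-derivative at 0 is the weight 2 term on the axis, zero by assumption, so
      the difference quotient of the partial derivative is its value divided by x.\<close>
    moreover have "cpartial_w l F 0 = 0"
    proof -
      obtain L where L: "(F has_derivative L) (at 0)" "\<And>c v. L (cscale c v) = c * L v"
        using F(1,3) unfolding holo_fun_def by blast
      have "wcoef F 2 (0, ?a) = L (0, ?a)" by (rule wcoef_2_axis [OF F _ L]) (simp add: 0)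
      then show ?thesis using 0 [of 2] by (simp add: cpartial_w_eq [OF L])
    qed
    ultimately have "((\<lambda>x. cpartial_w l F (0, x *s ?v) / x) \<longlongrightarrow> 0) (at 0)"
      using DERIV_D by (fastforce simp flip: zero_prod_def)
    then have 2: "((\<lambda>t::real. cpartial_w l F (0, (of_real t)\<^sup>2 *s ?v) / (of_real t)\<^sup>2) \<longlongrightarrow> 0) (at_right 0)"
      by (rule filterlim_compose [OF _ filterlim_square_at_right])
    have "((\<lambda>t::real. DP) \<longlongrightarrow> 0 - 0) (at_right 0)"
      using tendsto_diff [OF 2 1] by simp
    then have "DP = 0" using tendsto_unique [OF trivial_limit_at_right_real tendsto_const] by fastforce
    then show ?thesis by (simp add: DP_def)
  qed
  have P_axis: "P (axis k 1) = 0" for k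
  proof -
    have "axis k 1 + y *s axis k 1 = (1 + y) *s axis k (1::complex)" for y
      by (simp add: vec_eq_iff algebra_simps)
    then have eq: "P (axis k 1 + y *s axis k 1) = (1 + y)\<^sup>2 * P (axis k 1)" for y
      by (simp only: P_hom)
    have "((\<lambda>y. (1 + y)\<^sup>2 * P (axis k 1)) has_field_derivative 2 * P (axis k 1)) (at 0)"
      by (auto intro!: derivative_eq_intros)
    then show ?thesis using DP [of k k] DERIV_imp_deriv unfolding eq by fastforce
  qed
  \<comment> \<open>Homogeneity gives \<phi>(s) = s^2 P(e_2 + e_1 / s), the shape required by
    \<open>quadratic_growth\<close> with C = 0. The coefficients of \<phi> are then P(e_1), the
    mixed derivative and P(e_2).\<close>
  define \<phi> where "\<phi> y = P (axis 1 1 + y *s axis 2 1)" for y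
  define \<psi> where "\<psi> y = - cnj (P (axis 2 1 + cnj y *s axis 1 1))" for y
  have hol: "\<phi> holomorphic_on UNIV" unfolding \<phi>_def by (rule P_line)
  have "(\<lambda>y. cnj (P (axis 2 1 + cnj y *s axis 1 1))) holomorphic_on UNIV"
    using holomorphic_on_compose_cnj_cnj [OF P_line [of "axis 2 1" "axis 1 1" "cnj ` UNIV"]]
    by (simp add: o_def)
  then have hol': "\<psi> holomorphic_on UNIV" unfolding \<psi>_def by (intro holomorphic_intros)
  have eq: "\<phi> s = s * 0 - s\<^sup>2 * cnj (\<psi> (1 / cnj s))" if "s \<noteq> 0" for s
  proof -
    have e: "axis 1 1 + s *s axis 2 1 = s *s (axis 2 1 + (1 / s) *s axis 1 (1::complex))"
      using that by (simp add: vec_eq_iff algebra_simps)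
    show ?thesis unfolding \<phi>_def \<psi>_def e P_hom by simp
  qed
  obtain a b c where abc: "\<And>s. \<phi> s = a + b * s + c * s\<^sup>2" "c = - cnj (\<psi> 0)"
    using quadratic_growth [OF hol' hol eq] by blast
  have "a = 0" using abc(1) [of 0] P_axis by (simp add: \<phi>_def)
  have "(\<phi> has_field_derivative b) (at 0)"
    unfolding abc(1) [abs_def] by (auto intro!: derivative_eq_intros)
  then have "b = 0" using DP [of 1 2] DERIV_imp_deriv by (fastforce simp: \<phi>_def [abs_def])
  have "c = 0" using abc(2) P_axis by (simp add: \<psi>_def)
  have \<phi>0: "\<phi> y = 0" for y using abc(1) [of y] \<open>a = 0\<close> \<open>b = 0\<close> \<open>c = 0\<close> by simp
  have "P w = 0"
  proof (cases "w $ 1 = 0")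
    case True
    then have "w = (w $ 2) *s axis 2 1" by (simp add: vec_eq_iff forall_2 axis_def)
    then show ?thesis using P_hom P_axis by (metis mult_zero_right)
  next
    case False
    then have "w = (w $ 1) *s (axis 1 1 + (w $ 2 / w $ 1) *s axis 2 1)"
      by (simp add: vec_eq_iff forall_2 axis_def)
    then have "P w = (w $ 1)\<^sup>2 * \<phi> (w $ 2 / w $ 1)" unfolding \<phi>_def using P_hom by metis
    then show ?thesis by (simp add: \<phi>0)
  qed
  then show ?thesis by (simp add: P_def)
qed


section \<open>The tangency equation\<close>

lemma tendsto_cdot:
  "(f \<longlongrightarrow> a) F \<Longrightarrow> (g \<longlongrightarrow> b) F \<Longrightarrow> ((\<lambda>t. cdot (f t) (g t)) \<longlongrightarrow> cdot a b) F"
  by (rule bounded_bilinear.tendsto [OF bounded_bilinear_cdot])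

lemma tendsto_matrix_vector:
  "(f \<longlongrightarrow> a) F \<Longrightarrow> ((\<lambda>t. B *v f t) \<longlongrightarrow> B *v a) F" for B :: "complex ^ 'n::finite ^ 'm::finite"
  by (rule bounded_linear.tendsto [OF bounded_linear_matrix_vector])

lemma eventually_norm_le_of_tendsto:
  fixes f :: "real \<Rightarrow> complex"
  assumes "((\<lambda>t. f t / of_real t ^ m) \<longlongrightarrow> a) (at_right 0)"
  shows "\<forall>\<^sub>F t in at_right 0. norm (f t) \<le> (norm a + 1) * t ^ m"
proof -
  have "\<forall>\<^sub>F t in at_right 0. norm (f t / of_real t ^ m) < norm a + 1"
    by (rule order_tendstoD(2) [OF tendsto_norm [OF assms]]) simp
  moreover have "\<forall>\<^sub>F t in at_right (0::real). 0 < t"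
    unfolding eventually_at_right_field by (intro exI [of _ 1]) auto
  ultimately show ?thesis
    by eventually_elim (simp add: norm_divide norm_power pos_divide_less_eq less_imp_le)
qed

lemma eventually_norm_vec_le:
  fixes f :: "real \<Rightarrow> complex ^ 'm::finite"
  assumes "\<And>i. ((\<lambda>t. f t $ i / of_real t ^ m) \<longlongrightarrow> a i) (at_right 0)"
  obtains C where "C > 0" "\<forall>\<^sub>F t in at_right 0. norm (f t) \<le> C * t ^ m"
proof
  have "\<forall>\<^sub>F t in at_right 0. \<forall>i. norm (f t $ i) \<le> (norm (a i) + 1) * t ^ m"
    by (intro eventually_all_finite eventually_norm_le_of_tendsto assms)
  then show "\<forall>\<^sub>F t in at_right 0. norm (f t) \<le> (\<Sum>i\<in>UNIV. norm (a i) + 1) * t ^ m"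
  proof eventually_elim
    case (elim t)
    have "norm (f t) \<le> (\<Sum>i\<in>UNIV. norm (f t $ i))" by (simp add: norm_vec_def L2_set_le_sum)
    also have "\<dots> \<le> (\<Sum>i\<in>UNIV. (norm (a i) + 1) * t ^ m)" by (intro sum_mono) (use elim in auto)
    finally show ?case by (simp add: sum_distrib_right)
  qed
  show "(\<Sum>i\<in>UNIV. norm (a i) + 1) > 0" by (intro sum_pos) (auto intro: add_nonneg_pos)
qed

context standard_manifold
begin

definition quadric_point :: "complex ^ 'n \<Rightarrow> real ^ 2 \<Rightarrow> 'n ambient" where
  "quadric_point z u = (z, \<chi> l. Complex (u $ l) (Re (cdot z (A l *v z))))"

text \<open>The quadric point, corrected by the remainder so that its dilation by \<open>t\<close> lies on \<open>M\<close>.\<close>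

definition lifted_point :: "complex ^ 'n \<Rightarrow> real ^ 2 \<Rightarrow> real \<Rightarrow> 'n ambient" where
  "lifted_point z u t =
     (z, \<chi> l. Complex (u $ l) (Re (cdot z (A l *v z)) + R l (t *\<^sub>R z, t\<^sup>2 *\<^sub>R u) / t\<^sup>2))"

lemma eventually_pos: "\<forall>\<^sub>F t in at_right (0::real). 0 < t \<and> t < 1"
  unfolding eventually_at_right_field by (intro exI [of _ 1]) auto

text \<open>\<open>difference_estimate\<close> against the origin: the remainder is o(t^2) on points
  of weighted size t.\<close>

lemma tendsto_R: "((\<lambda>t. R l (t *\<^sub>R z, t\<^sup>2 *\<^sub>R u) / t\<^sup>2) \<longlongrightarrow> 0) (at_right 0)"
proof (rule tendstoI)
  fix e :: real assume e: "e > 0"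
  define C where "C = norm z + norm u + 1"
  have C: "C > 0" by (simp add: C_def add_nonneg_pos)
  have "\<forall>\<^sub>F t in at_right 0. \<forall>a b. norm (fst a) \<le> C * t \<longrightarrow> norm (snd a) \<le> C * t\<^sup>2 \<longrightarrow>
     norm (fst b) \<le> C * t \<longrightarrow> norm (snd b) \<le> C * t\<^sup>2 \<longrightarrow>
     \<bar>R l b - R l a\<bar> \<le> e / (2 * C) * (t * norm (fst b - fst a) + norm (snd b - snd a))"
    by (rule R.difference_estimate) (use e C in auto)
  then show "\<forall>\<^sub>F t in at_right 0. dist (R l (t *\<^sub>R z, t\<^sup>2 *\<^sub>R u) / t\<^sup>2) 0 < e"
    using eventually_pos
  proof eventually_elim
    case (elim t)
    have "norm (t *\<^sub>R z) \<le> C * t" "norm (t\<^sup>2 *\<^sub>R u) \<le> C * t\<^sup>2"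
      using elim(2) by (auto simp: C_def mult.commute intro!: mult_right_mono)
    then have "\<bar>R l (t *\<^sub>R z, t\<^sup>2 *\<^sub>R u) - R l 0\<bar>
        \<le> e / (2 * C) * (t * norm (t *\<^sub>R z) + norm (t\<^sup>2 *\<^sub>R u))"
      using elim(1) [rule_format, of 0 "(t *\<^sub>R z, t\<^sup>2 *\<^sub>R u)"] C elim(2) by simp
    also have "\<dots> = e / (2 * C) * (norm z + norm u) * t\<^sup>2"
      using elim(2) by (simp add: power2_eq_square algebra_simps add_divide_distrib)
    also have "\<dots> \<le> e / (2 * C) * C * t\<^sup>2"
      using e C by (intro mult_right_mono mult_left_mono) (auto simp: C_def)
    also have "\<dots> = e / 2 * t\<^sup>2" using C by simp
    also have "\<dots> < e * t\<^sup>2" using e elim(2) by simp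
    finally have "\<bar>R l (t *\<^sub>R z, t\<^sup>2 *\<^sub>R u)\<bar> < e * t\<^sup>2" by (simp add: R.r_0)
    then show ?case using elim(2) by (simp add: dist_norm abs_divide pos_divide_less_eq)
  qed
qed

lemma tendsto_lifted_point: "(lifted_point z u \<longlongrightarrow> quadric_point z u) (at_right 0)"
proof -
  have "((\<lambda>t. Complex (u $ l) (Re (cdot z (A l *v z)) + R l (t *\<^sub>R z, t\<^sup>2 *\<^sub>R u) / t\<^sup>2))
      \<longlongrightarrow> Complex (u $ l) (Re (cdot z (A l *v z)) + 0)) (at_right 0)" for l
    by (intro tendsto_Complex tendsto_intros tendsto_R)
  then show ?thesis
    unfolding lifted_point_def [abs_def] quadric_point_def
    by (intro tendsto_Pair tendsto_const tendsto_vec_lambda) simp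
qed

lemma tendsto_dil_lifted_point: "((\<lambda>t. dil (of_real t) (lifted_point z u t)) \<longlongrightarrow> 0) (at_right 0)"
proof -
  have "\<forall>\<^sub>F t in at_right 0. norm (lifted_point z u t) < norm (quadric_point z u) + 1"
    by (rule order_tendstoD(2) [OF tendsto_norm [OF tendsto_lifted_point]]) simp
  then have "\<forall>\<^sub>F t in at_right 0. norm (dil (of_real t) (lifted_point z u t))
      \<le> 2 * t * (norm (quadric_point z u) + 1)"
    using eventually_pos
  proof eventually_elim
    case (elim t)
    have "norm (dil (of_real t) (lifted_point z u t)) \<le> 2 * t * norm (lifted_point z u t)"
      using norm_dil_le [of "of_real t" "lifted_point z u t"] elim by simp
    also have "\<dots> \<le> 2 * t * (norm (quadric_point z u) + 1)"
      using elim by (intro mult_left_mono) auto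
    finally show ?case .
  qed
  moreover have "((\<lambda>t. 2 * t * (norm (quadric_point z u) + 1)) \<longlongrightarrow> 2 * 0 * (norm (quadric_point z u) + 1))
      (at_right 0)"
    by (intro tendsto_intros)
  ultimately show ?thesis using Lim_null_comparison by simp
qed

lemma eventually_dil_lifted_point:
  assumes "open W" "0 \<in> W"
  shows "\<forall>\<^sub>F t in at_right 0. dil (of_real t) (lifted_point z u t) \<in> W \<inter> M"
proof -
  have "\<forall>\<^sub>F t in at_right 0. dil (of_real t) (lifted_point z u t) \<in> W \<inter> U"
    by (rule topological_tendstoD [OF tendsto_dil_lifted_point]) (use assms U in auto)
  then show ?thesis
    using eventually_pos
  proof eventually_elim
    case (elim t)
    let ?t = "complex_of_real t"
    have re: "re_part (dil ?t (lifted_point z u t)) = (t *\<^sub>R z, t\<^sup>2 *\<^sub>R u)"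
      unfolding re_part_def dil_def lifted_point_def
      by (simp add: vec_eq_iff power2_eq_square) (simp add: scaleR_conv_of_real)
    have Q: "Re (cdot (?t *s z) (A j *v (?t *s z))) = t\<^sup>2 * Re (cdot z (A j *v z))" for j
      by (simp add: matrix_linear cdot_linear power2_eq_square flip: of_real_mult mult.assoc)
    have "Im (snd (dil ?t (lifted_point z u t)) $ j) =
        t\<^sup>2 * (Re (cdot z (A j *v z)) + R j (t *\<^sub>R z, t\<^sup>2 *\<^sub>R u) / t\<^sup>2)" for j
      by (simp add: dil_def lifted_point_def flip: of_real_power)
    then have "dil ?t (lifted_point z u t) \<in> M"
      using elim mem_M [of "dil ?t (lifted_point z u t)"] Q
      by (simp add: re distrib_left) (simp add: dil_def lifted_point_def)
    then show ?case using elim by blast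
  qed
qed

lemma quadric_pointI:
  assumes "\<And>l. complex_of_real (Im (w $ l)) = cdot z (A l *v z)"
  shows "(z, w) = quadric_point z (\<chi> l. Re (w $ l))"
proof -
  have "Re (cdot z (A l *v z)) = Im (w $ l)" for l by (simp flip: assms)
  then show ?thesis by (simp add: quadric_point_def vec_eq_iff)
qed

text \<open>Both maps send the dilated lifted points, which lie on M, into M. Subtracting the
  defining equations and dividing by t^(m+1) leaves twice the real part of the cross term, a term
  quadratic in D and the difference of the remainders; the last two tend to 0.\<close>

lemma tangency:
  fixes h k :: "'n ambient \<Rightarrow> 'n ambient"
  assumes Dz_def: "Dz = (\<lambda>i p. fst (h p) $ i - fst (k p) $ i)"
    and Dw_def: "Dw = (\<lambda>j p. snd (h p) $ j - snd (k p) $ j)"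
    and W: "open W" "0 \<in> W"
    and hz: "\<And>i. holo_fun (\<lambda>p. fst (h p) $ i) W" and hw: "\<And>j. holo_fun (\<lambda>p. snd (h p) $ j) W"
    and kz: "\<And>i. holo_fun (\<lambda>p. fst (k p) $ i) W" and kw: "\<And>j. holo_fun (\<lambda>p. snd (k p) $ j) W"
    and h0: "h 0 = 0" and k0: "k 0 = 0"
    and hM: "\<And>p. p \<in> W \<Longrightarrow> p \<in> M \<Longrightarrow> h p \<in> M" and kM: "\<And>p. p \<in> W \<Longrightarrow> p \<in> M \<Longrightarrow> k p \<in> M"
    and hU: "\<And>p. p \<in> W \<Longrightarrow> h p \<in> U" and kU: "\<And>p. p \<in> W \<Longrightarrow> k p \<in> U"
    and h1: "\<And>j p. wcoef (\<lambda>p. snd (h p) $ j) 1 p = 0" and k1: "\<And>j p. wcoef (\<lambda>p. snd (k p) $ j) 1 p = 0"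
    and D1: "\<And>i p. wcoef (Dz i) 1 p = 0"
    and m: "\<And>i l p. l < m \<Longrightarrow> wcoef (Dz i) l p = 0" "\<And>j l p. l < m + 1 \<Longrightarrow> wcoef (Dw j) l p = 0"
  shows "Im (wcoef (Dw j) (m + 1) (quadric_point z u)) =
    2 * Re (cdot (\<chi> i. wcoef (\<lambda>p. fst (k p) $ i) 1 (quadric_point z u))
      (A j *v (\<chi> i. wcoef (Dz i) m (quadric_point z u))))"
proof -
  let ?p = "\<lambda>t. dil (of_real t) (lifted_point z u t)" and ?q = "quadric_point z u"
  have Dz: "holo_fun (Dz i) W" for i unfolding Dz_def by (intro holo_fun_diff hz kz)
  have Dw: "holo_fun (Dw j) W" for j unfolding Dw_def by (intro holo_fun_diff hw kw)
  note lim = tendsto_wcoef [OF _ W _ tendsto_lifted_point]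
  have less2: "l < 2 \<Longrightarrow> l = 0 \<or> l = 1" for l :: nat by auto
  have lim_kz: "((\<lambda>t. fst (k (?p t)) $ i / of_real t ^ 1) \<longlongrightarrow> wcoef (\<lambda>p. fst (k p) $ i) 1 ?q) (at_right 0)" for i
    by (rule lim [OF kz]) (simp add: k0)
  have lim_hz: "((\<lambda>t. fst (h (?p t)) $ i / of_real t ^ 1) \<longlongrightarrow> wcoef (\<lambda>p. fst (h p) $ i) 1 ?q) (at_right 0)" for i
    by (rule lim [OF hz]) (simp add: h0)
  have lim_kw: "((\<lambda>t. snd (k (?p t)) $ j / of_real t ^ 2) \<longlongrightarrow> wcoef (\<lambda>p. snd (k p) $ j) 2 ?q) (at_right 0)" for j
    by (rule lim [OF kw]) (auto dest!: less2 simp: k0 k1 simp del: One_nat_def)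
  have lim_hw: "((\<lambda>t. snd (h (?p t)) $ j / of_real t ^ 2) \<longlongrightarrow> wcoef (\<lambda>p. snd (h p) $ j) 2 ?q) (at_right 0)" for j
    by (rule lim [OF hw]) (auto dest!: less2 simp: h0 h1 simp del: One_nat_def)
  have lim_Dz: "((\<lambda>t. Dz i (?p t) / of_real t ^ m) \<longlongrightarrow> wcoef (Dz i) m ?q) (at_right 0)" for i
    by (rule lim [OF Dz]) (simp add: m)
  have lim_Dw: "((\<lambda>t. Dw j (?p t) / of_real t ^ (m + 1)) \<longlongrightarrow> wcoef (Dw j) (m + 1) ?q) (at_right 0)" for j
    by (rule lim [OF Dw]) (simp only: m)
  \<comment> \<open>D = o(t) in z-directions; this makes the quadratic term negligible even when m =
    1.\<close>
  have lim_Dz1: "((\<lambda>t. Dz i (?p t) / of_real t ^ 1) \<longlongrightarrow> 0) (at_right 0)" for i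
  proof -
    have "((\<lambda>t. Dz i (?p t) / of_real t ^ 1) \<longlongrightarrow> wcoef (Dz i) 1 ?q) (at_right 0)"
      by (rule lim [OF Dz]) (simp add: Dz_def h0 k0)
    then show ?thesis by (simp only: D1)
  qed
  define kv where "kv t = fst (k (?p t))" for t
  define hv where "hv t = fst (h (?p t))" for t
  define dv where "dv t = (\<chi> i. Dz i (?p t))" for t
  have hkd: "hv t = kv t + dv t" for t by (simp add: hv_def kv_def dv_def Dz_def vec_eq_iff)
  define Rdiff where "Rdiff t = R j (re_part (h (?p t))) - R j (re_part (k (?p t)))" for t
  \<comment> \<open>The factor t^(m+1) is shared between the two slots so that each has a
    limit.\<close>
  define cross where "cross t = cdot ((1 / of_real t) *s kv t) (A j *v ((1 / of_real t ^ m) *s dv t))"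
    for t :: real
  define quad where "quad t = cdot ((1 / of_real t ^ m) *s dv t) (A j *v ((1 / of_real t) *s dv t))"
    for t :: real
  have vec_lim: "((\<lambda>t. (1 / of_real t ^ n) *s v t) \<longlongrightarrow> (\<chi> i. a i)) (at_right 0)"
    if "\<And>i. ((\<lambda>t. v t $ i / of_real t ^ n) \<longlongrightarrow> a i) (at_right 0)"
    for n and v :: "real \<Rightarrow> complex ^ 'n" and a
    by (rule vec_tendstoI) (use that in \<open>simp add: field_simps\<close>)
  have lk: "((\<lambda>t. (1 / of_real t ^ 1) *s kv t) \<longlongrightarrow> (\<chi> i. wcoef (\<lambda>p. fst (k p) $ i) 1 ?q)) (at_right 0)"
    by (rule vec_lim) (simp only: kv_def lim_kz)
  have ld: "((\<lambda>t. (1 / of_real t ^ m) *s dv t) \<longlongrightarrow> (\<chi> i. wcoef (Dz i) m ?q)) (at_right 0)"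
    by (rule vec_lim) (simp only: dv_def vec_lambda_beta lim_Dz)
  have ld1: "((\<lambda>t. (1 / of_real t ^ 1) *s dv t) \<longlongrightarrow> (\<chi> i. 0)) (at_right 0)"
    by (rule vec_lim) (simp only: dv_def vec_lambda_beta lim_Dz1)
  have lim_cross: "(cross \<longlongrightarrow> cdot (\<chi> i. wcoef (\<lambda>p. fst (k p) $ i) 1 ?q)
      (A j *v (\<chi> i. wcoef (Dz i) m ?q))) (at_right 0)"
    unfolding cross_def [abs_def] using tendsto_cdot [OF lk tendsto_matrix_vector [OF ld]] by simp
  have "(quad \<longlongrightarrow> cdot (\<chi> i. wcoef (Dz i) m ?q) (A j *v (\<chi> i. 0))) (at_right 0)"
    unfolding quad_def [abs_def] using tendsto_cdot [OF ld tendsto_matrix_vector [OF ld1]] by simp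
  moreover have "A j *v (\<chi> i. 0) = 0" by (simp add: matrix_vector_mult_def vec_eq_iff)
  ultimately have lim_quad: "(quad \<longlongrightarrow> 0) (at_right 0)" by simp
  obtain Ckz where Ckz: "Ckz > 0" "\<forall>\<^sub>F t in at_right 0. norm (fst (k (?p t))) \<le> Ckz * t ^ 1"
    by (rule eventually_norm_vec_le [OF lim_kz])
  obtain Chz where Chz: "Chz > 0" "\<forall>\<^sub>F t in at_right 0. norm (fst (h (?p t))) \<le> Chz * t ^ 1"
    by (rule eventually_norm_vec_le [OF lim_hz])
  obtain Ckw where Ckw: "Ckw > 0" "\<forall>\<^sub>F t in at_right 0. norm (snd (k (?p t))) \<le> Ckw * t ^ 2"
    by (rule eventually_norm_vec_le [OF lim_kw])
  obtain Chw where Chw: "Chw > 0" "\<forall>\<^sub>F t in at_right 0. norm (snd (h (?p t))) \<le> Chw * t ^ 2"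
    by (rule eventually_norm_vec_le [OF lim_hw])
  obtain Cz where Cz: "Cz > 0" "\<forall>\<^sub>F t in at_right 0. norm (\<chi> i. Dz i (?p t)) \<le> Cz * t ^ m"
    by (rule eventually_norm_vec_le [where f = "\<lambda>t. \<chi> i. Dz i (?p t)", simplified, OF lim_Dz])
  obtain Cw where Cw: "Cw > 0" "\<forall>\<^sub>F t in at_right 0. norm (\<chi> j. Dw j (?p t)) \<le> Cw * t ^ (m + 1)"
    by (rule eventually_norm_vec_le [where f = "\<lambda>t. \<chi> i. Dw i (?p t)" and m = "m + 1", unfolded vec_lambda_beta, OF lim_Dw])
  define C where "C = Ckz + Chz + Ckw + Chw"
  have C: "C > 0" "Ckz \<le> C" "Chz \<le> C" "Ckw \<le> C" "Chw \<le> C"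
    using Ckz Chz Ckw Chw by (auto simp: C_def)
  have norm_re: "norm (snd (re_part p)) \<le> norm (snd p)" for p :: "'n ambient"
    unfolding re_part_def norm_vec_def snd_conv
    by (intro L2_set_mono) (auto simp: abs_Re_le_cmod)
  have norm_re_diff: "norm (snd (re_part p) - snd (re_part p')) \<le> norm (\<chi> j. snd p $ j - snd p' $ j)"
    for p p' :: "'n ambient"
  proof -
    have "snd (re_part p) - snd (re_part p') = snd (re_part (p - p'))"
      by (simp add: re_part_def vec_eq_iff)
    moreover have "(\<chi> j. snd p $ j - snd p' $ j) = snd (p - p')" by (simp add: vec_eq_iff)
    ultimately show ?thesis using norm_re [of "p - p'"] by simp
  qed
  have lim_R: "((\<lambda>t. Rdiff t / t ^ (m + 1)) \<longlongrightarrow> 0) (at_right 0)"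
  proof (rule tendstoI)
    fix e :: real assume e: "e > 0"
    \<comment> \<open>Cz and Cw bound the increments of z and w in units of t^m and t^(m+1), so the
      total error is half of e.\<close>
    define \<epsilon> where "\<epsilon> = e / (2 * (Cz + Cw))"
    have \<epsilon>: "\<epsilon> > 0" "\<epsilon> * (Cz + Cw) = e / 2" using e Cz(1) Cw(1) by (auto simp: \<epsilon>_def field_simps)
    have est: "\<forall>\<^sub>F t in at_right 0. \<forall>a b. norm (fst a) \<le> C * t \<longrightarrow> norm (snd a) \<le> C * t\<^sup>2 \<longrightarrow>
       norm (fst b) \<le> C * t \<longrightarrow> norm (snd b) \<le> C * t\<^sup>2 \<longrightarrow>
       \<bar>R j b - R j a\<bar> \<le> \<epsilon> * (t * norm (fst b - fst a) + norm (snd b - snd a))"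
      by (rule R.difference_estimate) (use \<epsilon> C in auto)
    show "\<forall>\<^sub>F t in at_right 0. dist (Rdiff t / t ^ (m + 1)) 0 < e"
      using est Ckz(2) Chz(2) Ckw(2) Chw(2) Cz(2) Cw(2) eventually_pos
    proof eventually_elim
      case (elim t)
      have t: "0 < t" using elim by simp
      let ?a = "re_part (k (?p t))" and ?b = "re_part (h (?p t))"
      have mono: "x \<le> C * s" if "x \<le> c * s" "c \<le> C" "s \<ge> 0" for x c s :: real
        using that mult_right_mono [of c C s] by linarith
      have "norm (fst ?a) \<le> C * t" "norm (fst ?b) \<le> C * t"
        using elim C t by (auto simp: re_part_def intro: mono)
      moreover have "norm (snd ?a) \<le> C * t\<^sup>2" "norm (snd ?b) \<le> C * t\<^sup>2"
        using elim C t by (auto intro!: order_trans [OF norm_re] intro: mono)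
      ultimately have "\<bar>Rdiff t\<bar> \<le> \<epsilon> * (t * norm (fst ?b - fst ?a) + norm (snd ?b - snd ?a))"
        unfolding Rdiff_def using elim(1) by blast
      also have "\<dots> \<le> \<epsilon> * (t * (Cz * t ^ m) + Cw * t ^ (m + 1))"
      proof (intro mult_left_mono add_mono)
        have "fst ?b - fst ?a = (\<chi> i. Dz i (?p t))" by (simp add: re_part_def Dz_def vec_eq_iff)
        then show "norm (fst ?b - fst ?a) \<le> Cz * t ^ m" using elim by simp
        show "norm (snd ?b - snd ?a) \<le> Cw * t ^ (m + 1)"
          using norm_re_diff [of "h (?p t)" "k (?p t)"] elim unfolding Dw_def by linarith
      qed (use t \<epsilon> in auto)
      also have "\<dots> = (\<epsilon> * (Cz + Cw)) * t ^ (m + 1)" by (simp add: algebra_simps)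
      also have "\<dots> < e * t ^ (m + 1)" using \<epsilon> e t by simp
      finally show ?case using t by (simp add: dist_norm abs_divide pos_divide_less_eq)
    qed
  qed
  have "((\<lambda>t. Im (Dw j (?p t) / of_real t ^ (m + 1))) \<longlongrightarrow> Im (wcoef (Dw j) (m + 1) ?q)) (at_right 0)"
    by (intro tendsto_Im lim_Dw)
  moreover have "\<forall>\<^sub>F t in at_right 0. Im (Dw j (?p t) / of_real t ^ (m + 1)) =
      2 * Re (cross t) + Re (quad t) + Rdiff t / t ^ (m + 1)"
    using eventually_dil_lifted_point [OF W, of z u] eventually_pos
  proof eventually_elim
    case (elim t)
    have t: "t > 0" using elim by simp
    have "Im (snd (h (?p t)) $ j) = Re (cdot (hv t) (A j *v hv t)) + R j (re_part (h (?p t)))"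
      using mem_M [OF hU] hM elim unfolding hv_def by blast
    moreover have "Im (snd (k (?p t)) $ j) = Re (cdot (kv t) (A j *v kv t)) + R j (re_part (k (?p t)))"
      using mem_M [OF kU] kM elim unfolding kv_def by blast
    moreover have "Re (cdot (hv t) (A j *v hv t)) =
        Re (cdot (kv t) (A j *v kv t)) + 2 * Re (cdot (kv t) (A j *v dv t)) + Re (cdot (dv t) (A j *v dv t))"
    proof -
      have "Re (cdot (dv t) (A j *v kv t)) = Re (cdot (kv t) (A j *v dv t))"
        using arg_cong [OF cdot_hermitian [OF herm, of "dv t" j "kv t"], of Re] by simp
      then show ?thesis unfolding hkd by (simp add: cdot_linear matrix_linear)
    qed
    ultimately have eq: "Im (Dw j (?p t)) =
        2 * Re (cdot (kv t) (A j *v dv t)) + Re (cdot (dv t) (A j *v dv t)) + Rdiff t"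
      by (simp add: Dw_def Rdiff_def)
    have "cross t = cdot (kv t) (A j *v dv t) / of_real (t ^ (m + 1))"
      "quad t = cdot (dv t) (A j *v dv t) / of_real (t ^ (m + 1))"
      by (simp_all add: cross_def quad_def cdot_linear matrix_linear field_simps)
    then have "Re (cross t) = Re (cdot (kv t) (A j *v dv t)) / t ^ (m + 1)"
      "Re (quad t) = Re (cdot (dv t) (A j *v dv t)) / t ^ (m + 1)"
      by (simp_all only: Re_divide_of_real)
    moreover have "Im (Dw j (?p t) / of_real t ^ (m + 1)) = Im (Dw j (?p t)) / t ^ (m + 1)"
      by (simp only: of_real_power [symmetric] Im_divide_of_real)
    ultimately show ?case unfolding eq by (simp add: add_divide_distrib)
  qed
  ultimately have 1: "((\<lambda>t. 2 * Re (cross t) + Re (quad t) + Rdiff t / t ^ (m + 1))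
      \<longlongrightarrow> Im (wcoef (Dw j) (m + 1) ?q)) (at_right 0)"
    by (rule Lim_transform_eventually)
  have 2: "((\<lambda>t. 2 * Re (cross t) + Re (quad t) + Rdiff t / t ^ (m + 1)) \<longlongrightarrow>
      2 * Re (cdot (\<chi> i. wcoef (\<lambda>p. fst (k p) $ i) 1 ?q) (A j *v (\<chi> i. wcoef (Dz i) m ?q)))
      + Re 0 + 0) (at_right 0)"
    by (intro tendsto_add tendsto_mult tendsto_const tendsto_Re lim_cross lim_quad lim_R)
  show ?thesis using tendsto_unique [OF trivial_limit_at_right_real 1 2] by simp
qed

end


section \<open>Automorphism germs\<close>

lemma complex_linear_expansion:
  fixes F :: "('n::finite) ambient \<Rightarrow> complex"
  assumes lin: "linear F" and cl: "\<And>c v. F (cscale c v) = c * F v"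
  shows "F (z, w) = (\<Sum>i\<in>UNIV. z $ i * F (axis i 1, 0)) + (\<Sum>l\<in>UNIV. w $ l * F (0, axis l 1))"
proof -
  have "(z, 0) = (\<Sum>i\<in>UNIV. cscale (z $ i) (axis i 1, 0 :: complex ^ 2))"
    by (rule prod_eqI) (simp_all add: fst_sum snd_sum cscale_def basis_expansion)
  then have "F (z, 0) = (\<Sum>i\<in>UNIV. z $ i * F (axis i 1, 0))"
    by (simp only: linear_sum [OF lin] cl)
  moreover have "(0, w) = (\<Sum>l\<in>UNIV. cscale (w $ l) (0 :: complex ^ 'n, axis l 1))"
    by (rule prod_eqI) (simp_all add: fst_sum snd_sum cscale_def basis_expansion)
  then have "F (0, w) = (\<Sum>l\<in>UNIV. w $ l * F (0, axis l 1))"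
    by (simp only: linear_sum [OF lin] cl)
  moreover have "F (z, w) = F (z, 0) + F (0, w)" by (simp flip: linear_add [OF lin])
  ultimately show ?thesis by simp
qed

lemma bounded_linear_fst_nth: "bounded_linear (\<lambda>v::('n::finite) ambient. fst v $ i)"
  by (rule bounded_linear_compose [OF bounded_linear_vec_nth bounded_linear_fst])

lemma bounded_linear_snd_nth: "bounded_linear (\<lambda>v::('n::finite) ambient. snd v $ i)"
  by (rule bounded_linear_compose [OF bounded_linear_vec_nth bounded_linear_snd])

lemma holo_fun_components:
  assumes "holo_on h W"
  shows "holo_fun (\<lambda>p. fst (h p) $ i) W" "holo_fun (\<lambda>p. snd (h p) $ j) W"
proof -
  have "\<exists>L. (h has_derivative L) (at p) \<and> (\<forall>c v. L (cscale c v) = cscale c (L v))" if "p \<in> W" for p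
    using assms that by (simp add: holo_on_def)
  then show "holo_fun (\<lambda>p. fst (h p) $ i) W" "holo_fun (\<lambda>p. snd (h p) $ j) W"
    unfolding holo_fun_def
    using bounded_linear.has_derivative [OF bounded_linear_fst_nth, of h _ _ i]
      bounded_linear.has_derivative [OF bounded_linear_snd_nth, of h _ _ j]
    by (metis (no_types, lifting) cscale_def fst_conv snd_conv vector_smult_component)+
qed

text \<open>Additivity of \<open>deriv\<close> needs differentiability of the inner partial
  derivatives, supplied by \<open>holomorphic_cpartial_w\<close>.\<close>

lemma cpartial_w_cpartial_w_diff:
  fixes F G :: "('n::finite) ambient \<Rightarrow> complex"
  assumes W: "open W" "0 \<in> W" and F: "holo_fun F W" and G: "holo_fun G W"
  shows "cpartial_w s (cpartial_w l (\<lambda>p. F p - G p)) 0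
    = cpartial_w s (cpartial_w l F) 0 - cpartial_w s (cpartial_w l G) 0"
proof -
  have diff: "cpartial_w l (\<lambda>p. F p - G p) p = cpartial_w l F p - cpartial_w l G p" if p: "p \<in> W" for p
  proof -
    obtain L L' where L: "(F has_derivative L) (at p)" "\<And>c v. L (cscale c v) = c * L v"
      and L': "(G has_derivative L') (at p)" "\<And>c v. L' (cscale c v) = c * L' v"
      using F G p unfolding holo_fun_def by metis
    have "((\<lambda>p. F p - G p) has_derivative (\<lambda>v. L v - L' v)) (at p)"
      by (intro has_derivative_diff L L')
    then have "cpartial_w l (\<lambda>p. F p - G p) p = L (0, axis l 1) - L' (0, axis l 1)"
      by (rule cpartial_w_eq) (simp add: L(2) L'(2) algebra_simps)
    then show ?thesis by (simp add: cpartial_w_eq [OF L] cpartial_w_eq [OF L'])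
  qed
  let ?v = "axis s 1 :: complex ^ 2"
  have d: "(\<lambda>x. cpartial_w l H (0, x *s ?v)) field_differentiable at 0" if H: "holo_fun H W" for H
  proof -
    obtain r where "r > 0" "(\<lambda>x. cpartial_w l H (0, x *s ?v)) holomorphic_on ball 0 r"
      using holomorphic_cpartial_w [OF H W] by blast
    then show ?thesis by (intro holomorphic_on_imp_differentiable_at [of _ "ball 0 r"]) auto
  qed
  have "isCont (\<lambda>x. (0 :: complex ^ 'n, x *s ?v)) 0"
    by (intro continuous_Pair continuous_const linear_continuous_at bounded_linear_smult_left)
  then have "((\<lambda>x. (0 :: complex ^ 'n, x *s ?v)) \<longlongrightarrow> 0) (nhds 0)"
    by (simp add: continuous_at tendsto_nhds_iff flip: zero_prod_def)
  then have "\<forall>\<^sub>F x in nhds 0. (0 :: complex ^ 'n, x *s ?v) \<in> W" using W by (intro topological_tendstoD) auto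
  then have "\<forall>\<^sub>F x in nhds 0. cpartial_w l (\<lambda>p. F p - G p) (0, x *s ?v)
      = cpartial_w l F (0, x *s ?v) - cpartial_w l G (0, x *s ?v)"
    by eventually_elim (rule diff)
  then have "deriv (\<lambda>x. cpartial_w l (\<lambda>p. F p - G p) (0, x *s ?v)) 0
      = deriv (\<lambda>x. cpartial_w l F (0, x *s ?v) - cpartial_w l G (0, x *s ?v)) 0"
    by (rule deriv_cong_ev) simp
  also have "\<dots> = deriv (\<lambda>x. cpartial_w l F (0, x *s ?v)) 0 - deriv (\<lambda>x. cpartial_w l G (0, x *s ?v)) 0"
    by (rule deriv_diff) (use d F G in blast)+
  finally show ?thesis
    unfolding cpartial_w_def [of s] by (subst (1 2 3) axis_smult) simp
qed

definition cadjoint :: "complex ^ 'n ^ 'm \<Rightarrow> complex ^ 'm ^ 'n" where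
  "cadjoint B = (\<chi> i l. cnj (B $ l $ i))"

lemma cdot_cadjoint: "cdot (B *v x) y = cdot x (cadjoint B *v y)"
proof -
  have "cdot (B *v x) y = (\<Sum>l\<in>UNIV. \<Sum>i\<in>UNIV. cnj (B $ l $ i) * cnj (x $ i) * y $ l)"
    by (simp add: cdot_def matrix_vector_mult_def sum_distrib_right)
  also have "\<dots> = (\<Sum>i\<in>UNIV. \<Sum>l\<in>UNIV. cnj (B $ l $ i) * cnj (x $ i) * y $ l)" by (rule sum.swap)
  also have "\<dots> = cdot x (cadjoint B *v y)"
    by (simp add: cdot_def matrix_vector_mult_def cadjoint_def sum_distrib_left mult_ac)
  finally show ?thesis .
qed

text \<open>An injective square matrix is onto, so y = B x, and <y, y> moves onto the
  adjoint.\<close>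

lemma cadjoint_injective:
  fixes B :: "complex ^ 'n::finite ^ 'n"
  assumes inj: "\<And>z. B *v z = 0 \<Longrightarrow> z = 0" and "cadjoint B *v y = 0"
  shows "y = 0"
proof -
  have "inj ((*v) B)"
    by (rule injI) (metis inj eq_iff_diff_eq_0 matrix_vector_mult_diff_distrib)
  then have "surj ((*v) B)"
    using vec.linear_injective_imp_surjective matrix_vector_mul_linear_gen by blast
  then obtain x where "y = B *v x" by (metis surjD)
  then have "cdot y y = cdot x (cadjoint B *v y)" by (metis cdot_cadjoint)
  then show ?thesis using assms(2) by simp
qed

context standard_manifold
begin

lemma derivative_preserves_tangent_space:
  assumes M_0: "0 \<in> M" and W: "open W" "0 \<in> W" and h: "h 0 = 0" "\<And>p. p \<in> W \<Longrightarrow> p \<in> M \<Longrightarrow> h p \<in> M"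
    and L: "(h has_derivative L) (at 0)" and v: "v \<in> tangent_space M 0"
  shows "L v \<in> tangent_space M 0"
proof -
  obtain \<gamma> where \<gamma>: "\<gamma> 0 = 0" "\<And>t. \<gamma> t \<in> M" "(\<gamma> has_vector_derivative v) (at 0)"
    using v unfolding tangent_space_def by blast
  define \<delta> where "\<delta> t = h (if \<gamma> t \<in> W then \<gamma> t else 0)" for t
  have mem: "\<delta> t \<in> M" for t using h M_0 \<gamma>(2) by (simp add: \<delta>_def)
  have "((\<lambda>t. h (\<gamma> t)) has_derivative (\<lambda>s. L (s *\<^sub>R v))) (at 0)"
    using \<gamma>(3) unfolding has_vector_derivative_def
    by (rule has_derivative_compose) (use L \<gamma>(1) in simp)
  then have d: "((\<lambda>t. h (\<gamma> t)) has_vector_derivative L v) (at 0)"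
    by (simp add: has_vector_derivative_def linear_scale [OF has_derivative_linear [OF L]])
  have "isCont \<gamma> 0" using \<gamma>(3) has_vector_derivative_continuous by blast
  then have "(\<gamma> \<longlongrightarrow> 0) (nhds 0)" by (simp add: continuous_at tendsto_nhds_iff \<gamma>(1))
  then have "\<forall>\<^sub>F t in nhds 0. \<gamma> t \<in> W" using W by (intro topological_tendstoD) auto
  then have "(\<delta> has_vector_derivative L v) (at 0)"
    using d by (subst has_vector_derivative_cong_ev)
      (auto elim: eventually_mono simp: \<delta>_def \<gamma>(1) h(1) W(2))
  from tangent_space_0 [OF mem this] show ?thesis by (simp add: \<delta>_def \<gamma>(1) h(1) W(2))
qed

text \<open>The last two clauses say that the derivative maps the complex tangent space w = 0 at the
  origin injectively into itself; hence w-components have no part of weight 1.\<close>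

definition local_automorphism where
  "local_automorphism h W L \<longleftrightarrow> open W \<and> 0 \<in> W \<and> holo_on h W \<and> (\<forall>p\<in>W. h p \<in> U) \<and>
    (\<forall>p\<in>W. p \<in> M \<longrightarrow> h p \<in> M) \<and> h 0 = 0 \<and> (h has_derivative L) (at 0) \<and>
    (\<forall>c v. L (cscale c v) = cscale c (L v)) \<and> (\<forall>z. snd (L (z, 0)) = 0) \<and>
    (\<forall>z. fst (L (z, 0)) = 0 \<longrightarrow> z = 0)"

text \<open>The chain rule for h' after h makes the derivative L injective, and L preserves the
  tangent space Im w = 0. Shrinking the domain keeps the image in U.\<close>

lemma Aut0_local:
  assumes h: "h \<in> Aut0 M" and M_0: "0 \<in> M"
  shows "\<exists>W L. local_automorphism h W L"
proof -
  obtain W' h' where W': "open W'" "0 \<in> W'" "holo_on h W'" "open (h ` W')" "holo_on h' (h ` W')"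
    "\<And>p. p \<in> W' \<Longrightarrow> h' (h p) = p" "h ` (M \<inter> W') \<subseteq> M" and h0: "h 0 = 0"
    using h unfolding Aut0_def by auto
  obtain L where L: "(h has_derivative L) (at 0)" "\<And>c v. L (cscale c v) = cscale c (L v)"
    using W'(2,3) unfolding holo_on_def by blast
  have "h 0 \<in> h ` W'" using W'(2) by blast
  then obtain L' where L': "(h' has_derivative L') (at (h 0))"
    using W'(5) unfolding holo_on_def by blast
  have "((\<lambda>p. h' (h p)) has_derivative (\<lambda>v. L' (L v))) (at 0)"
    by (rule has_derivative_compose [OF L(1) L'])
  moreover have "((\<lambda>p. h' (h p)) has_derivative (\<lambda>v. v)) (at 0)"
    by (rule has_derivative_transform_within_open [OF has_derivative_ident W'(1,2)]) (simp add: W'(6))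
  ultimately have "(\<lambda>v. L' (L v)) = (\<lambda>v. v)" by (rule has_derivative_unique)
  then have inj: "v = 0" if "L v = 0" for v
    using that linear_0 [OF has_derivative_linear [OF L']] by metis
  have cont: "continuous_on W' h"
    using W'(3) unfolding holo_on_def
    by (meson continuous_at_imp_continuous_on has_derivative_continuous)
  define W where "W = W' \<inter> h -` U"
  have W: "open W" "0 \<in> W"
    using continuous_open_preimage [OF cont W'(1) U(1)] W'(2) U(2) h0 by (auto simp: W_def)
  have holo: "holo_on h W" using W'(3) by (simp add: W_def holo_on_def)
  have hM: "h p \<in> M" if "p \<in> W" "p \<in> M" for p using that W'(7) by (auto simp: W_def)
  have tangent: "Im (snd (L (z, 0)) $ j) = 0" for z j
  proof -
    have "(z, \<chi> j. complex_of_real ((0 :: real ^ 2) $ j)) \<in> tangent_space M 0"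
      by (rule tangent_space_at_0I [OF M_0])
    then have "(z, 0) \<in> tangent_space M 0" by (simp add: zero_vec_def)
    from tangent_at_0 [OF M_0 derivative_preserves_tangent_space [OF M_0 W h0 hM L(1) this]]
    show ?thesis .
  qed
  \<comment> \<open>Tangency at z and at \<i> z together with complex linearity removes both the
    imaginary and the real part.\<close>
  have snd0: "snd (L (z, 0)) = 0" for z
  proof -
    have "L (\<i> *s z, 0) = cscale \<i> (L (z, 0))" using L(2) [of \<i> "(z, 0)"] by (simp add: cscale_def)
    then have "Im (snd (cscale \<i> (L (z, 0))) $ j) = 0" for j using tangent [of "\<i> *s z" j] by simp
    then show ?thesis using tangent [of z] by (simp add: cscale_def vec_eq_iff complex_eq_iff)
  qed
  have "z = 0" if "fst (L (z, 0)) = 0" for z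
  proof -
    have "L (z, 0) = 0" using that snd0 [of z] by (simp add: prod_eq_iff)
    then show ?thesis using inj by (metis fst_conv fst_zero)
  qed
  with W holo hM h0 L snd0 show ?thesis
    unfolding local_automorphism_def by (intro exI [of _ W] exI [of _ L]) (auto simp: W_def)
qed

theorem germ_determined:
  fixes h k :: "'n ambient \<Rightarrow> 'n ambient"
  assumes M_0: "0 \<in> M" and type: "finite_type_2 M 0"
    and nondeg: "levi_nondegenerate A"
    and h: "h \<in> Aut0 M" and k: "k \<in> Aut0 M"
    and fz: "\<And>j i. cpartial_z i (f_comp h j) 0 = cpartial_z i (f_comp k j) 0"
    and fw: "\<And>j l. cpartial_w l (f_comp h j) 0 = cpartial_w l (f_comp k j) 0"
    and gw: "\<And>u l. cpartial_w l (g_comp h u) 0 = cpartial_w l (g_comp k u) 0"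
    and gww: "\<And>u s l. cpartial_w s (cpartial_w l (g_comp h u)) 0
                  = cpartial_w s (cpartial_w l (g_comp k u)) 0"
  shows "germ_eq h k"
proof -
  obtain Wh Lh where "local_automorphism h Wh Lh" using Aut0_local [OF h M_0] by blast
  then have Wh: "open Wh" "0 \<in> Wh" "holo_on h Wh" "\<And>p. p \<in> Wh \<Longrightarrow> h p \<in> U"
    "\<And>p. p \<in> Wh \<Longrightarrow> p \<in> M \<Longrightarrow> h p \<in> M" "h 0 = 0"
    and Lh: "(h has_derivative Lh) (at 0)" "\<And>c v. Lh (cscale c v) = cscale c (Lh v)"
      "\<And>z. snd (Lh (z, 0)) = 0" "\<And>z. fst (Lh (z, 0)) = 0 \<Longrightarrow> z = 0"
    unfolding local_automorphism_def by blast+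
  obtain Wk Lk where "local_automorphism k Wk Lk" using Aut0_local [OF k M_0] by blast
  then have Wk: "open Wk" "0 \<in> Wk" "holo_on k Wk" "\<And>p. p \<in> Wk \<Longrightarrow> k p \<in> U"
    "\<And>p. p \<in> Wk \<Longrightarrow> p \<in> M \<Longrightarrow> k p \<in> M" "k 0 = 0"
    and Lk: "(k has_derivative Lk) (at 0)" "\<And>c v. Lk (cscale c v) = cscale c (Lk v)"
      "\<And>z. snd (Lk (z, 0)) = 0" "\<And>z. fst (Lk (z, 0)) = 0 \<Longrightarrow> z = 0"
    unfolding local_automorphism_def by blast+
  define W where "W = Wh \<inter> Wk"
  have W: "open W" "0 \<in> W" using Wh Wk by (auto simp: W_def)
  have holo: "holo_on h W" "holo_on k W" using Wh(3) Wk(3) by (auto simp: W_def holo_on_def)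
  define Dz where "Dz i p = fst (h p) $ i - fst (k p) $ i" for i p
  define Dw where "Dw j p = snd (h p) $ j - snd (k p) $ j" for j p
  have holo_Dz: "holo_fun (Dz i) W" for i
    unfolding Dz_def [abs_def] by (intro holo_fun_diff holo_fun_components holo)
  have holo_Dw: "holo_fun (Dw j) W" for j
    unfolding Dw_def [abs_def] by (intro holo_fun_diff holo_fun_components holo)
  define lz where "lz i v = fst (Lh v) $ i - fst (Lk v) $ i" for i v
  define lw where "lw j v = snd (Lh v) $ j - snd (Lk v) $ j" for j v
  have der_z: "((\<lambda>p. fst (F p) $ i) has_derivative (\<lambda>v. fst (L v) $ i)) (at p)"
    if "(F has_derivative L) (at p)" for F :: "'n ambient \<Rightarrow> 'n ambient" and L p i
    by (rule bounded_linear.has_derivative [OF bounded_linear_fst_nth that])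
  have der_w: "((\<lambda>p. snd (F p) $ j) has_derivative (\<lambda>v. snd (L v) $ j)) (at p)"
    if "(F has_derivative L) (at p)" for F :: "'n ambient \<Rightarrow> 'n ambient" and L p j
    by (rule bounded_linear.has_derivative [OF bounded_linear_snd_nth that])
  have lz: "(Dz i has_derivative lz i) (at 0)" "lz i (cscale c v) = c * lz i v" for i c v
    unfolding Dz_def [abs_def] lz_def [abs_def] Lh(2) Lk(2)
    by (auto intro!: has_derivative_diff der_z Lh Lk simp: cscale_def algebra_simps)
  have lw: "(Dw j has_derivative lw j) (at 0)" "lw j (cscale c v) = c * lw j v" for j c v
    unfolding Dw_def [abs_def] lw_def [abs_def] Lh(2) Lk(2)
    by (auto intro!: has_derivative_diff der_w Lh Lk simp: cscale_def algebra_simps)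
  have f_comp: "(f_comp F i has_derivative (\<lambda>v. fst (L v) $ i - fst v $ i)) (at 0)"
    if "(F has_derivative L) (at 0)" for F :: "'n ambient \<Rightarrow> 'n ambient" and L i
  proof -
    have "f_comp F i = (\<lambda>p. fst (F p) $ i - fst p $ i)" by (simp add: f_comp_def [abs_def])
    then show ?thesis
      using has_derivative_diff [OF der_z [OF that] der_z [OF has_derivative_ident]] by simp
  qed
  have g_comp: "(g_comp F i has_derivative (\<lambda>v. snd (L v) $ i - snd v $ i)) (at 0)"
    if "(F has_derivative L) (at 0)" for F :: "'n ambient \<Rightarrow> 'n ambient" and L i
  proof -
    have "g_comp F i = (\<lambda>p. snd (F p) $ i - snd p $ i)" by (simp add: g_comp_def [abs_def])
    then show ?thesis
      using has_derivative_diff [OF der_w [OF that] der_w [OF has_derivative_ident]] by simp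
  qed
  have cl_f: "fst (L (cscale c v)) $ i - fst (cscale c v) $ i = c * (fst (L v) $ i - fst v $ i)"
    and cl_g: "snd (L (cscale c v)) $ j - snd (cscale c v) $ j = c * (snd (L v) $ j - snd v $ j)"
    if "\<And>c v. L (cscale c v) = cscale c (L v)" for L :: "'n ambient \<Rightarrow> 'n ambient" and c v i j
    unfolding that by (simp_all add: cscale_def algebra_simps)
  have lz0: "lz i (z, w) = 0" for i z w
  proof -
    have "lz i (axis l 1, 0) = 0" for l
      using fz [of l i] unfolding cpartial_z_eq [OF f_comp [OF Lh(1)] cl_f [OF Lh(2)]]
        cpartial_z_eq [OF f_comp [OF Lk(1)] cl_f [OF Lk(2)]] by (simp add: lz_def)
    moreover have "lz i (0, axis l 1) = 0" for l
      using fw [of l i] unfolding cpartial_w_eq [OF f_comp [OF Lh(1)] cl_f [OF Lh(2)]]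
        cpartial_w_eq [OF f_comp [OF Lk(1)] cl_f [OF Lk(2)]] by (simp add: lz_def)
    ultimately show ?thesis
      by (subst complex_linear_expansion [OF has_derivative_linear [OF lz(1)] lz(2)]) simp
  qed
  \<comment> \<open>The z-derivatives of g are not prescribed; they agree because both derivatives
    preserve w = 0.\<close>
  have lw0: "lw j (z, w) = 0" for j z w
  proof -
    have "lw j (axis l 1, 0) = 0" for l by (simp add: lw_def Lh Lk)
    moreover have "lw j (0, axis l 1) = 0" for l
      using gw [of l j] unfolding cpartial_w_eq [OF g_comp [OF Lh(1)] cl_g [OF Lh(2)]]
        cpartial_w_eq [OF g_comp [OF Lk(1)] cl_g [OF Lk(2)]] by (simp add: lw_def)
    ultimately show ?thesis
      by (subst complex_linear_expansion [OF has_derivative_linear [OF lw(1)] lw(2)]) simp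
  qed
  have second: "cpartial_w s (cpartial_w l (Dw j)) 0 = 0" for s l j
  proof -
    have "holo_on (\<lambda>p::'n ambient. p) W"
      unfolding holo_on_def using has_derivative_ident by blast
    then have id: "holo_fun (\<lambda>p::'n ambient. snd p $ j) W" by (rule holo_fun_components(2))
    have "g_comp F j = (\<lambda>p. snd (F p) $ j - snd p $ j)" for F :: "'n ambient \<Rightarrow> _"
      by (simp add: g_comp_def [abs_def])
    then have "holo_fun (g_comp h j) W" "holo_fun (g_comp k j) W"
      by (auto intro!: holo_fun_diff holo_fun_components holo id)
    from cpartial_w_cpartial_w_diff [OF W this, of s l]
    have "cpartial_w s (cpartial_w l (\<lambda>p. g_comp h j p - g_comp k j p)) 0 = 0" by (simp add: gww)
    moreover have "(\<lambda>p. g_comp h j p - g_comp k j p) = Dw j"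
      by (simp add: g_comp_def Dw_def fun_eq_iff)
    ultimately show ?thesis by simp
  qed
  have D1: "wcoef (Dz i) 1 p = 0" "wcoef (Dw j) 1 p = 0" for i j p
    using wcoef_1 [OF lz] wcoef_1 [OF lw] by (simp_all only: lz0 lw0)
  have D0: "Dz i 0 = 0" "Dw j 0 = 0" for i j by (simp_all add: Dz_def Dw_def Wh Wk)
  have h1: "wcoef (\<lambda>p. snd (h p) $ j) 1 p = 0" and k1: "wcoef (\<lambda>p. snd (k p) $ j) 1 p = 0" for j p
  proof -
    have "wcoef (\<lambda>p. snd (h p) $ j) 1 p = snd (Lh (fst p, 0)) $ j"
      by (rule wcoef_1 [OF der_w [OF Lh(1)]]) (simp only: Lh(2), simp add: cscale_def)
    then show "wcoef (\<lambda>p. snd (h p) $ j) 1 p = 0" by (simp only: Lh(3) zero_index)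
    have "wcoef (\<lambda>p. snd (k p) $ j) 1 p = snd (Lk (fst p, 0)) $ j"
      by (rule wcoef_1 [OF der_w [OF Lk(1)]]) (simp only: Lk(2), simp add: cscale_def)
    then show "wcoef (\<lambda>p. snd (k p) $ j) 1 p = 0" by (simp only: Lk(3) zero_index)
  qed
  \<comment> \<open>The z-block of the derivative of k, the weight 1 part of its z-component; the
    w-block has weight 2 and does not contribute.\<close>
  define B where "B = (\<chi> i l. fst (Lk (axis l 1, 0)) $ i)"
  have B: "(B *v z) $ i = fst (Lk (z, 0)) $ i" for z i
  proof -
    have "fst (Lk (z, 0)) $ i = (\<Sum>l\<in>UNIV. z $ l * fst (Lk (axis l 1, 0)) $ i)
        + (\<Sum>l\<in>UNIV. (0 :: complex ^ 2) $ l * fst (Lk (0, axis l 1)) $ i)"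
      by (rule complex_linear_expansion [OF has_derivative_linear [OF der_z [OF Lk(1)]]])
         (simp only: Lk(2), simp add: cscale_def)
    then show ?thesis by (simp add: B_def matrix_vector_mult_def mult.commute)
  qed
  have k_lin: "(\<chi> i. wcoef (\<lambda>p. fst (k p) $ i) 1 p) = B *v fst p" for p
  proof -
    have "wcoef (\<lambda>p. fst (k p) $ i) 1 p = fst (Lk (fst p, 0)) $ i" for i
      by (rule wcoef_1 [OF der_z [OF Lk(1)]]) (simp only: Lk(2), simp add: cscale_def)
    then show ?thesis by (simp only: vec_eq_iff vec_lambda_beta B simp_thms)
  qed
  have B_inj: "z = 0" if "B *v z = 0" for z
  proof -
    have "fst (Lk (z, 0)) $ i = 0" for i using that B [of z i] by simp
    then show ?thesis using Lk(4) by (simp add: vec_eq_iff)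
  qed
  \<comment> \<open>The adjoint moves B from the first slot of the pairing to the second.\<close>
  define K where "K j = cadjoint B ** A j" for j
  have K: "K j *v x = cadjoint B *v (A j *v x)" for j x by (simp add: K_def matrix_vector_mul_assoc)
  have A_nondeg: "z = 0" if "A 1 *v z = 0" "A 2 *v z = 0" for z
    using nondeg that unfolding levi_nondegenerate_def by blast
  have A_indep: "x = 0 \<and> y = 0"
    if "\<And>z. complex_of_real x *s (A 1 *v z) + of_real y *s (A 2 *v z) = 0" for x y
    by (rule finite_type_independent [OF that M_0 type])
  have A_cindep: "c = 0 \<and> d = 0" if eq: "\<And>z. c *s (A 1 *v z) = d *s (A 2 *v z)" for c d
  proof -
    have e: "c * cdot u (A 1 *v z) = d * cdot u (A 2 *v z)" for u z
      using arg_cong [OF eq, of "cdot u"] by (simp add: cdot_linear)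
    \<comment> \<open>For Hermitian matrices conjugation gives a second relation with cnj c, cnj d;
      sum and difference separate real and imaginary parts.\<close>
    have e': "cnj c * cdot u (A 1 *v z) = cnj d * cdot u (A 2 *v z)" for u z
      using arg_cong [OF e [of z u], of cnj] cdot_hermitian [OF herm, of u _ z] by simp
    have "of_real (Re c) *s (A 1 *v z) + of_real (- Re d) *s (A 2 *v z) = 0" for z
    proof (rule cdot_eq_0_imp)
      fix u
      have "(c + cnj c) * cdot u (A 1 *v z) = (d + cnj d) * cdot u (A 2 *v z)"
        using e e' by (simp add: distrib_right)
      then show "cdot u (of_real (Re c) *s (A 1 *v z) + of_real (- Re d) *s (A 2 *v z)) = 0"
        by (simp add: complex_add_cnj cdot_linear)
    qed
    from A_indep [OF this] have re: "Re c = 0" "Re d = 0" by auto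
    have "of_real (Im c) *s (A 1 *v z) + of_real (- Im d) *s (A 2 *v z) = 0" for z
    proof (rule cdot_eq_0_imp)
      fix u
      have "(c - cnj c) * cdot u (A 1 *v z) = (d - cnj d) * cdot u (A 2 *v z)"
        using e e' by (simp add: left_diff_distrib)
      then show "cdot u (of_real (Im c) *s (A 1 *v z) + of_real (- Im d) *s (A 2 *v z)) = 0"
        by (simp add: complex_diff_cnj cdot_linear)
    qed
    from A_indep [OF this] have "Im c = 0" "Im d = 0" by auto
    with re show ?thesis by (simp add: complex_eq_iff)
  qed
  have K_nondeg: "z = 0" if "\<And>j. K j *v z = 0" for z
    using that A_nondeg cadjoint_injective [OF B_inj] unfolding K by blast
  have K_indep: "c = 0 \<and> d = 0" if "\<And>z. c *s (K 1 *v z) = d *s (K 2 *v z)" for c d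
  proof (rule A_cindep)
    fix z
    have "cadjoint B *v (c *s (A 1 *v z) - d *s (A 2 *v z)) = 0"
      using that [of z] unfolding K by (simp add: matrix_linear)
    from cadjoint_injective [OF B_inj this] show "c *s (A 1 *v z) = d *s (A 2 *v z)" by simp
  qed
  \<comment> \<open>Dw runs one weight ahead of Dz, matching the weights m and m + 1 of the leading
    terms.\<close>
  define vanish where "vanish m \<longleftrightarrow>
    (\<forall>i l p. l < m \<longrightarrow> wcoef (Dz i) l p = 0) \<and> (\<forall>j l p. l < m + 1 \<longrightarrow> wcoef (Dw j) l p = 0)" for m
  have step: "vanish (Suc m)" if m: "m \<ge> 1" and v: "vanish m" for m
  proof -
    have vz: "l < m \<Longrightarrow> wcoef (Dz i) l p = 0" and vw: "l < m + 1 \<Longrightarrow> wcoef (Dw j) l p = 0" for l i j p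
      using v unfolding vanish_def by blast+
    define f where "f p = (\<chi> i. wcoef (Dz i) m p)" for p
    define g where "g p = (\<chi> j. wcoef (Dw j) (m + 1) p)" for p
    interpret homogeneous_tangency A K f g m
    proof
      show "curve_entire (\<lambda>p. f p $ i)" for i
        unfolding f_def by (simp add: curve_entire_wcoef [OF holo_Dz W vz])
      show "curve_entire (\<lambda>p. g p $ j)" for j
        unfolding g_def vec_lambda_beta by (rule curve_entire_wcoef [OF holo_Dw W vw])
      show "f (t *s z, t\<^sup>2 *s w) = t ^ m *s f (z, w)" for t z w
        using wcoef_dil [OF holo_Dz W vz, where s = t and p = "(z, w)"] by (simp add: f_def vec_eq_iff)
      show "g (t *s z, t\<^sup>2 *s w) = t ^ (m + 1) *s g (z, w)" for t z w
        using wcoef_dil [OF holo_Dw W vw, where s = t and p = "(z, w)"] by (simp add: g_def vec_eq_iff)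
      show "Im (g (z, w) $ j) = 2 * Re (cdot z (K j *v f (z, w)))"
        if "\<And>l. complex_of_real (Im (w $ l)) = cdot z (A l *v z)" for z w j
      proof -
        let ?q = "quadric_point z (\<chi> l. Re (w $ l))"
        have "Im (wcoef (Dw j) (m + 1) ?q) =
            2 * Re (cdot (\<chi> i. wcoef (\<lambda>p. fst (k p) $ i) 1 ?q) (A j *v (\<chi> i. wcoef (Dz i) m ?q)))"
          by (rule tangency [OF _ _ W holo_fun_components(1) [OF holo(1)]
                holo_fun_components(2) [OF holo(1)] holo_fun_components(1) [OF holo(2)]
                holo_fun_components(2) [OF holo(2)] Wh(6) Wk(6) _ _ _ _ h1 k1 D1(1) vz vw])
             (use Wh(4,5) Wk(4,5) in \<open>simp_all add: W_def Dz_def [abs_def] Dw_def [abs_def]\<close>)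
        then show ?thesis
          unfolding k_lin quadric_pointI [OF that, symmetric] K f_def g_def
          by (simp add: cdot_cadjoint)
      qed
    qed (use herm A_indep A_nondeg K_nondeg K_indep m in blast)+
    \<comment> \<open>The prescribed derivatives enter here: weight 2 on the axis is the
      w-derivative of g, weight 4 collects its second w-derivatives.\<close>
    have g0: "g (0, w) = 0" if "m = 1 \<or> m = 3" for w
      using that
    proof
      assume "m = 1"
      then have "wcoef (Dw j) 2 (0, w) = lw j (0, w)" for j
        using vw by (intro wcoef_2_axis [OF holo_Dw W _ lw]) simp
      then show ?thesis using \<open>m = 1\<close> by (simp add: g_def vec_eq_iff lw0 numeral_2_eq_2)
    next
      assume "m = 3"
      then have "wcoef (Dw j) 4 (0, w) = 0" for j
        using vw by (intro wcoef_4_axis_eq_0 [OF holo_Dw W _ second]) simp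
      then show ?thesis using \<open>m = 3\<close> by (simp add: g_def vec_eq_iff)
    qed
    have f0: "f (0, w) = 0" if "m = 2" for w
    proof -
      have "wcoef (Dz i) 2 (0, w) = lz i (0, w)" for i
        using vz that by (intro wcoef_2_axis [OF holo_Dz W _ lz]) simp
      then show ?thesis using that by (simp add: f_def vec_eq_iff lz0)
    qed
    have f1: "f (z, w) = 0" if "m = 1" for z w
      unfolding f_def that D1 by (simp add: vec_eq_iff)
    have fg: "f (z, w) = 0" "g (z, w) = 0" for z w
      by (rule vanishing [OF g0 f0 f1]; assumption)+
    have "wcoef (Dz i) m p = 0" for i p
      using arg_cong [OF fg(1) [of "fst p" "snd p"], of "\<lambda>v. v $ i"] by (simp add: f_def)
    moreover have "wcoef (Dw j) (m + 1) p = 0" for j p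
      using arg_cong [OF fg(2) [of "fst p" "snd p"], of "\<lambda>v. v $ j"] by (simp add: g_def)
    ultimately show ?thesis
      unfolding vanish_def using vz vw by (metis Suc_eq_plus1 less_Suc_eq)
  qed
  have vanish_all: "vanish (Suc m)" for m
  proof (induction m)
    case 0
    \<comment> \<open>Weight 0 vanishes as both maps fix the origin; weight 1 of Dw is the z-linear
      part treated above.\<close>
    show ?case using D0 D1 unfolding vanish_def by (auto simp: less_Suc_eq)
  next
    case (Suc m)
    then show ?case using step [of "Suc m"] by simp
  qed
  have "wcoef (Dz i) l p = 0" "wcoef (Dw j) l p = 0" for i j l p
    using vanish_all [of l] unfolding vanish_def by auto
  then have "\<forall>\<^sub>F p in nhds 0. Dz i p = 0" "\<forall>\<^sub>F p in nhds 0. Dw j p = 0" for i j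
    by (auto intro: all_wcoef_0_imp [OF holo_Dz W] all_wcoef_0_imp [OF holo_Dw W])
  then have "\<forall>\<^sub>F p in nhds 0. (\<forall>i. Dz i p = 0) \<and> (\<forall>j. Dw j p = 0)"
    by (intro eventually_conj eventually_all_finite)
  then show ?thesis
    unfolding germ_eq_def
    by eventually_elim (simp add: Dz_def Dw_def prod_eq_iff vec_eq_iff)
qed

end

theorem theorem1p1:
  fixes M :: "('n::finite) ambient set"
    and A :: "2 \<Rightarrow> complex ^ 'n ^ 'n"
    and R :: "2 \<Rightarrow> (complex ^ 'n) \<times> (real ^ 2) \<Rightarrow> real"
    and h k :: "'n ambient \<Rightarrow> 'n ambient"
  assumes "generic_C3_submanifold_codim2 M" and "0 \<in> M"
    and "finite_type_2 M 0"
    and "standard_coordinates M A R"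
    and "levi_nondegenerate A"
    and "h \<in> Aut0 M" and "k \<in> Aut0 M"
    and "\<forall>j i. cpartial_z i (f_comp h j) 0 = cpartial_z i (f_comp k j) 0"
    and "\<forall>j l. cpartial_w l (f_comp h j) 0 = cpartial_w l (f_comp k j) 0"
    and "\<forall>u l. cpartial_w l (g_comp h u) 0 = cpartial_w l (g_comp k u) 0"
    and "\<forall>u s l. cpartial_w s (cpartial_w l (g_comp h u)) 0
                  = cpartial_w s (cpartial_w l (g_comp k u)) 0"
  shows "germ_eq h k"
proof -
  obtain U V where UV: "open U" "0 \<in> U" "open V" "0 \<in> V"
    "\<forall>j. Ck_on 3 (R j) V \<and> vanishes_to_weighted_order_2 (R j)"
    "\<forall>(z, w) \<in> U. (z, \<chi> l. Re (w $ l)) \<in> V"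
    "M \<inter> U = {(z, w). (z, w) \<in> U \<and>
          (\<forall>j. complex_of_real (Im (w $ j)) =
                 hermitian_form (A j) z + complex_of_real (R j (z, \<chi> l. Re (w $ l))))}"
    and herm: "\<forall>j. hermitian_matrix (A j)"
    using assms(4) unfolding standard_coordinates_def by blast
  interpret standard_manifold M A R U V
  proof
    show "re_part p \<in> V" if "p \<in> U" for p
      using bspec [OF UV(6) that] by (simp add: re_part_def split_beta)
    show "p \<in> M \<longleftrightarrow> (\<forall>j. complex_of_real (Im (snd p $ j)) =
        hermitian_form (A j) (fst p) + complex_of_real (R j (re_part p)))" if "p \<in> U" for p
    proof -
      have "p \<in> M \<longleftrightarrow> p \<in> M \<inter> U" using that by blast
      then show ?thesis unfolding UV(7) using that by (simp add: split_beta re_part_def)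
    qed
  qed (use UV herm in auto)
  show ?thesis
    by (rule germ_determined) (use assms in blast)+
qed


end
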